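(* Let $\Lambda$ be a $\sigma$-compact metric space, let $\sigma$ be a positive diffuse Radon measure on $\Lambda$, and let $\mu_\sigma$ be the Poisson measure of intensity $\sigma$ on the configuration space $\Gamma_\Lambda$. Let $L$ be the density, with respect to $\mu_\sigma$, of an absolutely continuous probability measure $\nu$ on $\Gamma_\Lambda$, and assume that $L\in \operatorname{Dom}\nabla^\sharp$ and $\nabla^\sharp L\in L^1(\mu_\sigma\otimes\sigma)$. Then $$\mathcal{T}_{\rho_1}(\mu_\sigma,\nu)\le \mathbb{E}_{\mu_\sigma}\left[\int_\Lambda |\nabla^\sharp_x L|\, d\sigma(x)\right].$$ The same inequality also holds for the trivial distance $\rho_0$, i.e. with $\mathcal{T}_{\rho_0}(\mu_\sigma,\nu)$ in place of $\mathcal{T}_{\rho_1}(\mu_\sigma,\nu)$.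
   Context: $\Gamma_\Lambda=\{\omega\subset\Lambda : \omega\cap K \text{ is finite for every compact } K\}$ is the configuration space, with $\omega\in\Gamma_\Lambda$ identified with the Radon measure $\sum_{x\in\omega}\varepsilon_x$ ($\varepsilon_a$ is the Dirac mass at $a$). It carries the vague topology (the weakest topology making $\omega\mapsto\int_\Lambda f\,d\omega$ continuous for every continuous compactly supported $f$) and its Borel $\sigma$-algebra. The Poisson measure $\mu_\sigma$ is characterized by $\mathbb{E}_{\mu_\sigma}[\exp(\int_\Lambda f\,d\omega)]=\exp\{\int_\Lambda(e^f-1)\,d\sigma\}$ for all continuous compactly supported $f$. Distances (possibly infinite) on $\Gamma_\Lambda$: the trivial distance $\rho_0(\omega,\eta)=\mathbf 1_{\{\omega\ne\eta\}}$, and the total variation distance $\rho_1(\omega,\eta)=\sum_{x\in\Lambda}|\omega(\{x\})-\eta(\{x\})|$, i.e. the number of points belonging to exactly one of $\omega,\eta$. For a distance $\rho$, the Rubinstein distance is $\mathcal{T}_\rho(\mu,\nu)=\inf_{\gamma}\int\int\rho(\omega,\eta)\,d\gamma(\omega,\eta)$, the infimum running over all probability measures $\gamma$ on $\Gamma_\Lambda\times\Gamma_\Lambda$ with marginals $\mu$ and $\nu$. Discrete gradient: $\nabla^\sharp_xF(\omega)=F(\omega+\varepsilon_x)-F(\omega)$ for $(\omega,x)\in\Gamma_\Lambda\times\Lambda$; $\operatorname{Dom}\nabla^\sharp$ is the set of $F\in L^2(\mu_\sigma)$ such that $\mathbb{E}_{\mu_\sigma}[\int_\Lambda|\nabla^\sharp_xF|^2\,d\sigma(x)]<+\infty$.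 *)

theory Defs
  imports "HOL-Probability.Probability"
begin

text \<open>The metric space \<open>\<Lambda>\<close> is the universe of a type of class \<^class>\<open>metric_space\<close>.\<close>

definition sigma_compact_space :: "'a::metric_space itself \<Rightarrow> bool" where
  "sigma_compact_space _ \<longleftrightarrow>
     (\<exists>K :: nat \<Rightarrow> 'a set. (\<forall>n. compact (K n)) \<and> (\<Union>n. K n) = UNIV)"

definition radon_measure :: "'a::metric_space measure \<Rightarrow> bool" where
  "radon_measure \<sigma> \<longleftrightarrow>
     sets \<sigma> = sets borel \<and>
     (\<forall>K. compact K \<longrightarrow> emeasure \<sigma> K < \<infinity>) \<and>
     (\<forall>B \<in> sets borel. emeasure \<sigma> B = (SUP K \<in> {K. compact K \<and> K \<subseteq> B}. emeasure \<sigma> K))"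

definition diffuse_measure :: "'a::metric_space measure \<Rightarrow> bool" where
  "diffuse_measure \<sigma> \<longleftrightarrow> (\<forall>x. emeasure \<sigma> {x} = 0)"

definition Cc :: "('a::metric_space \<Rightarrow> real) set" where
  "Cc = {f. continuous_on UNIV f \<and> compact (closure {x. f x \<noteq> 0})}"


subsection \<open>Configuration space\<close>

definition configurations :: "'a::metric_space set set" where
  "configurations = {\<omega>. \<forall>K. compact K \<longrightarrow> finite (\<omega> \<inter> K)}"

text \<open>The Borel measure \<open>\<Sum>x\<in>\<omega>. \<epsilon>\<^sub>x\<close>, as the image of the counting measure of \<open>\<omega>\<close> under the
  inclusion of \<open>\<omega>\<close> into the whole space; see \<open>emeasure_config_measure\<close> below.\<close>

definition config_measure :: "'a::metric_space set \<Rightarrow> 'a measure" where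
  "config_measure \<omega> = distr (count_space \<omega>) borel (\<lambda>x. x)"

lemma emeasure_config_measure:
  assumes "B \<in> sets borel"
  shows "emeasure (config_measure \<omega>) B = (\<integral>\<^sup>+ x. emeasure (return borel x) B \<partial>count_space \<omega>)"
proof -
  have "emeasure (config_measure \<omega>) B = emeasure (count_space \<omega>) (B \<inter> \<omega>)"
    unfolding config_measure_def using assms by (subst emeasure_distr) auto
  also have "\<dots> = (\<integral>\<^sup>+ x. indicator (B \<inter> \<omega>) x \<partial>count_space \<omega>)"
    by (subst nn_integral_indicator) auto
  also have "\<dots> = (\<integral>\<^sup>+ x. emeasure (return borel x) B \<partial>count_space \<omega>)"
    using assms by (intro nn_integral_cong) (auto simp: indicator_def)
  finally show ?thesis .
qed

definition vague_topology :: "'a::metric_space set topology" where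
  "vague_topology = topology_generated_by
     {{\<omega> \<in> configurations. (\<integral>x. f x \<partial>config_measure \<omega>) \<in> U} | f U. f \<in> Cc \<and> open U}"

lemma topspace_vague_topology:
  "topspace vague_topology = (configurations :: 'a::metric_space set set)"
proof -
  have "(\<lambda>_. 0) \<in> (Cc :: ('a \<Rightarrow> real) set)"
    by (simp add: Cc_def)
  then have "configurations \<in> {{\<omega> \<in> configurations. (\<integral>x. f x \<partial>config_measure \<omega>) \<in> U} |
      (f :: 'a \<Rightarrow> real) U. f \<in> Cc \<and> open U}"
    by (intro CollectI exI[of _ "\<lambda>_. 0"] exI[of _ UNIV]) auto
  then show ?thesis
    unfolding vague_topology_def topology_generated_by_topspace by blast
qed

definition config_space :: "'a::metric_space set measure" where
  "config_space = sigma configurations {U. openin vague_topology U}"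

lemma space_config_space: "space config_space = configurations"
  unfolding config_space_def
  by (rule space_measure_of) (use openin_subset topspace_vague_topology in blast)

lemma sets_config_space:
  "sets config_space = sigma_sets configurations {U. openin vague_topology U}"
  unfolding config_space_def
  by (rule sets_measure_of) (use openin_subset topspace_vague_topology in blast)

definition poisson_measure :: "'a::metric_space measure \<Rightarrow> 'a set measure \<Rightarrow> bool" where
  "poisson_measure \<sigma> \<mu> \<longleftrightarrow>
     prob_space \<mu> \<and> sets \<mu> = sets config_space \<and>
     (\<forall>f \<in> Cc. (\<integral>\<omega>. exp (\<integral>x. f x \<partial>config_measure \<omega>) \<partial>\<mu>) = exp (\<integral>x. (exp (f x) - 1) \<partial>\<sigma>))"


subsection \<open>Distances\<close>

definition rho0 :: "'a set \<Rightarrow> 'a set \<Rightarrow> ennreal" where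
  "rho0 \<omega> \<eta> = (if \<omega> \<noteq> \<eta> then 1 else 0)"

definition rho1 :: "'a::metric_space set \<Rightarrow> 'a set \<Rightarrow> ennreal" where
  "rho1 \<omega> \<eta> = (\<integral>\<^sup>+ x. ennreal \<bar>measure (config_measure \<omega>) {x} - measure (config_measure \<eta>) {x}\<bar>
                 \<partial>count_space UNIV)"

lemma measure_config_measure_singleton: "measure (config_measure \<omega>) {x} = indicator \<omega> x"
proof -
  have "measure (config_measure \<omega>) {x} = measure (count_space \<omega>) ({x} \<inter> \<omega>)"
    unfolding config_measure_def by (subst measure_distr) auto
  then show ?thesis
    by (auto simp: measure_count_space indicator_def)
qed

lemma rho1_eq_card_sym_diff: "rho1 \<omega> \<eta> = emeasure (count_space UNIV) (sym_diff \<omega> \<eta>)"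
proof -
  have "rho1 \<omega> \<eta> = (\<integral>\<^sup>+ x. indicator (sym_diff \<omega> \<eta>) x \<partial>count_space UNIV)"
    unfolding rho1_def measure_config_measure_singleton
    by (intro nn_integral_cong) (auto simp: indicator_def)
  then show ?thesis by simp
qed

definition couplings :: "'b measure \<Rightarrow> 'b measure \<Rightarrow> ('b \<times> 'b) measure set" where
  "couplings \<mu> \<nu> = {\<gamma>. prob_space \<gamma> \<and> sets \<gamma> = sets (\<mu> \<Otimes>\<^sub>M \<nu>) \<and>
                        distr \<gamma> \<mu> fst = \<mu> \<and> distr \<gamma> \<nu> snd = \<nu>}"

definition rubinstein :: "('b \<Rightarrow> 'b \<Rightarrow> ennreal) \<Rightarrow> 'b measure \<Rightarrow> 'b measure \<Rightarrow> ennreal" where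
  "rubinstein \<rho> \<mu> \<nu> = (INF \<gamma> \<in> couplings \<mu> \<nu>. \<integral>\<^sup>+ (\<omega>, \<eta>). \<rho> \<omega> \<eta> \<partial>\<gamma>)"


subsection \<open>Discrete gradient\<close>

text \<open>A configuration is a simple point set, so \<open>\<omega> + \<epsilon>\<^sub>x\<close> is a configuration only for \<open>x \<notin> \<omega>\<close>, where
  it is \<open>insert x \<omega>\<close>. For \<open>x \<in> \<omega>\<close> the gradient below is \<open>0\<close>; this value is irrelevant, since \<open>\<omega>\<close> is
  countable in a \<open>\<sigma>\<close>-compact space and hence a null set of every diffuse measure.\<close>

definition discrete_gradient :: "('a set \<Rightarrow> real) \<Rightarrow> 'a \<Rightarrow> 'a set \<Rightarrow> real" where
  "discrete_gradient F x \<omega> = F (insert x \<omega>) - F \<omega>"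

definition dom_gradient :: "'a::metric_space measure \<Rightarrow> 'a set measure \<Rightarrow> ('a set \<Rightarrow> real) set" where
  "dom_gradient \<sigma> \<mu> =
     {F. F \<in> borel_measurable \<mu> \<and> integrable \<mu> (\<lambda>\<omega>. (F \<omega>)\<^sup>2) \<and>
         (\<integral>\<^sup>+ \<omega>. \<integral>\<^sup>+ x. ennreal (\<bar>discrete_gradient F x \<omega>\<bar>\<^sup>2) \<partial>\<sigma> \<partial>\<mu>) < \<infinity>}"

end

theory Submission
  imports Defs
begin

text \<open>
  The inequality is proved by exhibiting couplings; no duality is involved.

  The part of the space that the vague topology can see is cut into cells \<open>A 0\<close>, \<open>A 1\<close>, \<open>\<dots>\<close> of
  intensity at most \<open>\<epsilon>\<close>, which are revealed one after another. Write \<open>D k\<close> for the union of the first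
  \<open>k\<close> cells and \<open>L k\<close> for the conditional expectation of the density \<open>L\<close> given \<open>\<omega> \<inter> D k\<close>. If \<open>\<eta>\<close> has
  law \<open>\<nu>\<close>, then, given \<open>\<eta> \<inter> D k\<close>, its part in the cell \<open>A k\<close> has density \<open>L (k + 1) / L k\<close> with
  respect to the Poisson law on that cell. A maximal coupling of these two laws keeps the part of \<open>\<eta>\<close>
  with the largest possible probability and otherwise draws a new one from the normalized deficit
  (\<open>maximal_coupling_marginal\<close>). Doing this in all cells, independently given \<open>\<eta>\<close>, turns \<open>\<eta>\<close> into a
  Poisson configuration \<open>\<omega>\<close> (\<open>distr_transport\<close>). A rejection in the cell \<open>A k\<close> moves at most the
  points that \<open>\<eta>\<close> and the new configuration have there, so its expected cost is at most
  \<open>C k = E (\<bar>L (k + 1) - L k\<bar> * N (A k))\<close>, where \<open>N\<close> counts points (\<open>maximal_coupling_cost\<close>).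

  The Mecke formula (\<open>mecke\<close>) replaces the factor \<open>N (A k)\<close> by an integral over an added point \<open>x\<close>.
  Since \<open>L k\<close> does not change when \<open>x\<close> is added in \<open>A k\<close>, this gives
  \<open>C k \<le> E (\<integral>\<^sub>A\<^sub>k \<bar>\<nabla>\<^sub>x L\<bar> d\<sigma>) + \<sigma> (A k) * E \<bar>L (k + 1) - L k\<bar>\<close>, and the last expectation is in turn at
  most \<open>2 * C k\<close>: the positive and the negative part of \<open>L (k + 1) - L k\<close> have the same conditional
  mean, and given \<open>\<omega> \<inter> D k\<close> the difference has a constant value, hence a constant sign, on the
  configurations that are empty in the cell. Hence \<open>C k\<close> is at most \<open>1 + 4 * \<epsilon>\<close> times
  the part of the right-hand side that belongs to \<open>A k\<close> (\<open>cell_cost_bound\<close>). It remains to sum over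
  \<open>k\<close> and to let \<open>\<epsilon>\<close> tend to \<open>0\<close>. The trivial distance is dominated by the total variation distance.

  All this rests on one description of the Borel \<open>\<sigma>\<close>-algebra of the vague topology: it is generated by
  the events that a precompact open set contains no point (\<open>sets_config_space_void\<close>). These events are
  closed under intersection, so a finite measure is determined by its void probabilities
  (\<open>measure_eqI_void\<close>). The independence of a Poisson process on disjoint sets, the Mecke formula and
  the law of \<open>\<omega>\<close> are all checked on void events only. If the space is not locally compact, the points
  without a compact neighbourhood are invisible to the \<open>\<sigma>\<close>-algebra, and they are left where they are.
\<close>

section \<open>Configurations and compactly supported functions\<close>

lemma sigma_compact_countable_basis:
  assumes "sigma_compact_space TYPE('a::metric_space)"
  shows "\<exists>\<B> :: 'a set set. countable \<B> \<and> topological_basis \<B>"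
proof -
  obtain K :: "nat \<Rightarrow> 'a set" where K: "\<And>n. compact (K n)" and UK: "(\<Union>n. K n) = UNIV"
    using assms unfolding sigma_compact_space_def by blast
  have "\<exists>C. finite C \<and> K n \<subseteq> (\<Union>c\<in>C. ball c (1 / Suc m))" for n m
    using seq_compact_imp_totally_bounded[of "K n"] K[of n]
    by (metis compact_imp_seq_compact divide_pos_pos of_nat_0_less_iff zero_less_Suc zero_less_one)
  then obtain C where fin: "\<And>n m. finite (C n m)"
    and C: "\<And>n m. K n \<subseteq> (\<Union>c\<in>C n m. ball c (1 / Suc m))"
    by metis
  define \<B> where "\<B> = (\<lambda>(c, m). ball c (1 / Suc m)) ` ((\<Union>n m. C n m) \<times> (UNIV :: nat set))"
  have "countable \<B>"
    unfolding \<B>_def using fin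
    by (intro countable_image countable_SIGMA countable_UN) (auto intro: countable_finite)
  moreover have "topological_basis \<B>"
  proof (rule topological_basisI)
    show "open B" if "B \<in> \<B>" for B
      using that unfolding \<B>_def by auto
    fix V :: "'a set" and x assume "open V" "x \<in> V"
    then obtain e where e: "e > 0" "ball x e \<subseteq> V"
      using open_contains_ball by blast
    obtain m :: nat where m: "1 / Suc m < e / 2"
      using nat_approx_posE[of "e / 2"] e(1) by auto
    obtain n where "x \<in> K n"
      using UK by blast
    then obtain c where c: "c \<in> C n m" "dist c x < 1 / Suc m"
      using C[of n m] by auto
    have "ball c (1 / Suc m) \<subseteq> ball x e"
    proof
      fix y assume "y \<in> ball c (1 / Suc m)"
      then show "y \<in> ball x e"
        using c(2) m dist_triangle[of x y c] by (auto simp: dist_commute)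
    qed
    then show "\<exists>B\<in>\<B>. x \<in> B \<and> B \<subseteq> V"
      using c e(2) unfolding \<B>_def by (intro bexI[of _ "ball c (1 / Suc m)"]) auto
  qed
  ultimately show ?thesis by blast
qed

definition precompact_open :: "'a::metric_space set \<Rightarrow> bool" where
  "precompact_open G \<longleftrightarrow> open G \<and> compact (closure G)"

definition void :: "'a::metric_space set \<Rightarrow> 'a set set" where
  "void A = {\<omega> \<in> configurations. \<omega> \<inter> A = {}}"

lemma precompact_openD: "precompact_open G \<Longrightarrow> open G" "precompact_open G \<Longrightarrow> compact (closure G)"
  by (auto simp: precompact_open_def)

lemma precompact_open_subset: "precompact_open G \<Longrightarrow> open D \<Longrightarrow> D \<subseteq> G \<Longrightarrow> precompact_open D"
  unfolding precompact_open_def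
  by (metis closed_closure closure_mono compact_Int_closed inf.absorb_iff2)

lemma precompact_open_Int: "precompact_open G \<Longrightarrow> open D \<Longrightarrow> precompact_open (G \<inter> D)"
  by (rule precompact_open_subset) (auto simp: precompact_open_def)

lemma precompact_open_Un: "precompact_open G \<Longrightarrow> precompact_open D \<Longrightarrow> precompact_open (G \<union> D)"
  by (auto simp: precompact_open_def)

lemma precompact_open_empty: "precompact_open {}"
  by (auto simp: precompact_open_def)

lemma configurations_subset: "\<omega> \<in> configurations \<Longrightarrow> \<eta> \<subseteq> \<omega> \<Longrightarrow> \<eta> \<in> configurations"
  unfolding configurations_def by (blast intro: finite_subset[OF Int_mono[OF _ order_refl]])

lemma configurations_Un: "\<omega> \<in> configurations \<Longrightarrow> \<eta> \<in> configurations \<Longrightarrow> \<omega> \<union> \<eta> \<in> configurations"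
  by (auto simp: configurations_def Int_Un_distrib2)

lemma configurations_insert: "\<omega> \<in> configurations \<Longrightarrow> insert x \<omega> \<in> configurations"
  using configurations_Un[of \<omega> "{x}"] by (simp add: configurations_def Int_insert_left)

lemma configurations_finite_UN:
  assumes "finite J" "\<And>j. j \<in> J \<Longrightarrow> f j \<in> configurations"
  shows "(\<Union>j\<in>J. f j) \<in> configurations"
  using assms
proof (induction)
  case empty
  then show ?case by (simp add: configurations_def)
next
  case (insert j J)
  then show ?case using configurations_Un[of "f j" "\<Union> (f ` J)"] by simp
qed

lemma configurations_finite_precompact:
  assumes "\<omega> \<in> configurations" "precompact_open G" "A \<subseteq> G"
  shows "finite (\<omega> \<inter> A)"
proof (rule finite_subset)
  show "\<omega> \<inter> A \<subseteq> \<omega> \<inter> closure G" using assms(3) closure_subset[of G] by blast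
  show "finite (\<omega> \<inter> closure G)"
    using assms by (simp add: configurations_def precompact_open_def)
qed

lemma compact_convergent_sequence:
  fixes x :: "nat \<Rightarrow> 'a::metric_space"
  assumes "x \<longlonglongrightarrow> y"
  shows "compact (insert y (range x))"
  using compactin_sequence_with_limit[of euclidean x y "range x"] assms by simp

text \<open>A configuration has no accumulation point, because a sequence of its points together with the limit
  would be a compact set that contains infinitely many of them.\<close>

lemma configuration_isolated:
  assumes "\<omega> \<in> configurations"
  shows "\<exists>r>0. \<omega> \<inter> ball y r \<subseteq> {y}"
proof (rule ccontr)
  assume "\<not> ?thesis"
  then have "\<forall>n::nat. \<exists>x. x \<in> \<omega> \<and> x \<noteq> y \<and> dist y x < 1 / Suc n"
    by (auto simp: subset_iff) (metis divide_pos_pos of_nat_0_less_iff zero_less_Suc zero_less_one of_nat_Suc)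
  then obtain x :: "nat \<Rightarrow> 'a" where x: "\<And>n. x n \<in> \<omega>" "\<And>n. x n \<noteq> y" "\<And>n. dist y (x n) < 1 / Suc n"
    by metis
  have lim: "x \<longlonglongrightarrow> y"
  proof (rule metric_LIMSEQ_I)
    fix e :: real assume "e > 0"
    then obtain m :: nat where m: "1 / Suc m < e"
      using nat_approx_posE by blast
    show "\<exists>no. \<forall>n\<ge>no. dist (x n) y < e"
    proof (intro exI[of _ m] allI impI)
      fix n assume "m \<le> n"
      then have "1 / Suc n \<le> 1 / Suc m"
        by (simp add: frac_le)
      then show "dist (x n) y < e"
        using x(3)[of n] m by (simp add: dist_commute)
    qed
  qed
  have "compact (insert y (range x))"
    using compact_convergent_sequence[OF lim] .
  then have "finite (\<omega> \<inter> insert y (range x))"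
    using assms by (auto simp: configurations_def)
  then have fin: "finite (range x)"
    by (rule rev_finite_subset) (use x in auto)
  define e where "e = Min (dist y ` range x)"
  have "e > 0"
    unfolding e_def using fin x(2) by (subst Min_gr_iff) (auto simp: dist_commute)
  then obtain m :: nat where m: "1 / Suc m < e"
    using nat_approx_posE by blast
  have "e \<le> dist y (x m)"
    unfolding e_def using fin by (intro Min_le) auto
  then show False
    using m x(3)[of m] by simp
qed

lemma Cc_continuous: "f \<in> Cc \<Longrightarrow> continuous_on UNIV f"
  and Cc_compact: "f \<in> Cc \<Longrightarrow> compact (closure {x. f x \<noteq> 0})"
  by (auto simp: Cc_def)

lemma Cc_precompact:
  fixes f :: "'a::metric_space \<Rightarrow> real"
  shows "f \<in> Cc \<Longrightarrow> precompact_open {x. f x \<noteq> 0}"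
  using open_vimage[of "- {0::real}" f] unfolding Cc_def precompact_open_def
  by (auto simp: vimage_def)

lemma integral_config_measure:
  assumes "\<omega> \<in> configurations" "f \<in> borel_measurable borel" "precompact_open G" "\<And>x. f x \<noteq> 0 \<Longrightarrow> x \<in> G"
  shows "(\<integral>x. f x \<partial>config_measure \<omega>) = (\<Sum>x\<in>\<omega> \<inter> G. f x :: real)"
proof -
  have fin: "finite (\<omega> \<inter> G)"
    using configurations_finite_precompact[OF assms(1,3) order_refl] .
  have "(\<integral>x. f x \<partial>config_measure \<omega>) = (\<integral>x. f x \<partial>count_space \<omega>)"
    unfolding config_measure_def using assms(2) by (subst integral_distr) auto
  also have "\<dots> = (\<Sum>x | x \<in> \<omega> \<and> f x \<noteq> 0. f x)"
    by (intro lebesgue_integral_count_space_finite_support finite_subset[OF _ fin]) (use assms(4) in auto)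
  also have "\<dots> = (\<Sum>x\<in>\<omega> \<inter> G. f x)"
    using assms(4) by (intro sum.mono_neutral_left fin) auto
  finally show ?thesis .
qed

lemma Cc_borel: "f \<in> Cc \<Longrightarrow> f \<in> borel_measurable borel"
  by (intro borel_measurable_continuous_onI Cc_continuous)

lemma measurable_integral_Cc:
  assumes "f \<in> Cc"
  shows "(\<lambda>\<omega>. \<integral>x. f x \<partial>config_measure \<omega>) \<in> borel_measurable config_space"
proof (rule borel_measurableI)
  fix S :: "real set" assume "open S"
  have "(\<lambda>\<omega>. \<integral>x. f x \<partial>config_measure \<omega>) -` S \<inter> space config_space =
      {\<omega> \<in> configurations. (\<integral>x. f x \<partial>config_measure \<omega>) \<in> S}"
    by (auto simp: space_config_space)
  moreover have "openin vague_topology \<dots>"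
    unfolding vague_topology_def openin_topology_generated_by_iff
    using assms \<open>open S\<close> by (intro generate_topology_on.Basis) auto
  ultimately show "(\<lambda>\<omega>. \<integral>x. f x \<partial>config_measure \<omega>) -` S \<inter> space config_space \<in> sets config_space"
    by (auto simp: sets_config_space)
qed

text \<open>Continuous approximations of the indicator function of an open set from below. The whole space is
  treated separately because the distance to the empty set is \<open>0\<close> by convention.\<close>

definition bump :: "'a::metric_space set \<Rightarrow> nat \<Rightarrow> 'a \<Rightarrow> real" where
  "bump G n x = (if G = UNIV then 1 else min 1 (n * infdist x (- G)))"

lemma bump_continuous: "continuous_on UNIV (bump G n)"
  unfolding bump_def by (cases "G = UNIV") (auto intro!: continuous_intros)

lemma bump_bounds: "0 \<le> bump G n x" "bump G n x \<le> 1"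
  by (auto simp: bump_def infdist_nonneg)

lemma bump_outside: "x \<notin> G \<Longrightarrow> bump G n x = 0"
  by (auto simp: bump_def)

lemma bump_tendsto:
  assumes "open G"
  shows "(\<lambda>n. bump G n x) \<longlonglongrightarrow> indicator G x"
proof (cases "x \<in> G \<and> G \<noteq> UNIV")
  case True
  have "infdist x (- G) > 0"
    using True assms by (intro infdist_pos_not_in_closed) (auto simp: closed_def)
  then have "\<exists>N. \<forall>n\<ge>N. 1 \<le> real n * infdist x (- G)"
  proof -
    obtain N :: nat where N: "1 / infdist x (- G) \<le> N"
      using real_arch_simple by blast
    show ?thesis
    proof (intro exI[of _ N] allI impI)
      fix n assume "N \<le> n"
      then have "1 / infdist x (- G) \<le> n" using N by linarith
      then show "1 \<le> real n * infdist x (- G)"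
        using \<open>infdist x (- G) > 0\<close> by (simp add: field_simps)
    qed
  qed
  then have "\<forall>\<^sub>F n in sequentially. bump G n x = 1"
    using True unfolding eventually_sequentially bump_def
    by (metis min.absorb1)
  then show ?thesis
    using True by (simp add: tendsto_eventually)
next
  case False
  then have "bump G n x = indicator G x" for n
    by (auto simp: bump_def)
  then show ?thesis by simp
qed

text \<open>Approximates the indicator function of \<open>G - D\<close>, which in general is neither open nor closed. Sets of
  this form include all cells, and they are reached by a single limit of compactly supported
  continuous functions.\<close>

definition bump_diff :: "'a::metric_space set \<Rightarrow> 'a set \<Rightarrow> nat \<Rightarrow> 'a \<Rightarrow> real" where
  "bump_diff G D n x = bump G n x * (1 - bump D n x)"

lemma bump_diff_bounds: "0 \<le> bump_diff G D n x" "bump_diff G D n x \<le> 1"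
  unfolding bump_diff_def using bump_bounds[of G n x] bump_bounds[of D n x]
  by (auto intro!: mult_le_one)

lemma bump_diff_outside: "x \<notin> G \<Longrightarrow> bump_diff G D n x = 0"
  by (simp add: bump_diff_def bump_outside)

lemma bump_diff_tendsto:
  assumes "open G" "open D"
  shows "(\<lambda>n. bump_diff G D n x) \<longlonglongrightarrow> indicator (G - D) x"
proof -
  have "(\<lambda>n. bump_diff G D n x) \<longlonglongrightarrow> indicator G x * (1 - indicator D x)"
    unfolding bump_diff_def using assms by (intro tendsto_intros bump_tendsto)
  then show ?thesis by (auto simp: indicator_def split: if_splits)
qed

lemma bump_diff_Cc:
  assumes "precompact_open G"
  shows "(\<lambda>x. c * bump_diff G D n x) \<in> Cc"
proof -
  have "continuous_on UNIV (\<lambda>x. c * bump_diff G D n x)"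
    unfolding bump_diff_def by (intro continuous_intros bump_continuous)
  moreover have "closure {x. c * bump_diff G D n x \<noteq> 0} \<subseteq> closure G"
    by (rule closure_mono) (use bump_diff_outside in auto)
  then have "compact (closure {x. c * bump_diff G D n x \<noteq> 0})"
    using assms unfolding precompact_open_def by (metis closed_closure compact_Int_closed inf.absorb_iff2)
  ultimately show ?thesis by (simp add: Cc_def)
qed

lemma bump_diff_integral_tendsto:
  assumes "\<omega> \<in> configurations" "precompact_open G" "open D"
  shows "(\<lambda>n. \<integral>x. c * bump_diff G D n x \<partial>config_measure \<omega>) \<longlonglongrightarrow> c * real (card (\<omega> \<inter> (G - D)))"
proof -
  have fin: "finite (\<omega> \<inter> G)"
    using configurations_finite_precompact[OF assms(1,2) order_refl] .
  have "(\<integral>x. c * bump_diff G D n x \<partial>config_measure \<omega>) = (\<Sum>x\<in>\<omega> \<inter> G. c * bump_diff G D n x)" for n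
    using assms by (intro integral_config_measure Cc_borel bump_diff_Cc) (auto simp: bump_diff_outside, use bump_diff_outside in fastforce)
  moreover have "(\<lambda>n. \<Sum>x\<in>\<omega> \<inter> G. c * bump_diff G D n x) \<longlonglongrightarrow> (\<Sum>x\<in>\<omega> \<inter> G. c * indicator (G - D) x)"
    using assms by (intro tendsto_intros bump_diff_tendsto) (auto simp: precompact_open_def)
  moreover have "(\<Sum>x\<in>\<omega> \<inter> G. c * indicator (G - D) x) = c * real (card (\<omega> \<inter> (G - D)))"
    using fin by (simp add: sum_distrib_left[symmetric] indicator_def sum.If_cases Int_assoc Int_def Diff_eq)
  ultimately show ?thesis by simp
qed

definition num_points :: "'a set \<Rightarrow> 'a set \<Rightarrow> ennreal" where
  "num_points A \<omega> = of_nat (card (\<omega> \<inter> A))"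

lemma measurable_card:
  assumes "precompact_open G" "open D"
  shows "(\<lambda>\<omega>. real (card (\<omega> \<inter> (G - D)))) \<in> borel_measurable config_space"
  by (rule borel_measurable_LIMSEQ_real[where u="\<lambda>n \<omega>. \<integral>x. 1 * bump_diff G D n x \<partial>config_measure \<omega>"])
    (use bump_diff_integral_tendsto[OF _ assms, of _ 1] measurable_integral_Cc[OF bump_diff_Cc[OF assms(1)], of 1]
      in \<open>auto simp: space_config_space\<close>)

lemma measurable_num_points:
  assumes "precompact_open G" "open D"
  shows "num_points (G - D) \<in> borel_measurable config_space"
proof -
  have "num_points (G - D) = (\<lambda>\<omega>. ennreal (real (card (\<omega> \<inter> (G - D)))))"
    by (auto simp: num_points_def ennreal_of_nat_eq_real_of_nat)
  then show ?thesis using measurable_card[OF assms] by simp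
qed

lemma void_eq_card:
  assumes "precompact_open G" "A \<subseteq> G"
  shows "void A = {\<omega> \<in> space config_space. real (card (\<omega> \<inter> A)) = 0}"
  using configurations_finite_precompact[OF _ assms] by (auto simp: void_def space_config_space)

lemma sets_void_Diff:
  assumes "precompact_open G" "open D"
  shows "void (G - D) \<in> sets config_space"
proof -
  have [measurable]: "(\<lambda>\<omega>. real (card (\<omega> \<inter> (G - D)))) \<in> borel_measurable config_space"
    by (rule measurable_card[OF assms])
  have "{\<omega> \<in> space config_space. real (card (\<omega> \<inter> (G - D))) = 0} \<in> sets config_space"
    by measurable
  then show ?thesis
    using void_eq_card[OF assms(1), of "G - D"] by simp
qed

lemma sets_void: "precompact_open G \<Longrightarrow> void G \<in> sets config_space"
  using sets_void_Diff[of G "{}"] by simp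

lemma void_Un: "void A \<inter> void B = void (A \<union> B)"
  by (auto simp: void_def)

abbreviation void_sets :: "'a::metric_space set set set" where
  "void_sets \<equiv> {void G | G. precompact_open G}"

lemma void_sets_Pow: "void_sets \<subseteq> Pow configurations"
  by (auto simp: void_def)

section \<open>The Borel sigma-algebra of the vague topology\<close>

text \<open>The vague topology need not have a countable base when the space is not locally compact. It does have
  a countable network: a countable family of sets, measurable with respect to the void events, such
  that every point of an open set lies in a member of the family contained in the open set. Hence every
  open set is a countable union of such members. A member prescribes, for finitely many basic open
  sets, that there is exactly one point or none; the value of the integral of a compactly supported
  continuous function is almost determined by such information, since finitely many basic sets cover
  the support.\<close>

proposition sets_config_space_void:
  assumes "sigma_compact_space TYPE('a::metric_space)"
  shows "sets (config_space :: 'a set measure) = sigma_sets configurations void_sets"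
proof
  show "sigma_sets configurations void_sets \<subseteq> sets (config_space :: 'a set measure)"
    using sets.sigma_sets_subset[of void_sets config_space] sets_void
    by (auto simp: space_config_space)
next
  let ?\<Gamma> = "configurations :: 'a set set"
  let ?S = "sigma_sets ?\<Gamma> void_sets"
  interpret S: sigma_algebra ?\<Gamma> ?S
    by (rule sigma_algebra_sigma_sets[OF void_sets_Pow])
  obtain \<B> :: "'a set set" where cB: "countable \<B>" and bB: "topological_basis \<B>"
    using sigma_compact_countable_basis[OF assms] by blast
  have oB: "open B" if "B \<in> \<B>" for B
    using that bB by (rule topological_basis_open[rotated])
  have basis: "\<exists>B\<in>\<B>. x \<in> B \<and> B \<subseteq> V" if "open V" "x \<in> V" for x V
    using topological_basisE[OF bB that] by metis
  (* Points outside the union of P have no compact neighbourhood; every function in Cc vanishes there,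
     so "none" only inspects the points inside. *)
  define P where "P = {B \<in> \<B>. precompact_open B}"
  define none where "none B = (\<Inter>G\<in>insert {} P. void (G \<inter> B))" for B :: "'a set"
  define one where "one B = {\<omega> \<in> ?\<Gamma>. \<exists>x. \<omega> \<inter> B = {x}}" for B :: "'a set"
  have void_in: "void G \<in> ?S" if "precompact_open G" for G
    using that by auto
  have cP: "countable P" using cB unfolding P_def by simp
  have none_in: "none B \<in> ?S" if "B \<in> \<B>" for B
    unfolding none_def using cP oB[OF that]
    by (intro S.countable_INT' void_in precompact_open_Int) (auto simp: P_def precompact_open_empty intro: void_in precompact_open_Int)
  have one_in: "one B \<in> ?S" if "B \<in> P" for B
  proof -
    let ?Q = "{(B1, B2). B1 \<in> \<B> \<and> B2 \<in> \<B> \<and> B1 \<inter> B2 = {}}"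
    have B: "precompact_open B" using that by (simp add: P_def)
    have cQ: "countable ?Q"
      by (rule countable_subset[of _ "\<B> \<times> \<B>"]) (use cB in auto)
    (* At least two points in B: two disjoint basic sets are both hit inside B. *)
    have "one B = (?\<Gamma> - void B) - (\<Union>(B1, B2)\<in>?Q. (?\<Gamma> - void (B \<inter> B1)) \<inter> (?\<Gamma> - void (B \<inter> B2)))"
      (is "_ = ?R")
    proof (intro set_eqI iffI)
      fix \<omega> assume "\<omega> \<in> one B"
      then obtain x where x: "\<omega> \<in> ?\<Gamma>" "\<omega> \<inter> B = {x}" by (auto simp: one_def)
      have "\<omega> \<notin> (?\<Gamma> - void (B \<inter> B1)) \<inter> (?\<Gamma> - void (B \<inter> B2))" if "B1 \<inter> B2 = {}" for B1 B2
      proof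
        assume "\<omega> \<in> (?\<Gamma> - void (B \<inter> B1)) \<inter> (?\<Gamma> - void (B \<inter> B2))"
        then obtain y z where "y \<in> \<omega> \<inter> B" "y \<in> B1" "z \<in> \<omega> \<inter> B" "z \<in> B2"
          unfolding void_def by blast
        then show False using that x(2) by auto
      qed
      moreover have "\<omega> \<in> ?\<Gamma> - void B" using x by (auto simp: void_def)
      ultimately show "\<omega> \<in> ?R" by blast
    next
      fix \<omega> assume R: "\<omega> \<in> ?R"
      then have \<omega>: "\<omega> \<in> ?\<Gamma>" and "\<omega> \<inter> B \<noteq> {}" by (auto simp: void_def)
      then obtain x where x: "x \<in> \<omega>" "x \<in> B" by blast
      have "y = x" if y: "y \<in> \<omega>" "y \<in> B" for y
      proof (rule ccontr)
        assume "y \<noteq> x"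
        then obtain V W where VW: "open V" "open W" "y \<in> V" "x \<in> W" "V \<inter> W = {}"
          using hausdorff[of y x] by blast
        obtain B1 where B1: "B1 \<in> \<B>" "y \<in> B1" "B1 \<subseteq> V" using basis VW by blast
        obtain B2 where B2: "B2 \<in> \<B>" "x \<in> B2" "B2 \<subseteq> W" using basis VW by blast
        have "(B1, B2) \<in> ?Q" using B1 B2 VW by auto
        moreover have "\<omega> \<in> (?\<Gamma> - void (B \<inter> B1)) \<inter> (?\<Gamma> - void (B \<inter> B2))"
          using \<omega> x y B1 B2 by (auto simp: void_def)
        ultimately show False using R by blast
      qed
      then show "\<omega> \<in> one B" using \<omega> x by (auto simp: one_def)
    qed
    moreover have "?R \<in> ?S"
      using cQ B oB by (intro S.Diff S.countable_UN' S.top)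
        (auto intro!: S.Int S.Diff S.top void_in precompact_open_Int simp del: Diff_iff)
    ultimately show ?thesis by simp
  qed
  define atoms where "atoms = none ` \<B> \<union> one ` P"
  define net where "net = (\<lambda>F. ?\<Gamma> \<inter> \<Inter>F) ` {F. finite F \<and> F \<subseteq> atoms}"
  have "countable atoms" unfolding atoms_def using cB cP by simp
  then have cnet: "countable net"
    unfolding net_def by (intro countable_image countable_Collect_finite_subset)
  have net_Int: "N1 \<inter> N2 \<in> net" if "N1 \<in> net" "N2 \<in> net" for N1 N2
  proof -
    obtain F1 F2 where "finite F1" "F1 \<subseteq> atoms" "N1 = ?\<Gamma> \<inter> \<Inter>F1" "finite F2" "F2 \<subseteq> atoms" "N2 = ?\<Gamma> \<inter> \<Inter>F2"
      using \<open>N1 \<in> net\<close> \<open>N2 \<in> net\<close> unfolding net_def by blast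
    then show ?thesis unfolding net_def by (intro image_eqI[of _ _ "F1 \<union> F2"]) auto
  qed
  have net_in: "N \<in> ?S" if N: "N \<in> net" for N
  proof -
    obtain F where F: "finite F" "F \<subseteq> atoms" "N = ?\<Gamma> \<inter> \<Inter>F"
      using N unfolding net_def by blast
    have "F \<subseteq> ?S" using F(2) none_in one_in unfolding atoms_def by blast
    with F(1) have "?\<Gamma> \<inter> \<Inter>F \<in> ?S"
    proof (induction F rule: finite_induct)
      case (insert a F)
      then have "a \<in> ?S" "?\<Gamma> \<inter> \<Inter>F \<in> ?S" by blast+
      then have "a \<inter> (?\<Gamma> \<inter> \<Inter>F) \<in> ?S" by (rule S.Int)
      moreover have "?\<Gamma> \<inter> \<Inter>(insert a F) = a \<inter> (?\<Gamma> \<inter> \<Inter>F)" by blast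
      ultimately show ?case by (simp only:)
    qed (use S.top in simp)
    then show ?thesis unfolding F(3) .
  qed
  have basic: "\<exists>N\<in>net. \<omega> \<in> N \<and> N \<subseteq> {\<omega> \<in> ?\<Gamma>. (\<integral>x. f x \<partial>config_measure \<omega>) \<in> V}"
    if f: "f \<in> Cc" and V: "open V" and \<omega>: "\<omega> \<in> ?\<Gamma>" "(\<integral>x. f x \<partial>config_measure \<omega>) \<in> V"
    for f :: "'a \<Rightarrow> real" and V \<omega>
  proof -
    let ?Z = "{x. f x \<noteq> 0}"
    let ?K = "closure ?Z"
    have Z: "precompact_open ?Z" using Cc_precompact[OF f] .
    have K: "compact ?K" using Cc_compact[OF f] .
    have int: "(\<integral>x. f x \<partial>config_measure \<eta>) = (\<Sum>x\<in>\<eta> \<inter> ?Z. f x)" if "\<eta> \<in> ?\<Gamma>" for \<eta>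
      using that f Z by (intro integral_config_measure Cc_borel) auto
    define S where "S = \<omega> \<inter> ?K \<inter> \<Union>P"
    have ZP: "?Z \<subseteq> \<Union>P"
    proof
      fix x assume "x \<in> ?Z"
      then obtain B where "B \<in> \<B>" "x \<in> B" "B \<subseteq> ?Z"
        using basis[of ?Z x] Z precompact_openD(1) by blast
      then show "x \<in> \<Union>P" using precompact_open_subset[OF Z] oB unfolding P_def by blast
    qed
    have finS: "finite S"
      using \<omega>(1) K finite_subset[of S "\<omega> \<inter> ?K"] by (auto simp: S_def configurations_def)
    have int\<omega>: "(\<integral>x. f x \<partial>config_measure \<omega>) = (\<Sum>x\<in>S. f x)"
      unfolding int[OF \<omega>(1)] using finS ZP closure_subset[of ?Z] by (intro sum.mono_neutral_left) (auto simp: S_def)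
    obtain e where e: "e > 0" "ball (\<Sum>x\<in>S. f x) e \<subseteq> V"
      using V \<omega>(2) open_contains_ball unfolding int\<omega> by blast
    (* Each point of S may contribute an error of d, which adds up to less than e. *)
    define d where "d = e / (real (card S) + 1)"
    have d: "d > 0" "real (card S) * d < e"
      using e(1) unfolding d_def by (auto simp: field_simps)
    (* The halved distances make the neighbourhoods of different points of S disjoint. *)
    have "\<exists>B. y \<in> B \<and> B \<in> \<B> \<and> \<omega> \<inter> B \<subseteq> {y} \<and>
        (y \<in> S \<longrightarrow> B \<in> P \<and> (\<forall>x\<in>B. \<bar>f x - f y\<bar> < d) \<and> (\<forall>z\<in>S. z \<noteq> y \<longrightarrow> B \<subseteq> ball y (dist y z / 2)))" for y
    proof -
      obtain r where r: "r > 0" "\<omega> \<inter> ball y r \<subseteq> {y}" using configuration_isolated[OF \<omega>(1)] by blast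
      show ?thesis
      proof (cases "y \<in> S")
        case False
        obtain B where "B \<in> \<B>" "y \<in> B" "B \<subseteq> ball y r" using basis[of "ball y r" y] r by auto
        then show ?thesis using False r by blast
      next
        case True
        then obtain G where G: "G \<in> P" "y \<in> G" by (auto simp: S_def)
        define W where "W = ball y r \<inter> G \<inter> {x. \<bar>f x - f y\<bar> < d} \<inter> (\<Inter>z\<in>S - {y}. ball y (dist y z / 2))"
        have "open {x. \<bar>f x - f y\<bar> < d}"
          using Cc_continuous[OF f] by (intro open_Collect_less continuous_intros) auto
        then have "open W"
          unfolding W_def using G finS precompact_openD(1)[of G]
          by (intro open_Int open_INT) (auto simp: P_def)
        moreover have "y \<in> W" unfolding W_def using r G d by auto
        ultimately obtain B where B: "B \<in> \<B>" "y \<in> B" "B \<subseteq> W" using basis by blast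
        then have "B \<in> P" using G precompact_open_subset[of G B] oB[OF B(1)] by (auto simp: P_def W_def)
        then show ?thesis using B r by (intro exI[of _ B]) (auto simp: W_def)
      qed
    qed
    then obtain B where B: "\<And>y. y \<in> B y" "\<And>y. B y \<in> \<B>" "\<And>y. \<omega> \<inter> B y \<subseteq> {y}"
        "\<And>y. y \<in> S \<Longrightarrow> B y \<in> P" "\<And>y x. y \<in> S \<Longrightarrow> x \<in> B y \<Longrightarrow> \<bar>f x - f y\<bar> < d"
        "\<And>y z. y \<in> S \<Longrightarrow> z \<in> S \<Longrightarrow> z \<noteq> y \<Longrightarrow> B y \<subseteq> ball y (dist y z / 2)"
      by metis
    obtain T where T: "T \<subseteq> ?K" "finite T" "?K \<subseteq> (\<Union>y\<in>T. B y)"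
      using compactE_image[OF K, of ?K B] B(1,2) oB by (metis (no_types, lifting) UN_I subsetI)
    have ST: "S \<subseteq> T"
      using T(3) B(3) by (fastforce simp: S_def)
    define F where "F = none ` B ` (T - S) \<union> one ` B ` S"
    have "?\<Gamma> \<inter> \<Inter>F \<in> net"
      unfolding net_def F_def atoms_def using T(2) finS B(2,4) by (intro imageI) auto
    moreover have "\<omega> \<in> ?\<Gamma> \<inter> \<Inter>F"
    proof -
      have "\<omega> \<in> none (B y)" if "y \<in> T - S" for y
        using that T(1) B(3)[of y] \<omega>(1) by (auto simp: none_def void_def S_def)
      moreover have "\<omega> \<in> one (B y)" if "y \<in> S" for y
        using that B(1,3)[of y] \<omega>(1) by (auto simp: one_def S_def)
      ultimately show ?thesis using \<omega>(1) by (auto simp: F_def)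
    qed
    moreover have "(\<integral>x. f x \<partial>config_measure \<eta>) \<in> V" if \<eta>: "\<eta> \<in> ?\<Gamma> \<inter> \<Inter>F" for \<eta>
    proof -
      have \<eta>\<Gamma>: "\<eta> \<in> ?\<Gamma>" using \<eta> by blast
      have "\<exists>x. \<eta> \<inter> B y = {x}" if "y \<in> S" for y
      proof -
        have "\<eta> \<in> one (B y)" using that \<eta> unfolding F_def by blast
        then show ?thesis by (simp add: one_def)
      qed
      then obtain p where p: "\<And>y. y \<in> S \<Longrightarrow> \<eta> \<inter> B y = {p y}" by metis
      have pB: "p y \<in> B y" "p y \<in> \<eta>" if "y \<in> S" for y using p[OF that] by blast+
      have inj: "inj_on p S"
      proof (rule inj_onI, rule ccontr)
        fix y z assume yz: "y \<in> S" "z \<in> S" "p y = p z" "y \<noteq> z"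
        then have "dist y (p y) < dist y z / 2" "dist z (p y) < dist z y / 2"
          using B(6)[of y z] B(6)[of z y] pB[of y] pB[of z] by auto
        then show False using dist_triangle[of y z "p y"] by (simp add: dist_commute)
      qed
      have sub: "\<eta> \<inter> ?Z \<subseteq> p ` S"
      proof
        fix x assume x: "x \<in> \<eta> \<inter> ?Z"
        then obtain y where y: "y \<in> T" "x \<in> B y" using T(3) closure_subset[of ?Z] by blast
        have "y \<in> S"
        proof (rule ccontr)
          assume "y \<notin> S"
          then have "\<eta> \<in> none (B y)" using \<eta> y unfolding F_def by blast
          then show False using x y ZP by (auto simp: none_def void_def)
        qed
        then show "x \<in> p ` S" using p[of y] x y by auto
      qed
      have "(\<integral>x. f x \<partial>config_measure \<eta>) = (\<Sum>x\<in>p ` S. f x)"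
        unfolding int[OF \<eta>\<Gamma>] using sub finS pB by (intro sum.mono_neutral_left) auto
      also have "\<dots> = (\<Sum>y\<in>S. f (p y))" using inj by (simp add: sum.reindex)
      finally have eq: "(\<integral>x. f x \<partial>config_measure \<eta>) = (\<Sum>y\<in>S. f (p y))" .
      have "\<bar>(\<Sum>y\<in>S. f (p y)) - (\<Sum>y\<in>S. f y)\<bar> \<le> (\<Sum>y\<in>S. \<bar>f (p y) - f y\<bar>)"
        unfolding sum_subtractf[symmetric] by (rule sum_abs)
      also have "\<dots> \<le> (\<Sum>y\<in>S. d)"
        using B(5) pB by (intro sum_mono) (auto intro: less_imp_le)
      also have "\<dots> < e" using d by simp
      finally have "(\<integral>x. f x \<partial>config_measure \<eta>) \<in> ball (\<Sum>x\<in>S. f x) e"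
        unfolding eq by (simp add: dist_real_def abs_minus_commute)
      then show ?thesis using e by blast
    qed
    ultimately show ?thesis by blast
  qed
  have "V \<in> ?S" if V: "openin vague_topology V" for V :: "'a set set"
  proof -
    have gen: "generate_topology_on {{\<omega> \<in> ?\<Gamma>. (\<integral>x. f x \<partial>config_measure \<omega>) \<in> U} | f U. f \<in> Cc \<and> open U} V"
      using V unfolding vague_topology_def openin_topology_generated_by_iff .
    have "\<forall>\<omega>\<in>V. \<exists>N\<in>net. \<omega> \<in> N \<and> N \<subseteq> V"
      using gen
    proof (induction)
      case Empty
      then show ?case by simp
    next
      case (Int a b)
      show ?case
      proof
        fix \<omega> assume "\<omega> \<in> a \<inter> b"
        then obtain N1 N2 where "N1 \<in> net" "\<omega> \<in> N1" "N1 \<subseteq> a" "N2 \<in> net" "\<omega> \<in> N2" "N2 \<subseteq> b"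
          using Int by blast
        then show "\<exists>N\<in>net. \<omega> \<in> N \<and> N \<subseteq> a \<inter> b"
          using net_Int by (intro bexI[of _ "N1 \<inter> N2"]) auto
      qed
    next
      case (UN K)
      then show ?case by (meson Union_iff Union_upper subset_trans)
    next
      case (Basis s)
      then show ?case using basic by auto
    qed
    then have "V = \<Union>{N \<in> net. N \<subseteq> V}" by blast
    moreover have "\<dots> \<in> ?S"
      using cnet net_in by (intro S.countable_Union) auto
    ultimately show ?thesis by simp
  qed
  then show "sets (config_space :: 'a set measure) \<subseteq> ?S"
    unfolding sets_config_space by (intro sigma_sets_mono) auto
qed

lemma measurable_config_spaceI:
  assumes "sigma_compact_space TYPE('a::metric_space)"
    and "\<And>x. x \<in> space M \<Longrightarrow> T x \<in> (configurations :: 'a set set)"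
    and "\<And>G. precompact_open G \<Longrightarrow> {x \<in> space M. T x \<inter> G = {}} \<in> sets M"
  shows "T \<in> M \<rightarrow>\<^sub>M config_space"
proof (rule measurable_sigma_sets[OF sets_config_space_void[OF assms(1)] void_sets_Pow])
  show "T \<in> space M \<rightarrow> configurations" using assms(2) by blast
  fix y :: "'a set set" assume "y \<in> void_sets"
  then obtain G where G: "y = void G" "precompact_open G" by blast
  have "T -` y \<inter> space M = {x \<in> space M. T x \<inter> G = {}}"
    unfolding G using assms(2) by (auto simp: void_def)
  then show "T -` y \<inter> space M \<in> sets M" using assms(3)[OF G(2)] by simp
qed

text \<open>Void events of precompact open sets form a \<open>\<pi>\<close>-system, as the intersection of two of them is the void
  event of the union.\<close>

lemma measure_eqI_void:
  assumes "sigma_compact_space TYPE('a::metric_space)"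
    and "sets M = sets (config_space :: 'a set measure)" "sets N = sets (config_space :: 'a set measure)"
    and "finite_measure M"
    and eq: "\<And>G. precompact_open G \<Longrightarrow> emeasure M (void G) = emeasure N (void G)"
  shows "M = N"
proof (rule measure_eqI_generator_eq[where E=void_sets and \<Omega>=configurations and A="\<lambda>_. configurations"])
  interpret M: finite_measure M by fact
  have \<Gamma>: "configurations = void ({} :: 'a set)" by (simp add: void_def)
  show "Int_stable (void_sets :: 'a set set set)"
    by (auto simp: Int_stable_def void_Un) (use precompact_open_Un in blast)
  show "void_sets \<subseteq> Pow (configurations :: 'a set set)" by (rule void_sets_Pow)
  show "emeasure M X = emeasure N X" if "X \<in> void_sets" for X using that eq by auto
  show "sets M = sigma_sets configurations void_sets" "sets N = sigma_sets configurations void_sets"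
    using assms(2,3) sets_config_space_void[OF assms(1)] by auto
  show "range (\<lambda>_::nat. configurations) \<subseteq> (void_sets :: 'a set set set)"
    using \<Gamma> precompact_open_empty by auto
  show "(\<Union>i::nat. configurations) = (configurations :: 'a set set)" by simp
  show "emeasure M configurations \<noteq> \<infinity>" by simp
qed

section \<open>Void probabilities and mean counts of a Poisson process\<close>

locale poisson_process =
  fixes \<sigma> :: "'a::metric_space measure" and \<mu> :: "'a set measure"
  assumes sigma_compact: "sigma_compact_space TYPE('a)"
    and radon: "radon_measure \<sigma>"
    and diffuse: "diffuse_measure \<sigma>"
    and poisson: "poisson_measure \<sigma> \<mu>"
begin

sublocale prob_space \<mu>
  using poisson by (simp add: poisson_measure_def)

lemma sets_\<mu>[measurable_cong]: "sets \<mu> = sets config_space"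
  using poisson by (simp add: poisson_measure_def)

lemma space_\<mu>: "space \<mu> = configurations"
  using sets_eq_imp_space_eq[OF sets_\<mu>] by (simp add: space_config_space)

lemma sets_\<sigma>[measurable_cong]: "sets \<sigma> = sets borel"
  using radon by (simp add: radon_measure_def)

lemma space_\<sigma>: "space \<sigma> = UNIV"
  using sets_eq_imp_space_eq[OF sets_\<sigma>] by simp

lemma sigma_compact_finite: "compact K \<Longrightarrow> emeasure \<sigma> K < \<infinity>"
  using radon by (simp add: radon_measure_def)

sublocale \<sigma>: sigma_finite_measure \<sigma>
proof
  obtain K :: "nat \<Rightarrow> 'a set" where K: "\<And>n. compact (K n)" and UK: "(\<Union>n. K n) = UNIV"
    using sigma_compact unfolding sigma_compact_space_def by blast
  show "\<exists>A. countable A \<and> A \<subseteq> sets \<sigma> \<and> \<Union>A = space \<sigma> \<and> (\<forall>a\<in>A. emeasure \<sigma> a \<noteq> \<infinity>)"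
  proof (intro exI[of _ "range K"] conjI)
    show "range K \<subseteq> sets \<sigma>"
      using compact_imp_closed[OF K] by (auto simp: sets_\<sigma>)
    show "\<forall>a\<in>range K. emeasure \<sigma> a \<noteq> \<infinity>"
      using sigma_compact_finite[OF K] by (auto simp: less_top)
  qed (use UK in \<open>auto simp: space_\<sigma>\<close>)
qed

lemma sets_Diff[measurable]: "precompact_open G \<Longrightarrow> open D \<Longrightarrow> G - D \<in> sets borel"
  by (auto simp: precompact_open_def)

lemma emeasure_finite:
  assumes "precompact_open G" "A \<subseteq> G"
  shows "emeasure \<sigma> A < \<infinity>"
proof -
  have "emeasure \<sigma> A \<le> emeasure \<sigma> (closure G)"
    using assms closure_subset[of G] by (intro emeasure_mono) (auto simp: sets_\<sigma>)
  also have "\<dots> < \<infinity>" using assms by (intro sigma_compact_finite) (auto simp: precompact_open_def)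
  finally show ?thesis .
qed

lemma emeasure_eq: "precompact_open G \<Longrightarrow> A \<subseteq> G \<Longrightarrow> emeasure \<sigma> A = ennreal (measure \<sigma> A)"
  using emeasure_finite by (intro emeasure_eq_ennreal_measure) (auto simp: less_top)

text \<open>The defining formula of the Poisson measure, applied to \<open>-t\<close> times the approximations of the indicator
  function of \<open>G - D\<close>. The exponents are nonpositive, so constants dominate on the left-hand side
  and the indicator function of \<open>G\<close> dominates on the right-hand side.\<close>

lemma laplace_num_points:
  assumes G: "precompact_open G" and D: "open D" and t: "t \<ge> 0"
  shows "(\<integral>\<omega>. exp (- t * real (card (\<omega> \<inter> (G - D)))) \<partial>\<mu>) =
    exp (- (1 - exp (- t)) * measure \<sigma> (G - D))"
proof -
  let ?f = "\<lambda>n x. - t * bump_diff G D n x"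
  let ?I = "\<lambda>n \<omega>. \<integral>x. ?f n x \<partial>config_measure \<omega>"
  note [measurable] = measurable_card[OF G D] measurable_integral_Cc[OF bump_diff_Cc[OF G]] Cc_borel[OF bump_diff_Cc[OF G]]
  have nonpos: "?f n x \<le> 0" for n x
    using t bump_diff_bounds(1)[of G D n x] by simp
  have lap: "(\<integral>\<omega>. exp (?I n \<omega>) \<partial>\<mu>) = exp (\<integral>x. (exp (?f n x) - 1) \<partial>\<sigma>)" for n
    using poisson bump_diff_Cc[OF G, of "- t" D n] unfolding poisson_measure_def by blast
  have I_le: "?I n \<omega> \<le> 0" for n \<omega>
    using Bochner_Integration.integral_nonneg[of "config_measure \<omega>" "\<lambda>x. t * bump_diff G D n x"] t bump_diff_bounds(1)[of G D n]
    by simp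
  have 1: "(\<lambda>n. \<integral>\<omega>. exp (?I n \<omega>) \<partial>\<mu>) \<longlonglongrightarrow> (\<integral>\<omega>. exp (- t * real (card (\<omega> \<inter> (G - D)))) \<partial>\<mu>)"
  proof (rule integral_dominated_convergence[where w="\<lambda>_. 1"])
    show "AE \<omega> in \<mu>. (\<lambda>n. exp (?I n \<omega>)) \<longlonglongrightarrow> exp (- t * real (card (\<omega> \<inter> (G - D))))"
      using G D by (intro AE_I2 tendsto_exp bump_diff_integral_tendsto) (simp_all add: space_\<mu>)
    show "(\<lambda>\<omega>. exp (?I n \<omega>)) \<in> borel_measurable \<mu>" for n
      by measurable
  qed (use I_le in \<open>auto intro!: AE_I2\<close>)
  have "(\<lambda>n. \<integral>x. (exp (?f n x) - 1) \<partial>\<sigma>) \<longlonglongrightarrow> (\<integral>x. (exp (- t * indicator (G - D) x) - 1) \<partial>\<sigma>)"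
  proof (rule integral_dominated_convergence[where w="indicator G"])
    show "AE x in \<sigma>. (\<lambda>n. exp (?f n x) - 1) \<longlonglongrightarrow> exp (- t * indicator (G - D) x) - 1"
      using G D by (intro AE_I2 tendsto_intros bump_diff_tendsto) (auto simp: precompact_open_def)
    show "integrable \<sigma> (indicator G :: 'a \<Rightarrow> real)"
      using G emeasure_finite[OF G order_refl] precompact_openD(1)[OF G] by (simp add: sets_\<sigma> integrable_indicator_iff)
    show "AE x in \<sigma>. norm (exp (?f n x) - 1) \<le> indicator G x" for n
    proof (rule AE_I2)
      fix x show "norm (exp (?f n x) - 1) \<le> indicator G x"
      proof (cases "x \<in> G")
        case True
        have "exp (?f n x) \<le> 1" using nonpos[of n x] by (subst exp_le_one_iff)
        then show ?thesis using True exp_gt_zero[of "?f n x"] by (simp add: abs_if del: exp_gt_zero)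
      qed (simp add: bump_diff_outside)
    qed
  qed (use D G in \<open>auto simp: precompact_open_def\<close>)
  moreover have "(\<integral>x. (exp (- t * indicator (G - D) x) - 1) \<partial>\<sigma>) = (\<integral>x. - (1 - exp (- t)) * indicator (G - D) x \<partial>\<sigma>)"
    by (intro Bochner_Integration.integral_cong) (auto simp: indicator_def)
  moreover have "\<dots> = - (1 - exp (- t)) * measure \<sigma> (G - D)"
    using G D by (subst integral_mult_right_zero) (auto simp: space_\<sigma>)
  ultimately have "(\<lambda>n. \<integral>x. (exp (?f n x) - 1) \<partial>\<sigma>) \<longlonglongrightarrow> - (1 - exp (- t)) * measure \<sigma> (G - D)"
    by (simp only:)
  then have "(\<lambda>n. exp (\<integral>x. (exp (?f n x) - 1) \<partial>\<sigma>)) \<longlonglongrightarrow> exp (- (1 - exp (- t)) * measure \<sigma> (G - D))"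
    by (rule tendsto_exp)
  then show ?thesis using 1 unfolding lap by (rule LIMSEQ_unique[symmetric])
qed

text \<open>The limit of the Laplace transform of the number of points as its argument tends to infinity.\<close>

lemma emeasure_void:
  assumes G: "precompact_open G" and D: "open D"
  shows "emeasure \<mu> (void (G - D)) = ennreal (exp (- measure \<sigma> (G - D)))"
proof -
  note [measurable] = measurable_card[OF G D]
  let ?N = "\<lambda>\<omega>. real (card (\<omega> \<inter> (G - D)))"
  have V: "void (G - D) \<in> sets \<mu>" using sets_void_Diff[OF G D] by (simp add: sets_\<mu>)
  have lim0: "(\<lambda>n. exp (- real n * c)) \<longlonglongrightarrow> (if c = 0 then 1 else 0)" if "c \<ge> 0" for c :: real
  proof (cases "c = 0")
    case False
    then have "(\<lambda>n. exp (- c) ^ n) \<longlonglongrightarrow> 0" using that by (intro LIMSEQ_power_zero) simp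
    then show ?thesis using False by (simp add: exp_of_nat_mult[symmetric])
  qed simp
  have "(\<lambda>n. \<integral>\<omega>. exp (- real n * ?N \<omega>) \<partial>\<mu>) \<longlonglongrightarrow> (\<integral>\<omega>. indicator (void (G - D)) \<omega> \<partial>\<mu>)"
  proof (rule integral_dominated_convergence[where w="\<lambda>_. 1"])
    show "AE \<omega> in \<mu>. (\<lambda>n. exp (- real n * ?N \<omega>)) \<longlonglongrightarrow> indicator (void (G - D)) \<omega>"
    proof (rule AE_I2)
      fix \<omega> assume "\<omega> \<in> space \<mu>"
      then have "(if ?N \<omega> = 0 then 1 else 0) = (indicator (void (G - D)) \<omega> :: real)"
        using void_eq_card[OF G, of "G - D"] by (auto simp: indicator_def space_\<mu> space_config_space)
      then show "(\<lambda>n. exp (- real n * ?N \<omega>)) \<longlonglongrightarrow> indicator (void (G - D)) \<omega>"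
        using lim0[of "?N \<omega>"] by (simp only: of_nat_0_le_iff)
    qed
  qed (use V in \<open>auto intro!: AE_I2\<close>)
  then have "(\<lambda>n. exp (- (1 - exp (- real n)) * measure \<sigma> (G - D))) \<longlonglongrightarrow> measure \<mu> (void (G - D))"
    using V sets.sets_into_space[OF V] by (simp only: laplace_num_points[OF G D of_nat_0_le_iff]) (simp add: Int_absorb2)
  moreover have "(\<lambda>n. exp (- (1 - exp (- real n)) * measure \<sigma> (G - D))) \<longlonglongrightarrow> exp (- (1 - 0) * measure \<sigma> (G - D))"
    using lim0[of 1] by (intro tendsto_intros) simp
  ultimately have "measure \<mu> (void (G - D)) = exp (- measure \<sigma> (G - D))"
    using LIMSEQ_unique by fastforce
  then show ?thesis by (simp add: emeasure_eq_measure)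
qed

lemma emeasure_void_precompact: "precompact_open G \<Longrightarrow> emeasure \<mu> (void G) = ennreal (exp (- measure \<sigma> G))"
  using emeasure_void[of G "{}"] by simp

lemma DERIV_quotient_sequence:
  fixes g :: "real \<Rightarrow> real"
  assumes "(g has_field_derivative c) (at 0)"
  shows "(\<lambda>n. (g (1 / Suc n) - g 0) * Suc n) \<longlonglongrightarrow> c"
proof -
  have "((\<lambda>h. (g (0 + h) - g 0) / h) \<longlongrightarrow> c) (at 0)"
    using assms by (simp add: DERIV_def)
  moreover have "filterlim (\<lambda>n. 1 / Suc n :: real) (at 0) sequentially"
    unfolding filterlim_at using LIMSEQ_Suc[OF lim_1_over_n[where 'a=real]] by simp
  ultimately have "(\<lambda>n. (g (0 + 1 / Suc n) - g 0) / (1 / Suc n)) \<longlonglongrightarrow> c"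
    by (rule filterlim_compose)
  then show ?thesis by simp
qed

text \<open>The derivative of the Laplace transform at \<open>0\<close>, taken along \<open>1 / (n + 1)\<close>. Fatou's lemma gives one
  inequality, and the bound \<open>1 - exp (- h * N) \<le> h * N\<close> the other.\<close>

lemma nn_integral_num_points:
  assumes G: "precompact_open G" and D: "open D"
  shows "(\<integral>\<^sup>+ \<omega>. num_points (G - D) \<omega> \<partial>\<mu>) = emeasure \<sigma> (G - D)"
proof -
  note [measurable] = measurable_card[OF G D] measurable_num_points[OF G D]
  let ?N = "\<lambda>\<omega>. real (card (\<omega> \<inter> (G - D)))"
  let ?s = "measure \<sigma> (G - D)"
  define a where "a n \<omega> = (1 - exp (- (1 / Suc n) * ?N \<omega>)) * Suc n" for n \<omega>
  have [measurable]: "a n \<in> borel_measurable \<mu>" for n unfolding a_def by measurable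
  have a_nonneg: "0 \<le> a n \<omega>" for n \<omega>
    by (simp add: a_def)
  have a_le: "a n \<omega> \<le> ?N \<omega>" for n \<omega>
  proof -
    have "1 - exp (- (1 / Suc n) * ?N \<omega>) \<le> (1 / Suc n) * ?N \<omega>"
      using exp_ge_add_one_self[of "- (1 / Suc n) * ?N \<omega>"] by linarith
    then have "a n \<omega> \<le> (1 / Suc n) * ?N \<omega> * Suc n"
      unfolding a_def by (intro mult_right_mono) auto
    then show ?thesis by simp
  qed
  have int: "(\<integral>\<^sup>+ \<omega>. ennreal (a n \<omega>) \<partial>\<mu>) = ennreal ((1 - exp (- (1 - exp (- (1 / Suc n))) * ?s)) * Suc n)" for n
  proof -
    have e: "integrable \<mu> (\<lambda>\<omega>. exp (- (1 / Suc n) * ?N \<omega>))"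
      by (rule integrable_const_bound[where B=1]) auto
    then have i: "integrable \<mu> (a n)" unfolding a_def by simp
    have "(\<integral>\<omega>. a n \<omega> \<partial>\<mu>) = (1 - (\<integral>\<omega>. exp (- (1 / Suc n) * ?N \<omega>) \<partial>\<mu>)) * Suc n"
      unfolding a_def using e by (simp add: prob_space)
    then show ?thesis
      using i a_nonneg laplace_num_points[OF G D, of "1 / Suc n"] by (subst nn_integral_eq_integral) simp_all
  qed
  have lim: "(\<lambda>n. (1 - exp (- (1 - exp (- (1 / Suc n))) * ?s)) * Suc n) \<longlonglongrightarrow> ?s"
  proof -
    have "((\<lambda>h. - exp (- (1 - exp (- h)) * ?s)) has_field_derivative ?s) (at 0)"
      by (auto intro!: derivative_eq_intros)
    from DERIV_quotient_sequence[OF this] show ?thesis by (simp add: algebra_simps)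
  qed
  have alim: "(\<lambda>n. a n \<omega>) \<longlonglongrightarrow> ?N \<omega>" for \<omega>
  proof -
    have "((\<lambda>h. - exp (- h * ?N \<omega>)) has_field_derivative ?N \<omega>) (at 0)"
      by (auto intro!: derivative_eq_intros)
    from DERIV_quotient_sequence[OF this] show ?thesis by (simp add: a_def algebra_simps)
  qed
  have cN: "num_points (G - D) \<omega> = ennreal (?N \<omega>)" for \<omega>
    by (simp add: num_points_def ennreal_of_nat_eq_real_of_nat)
  have lim': "(\<lambda>n. \<integral>\<^sup>+ \<omega>. ennreal (a n \<omega>) \<partial>\<mu>) \<longlonglongrightarrow> ennreal ?s"
    unfolding int using lim by (rule tendsto_ennrealI)
  have "(\<integral>\<^sup>+ \<omega>. num_points (G - D) \<omega> \<partial>\<mu>) = (\<integral>\<^sup>+ \<omega>. liminf (\<lambda>n. ennreal (a n \<omega>)) \<partial>\<mu>)"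
    unfolding cN using alim by (intro nn_integral_cong lim_imp_Liminf[symmetric] tendsto_ennrealI) auto
  also have "\<dots> \<le> liminf (\<lambda>n. \<integral>\<^sup>+ \<omega>. ennreal (a n \<omega>) \<partial>\<mu>)"
    by (rule nn_integral_liminf) simp
  also have "\<dots> = ennreal ?s" using lim' by (intro lim_imp_Liminf) auto
  finally have "(\<integral>\<^sup>+ \<omega>. num_points (G - D) \<omega> \<partial>\<mu>) \<le> ennreal ?s" .
  moreover have "ennreal ?s \<le> (\<integral>\<^sup>+ \<omega>. num_points (G - D) \<omega> \<partial>\<mu>)"
    unfolding cN using lim' a_le by (intro LIMSEQ_le_const2[OF lim'] exI[of _ 0] allI impI nn_integral_mono ennreal_leI) auto
  ultimately show ?thesis using emeasure_eq[OF G, of "G - D"] by (simp add: antisym)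
qed

end

section \<open>Independence and the Mecke formula\<close>

definition glue :: "'a set \<Rightarrow> 'a set \<Rightarrow> 'a set \<Rightarrow> 'a set" where
  "glue D \<eta> \<zeta> = (\<eta> \<inter> D) \<union> (\<zeta> - D)"

lemma glue_configurations: "\<eta> \<in> configurations \<Longrightarrow> \<zeta> \<in> configurations \<Longrightarrow> glue D \<eta> \<zeta> \<in> configurations"
  unfolding glue_def by (intro configurations_Un) (auto elim: configurations_subset)

context poisson_process
begin

lemma measurable_configI:
  assumes "\<And>x. x \<in> space M \<Longrightarrow> T x \<in> (configurations :: 'a set set)"
    and "\<And>G. precompact_open G \<Longrightarrow> {x \<in> space M. T x \<inter> G = {}} \<in> sets M"
  shows "T \<in> M \<rightarrow>\<^sub>M \<mu>"
  using measurable_config_spaceI[OF sigma_compact assms] measurable_cong_sets[OF refl sets_\<mu>] by blast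

lemma measurable_glue:
  assumes "open D"
  shows "(\<lambda>p. glue D (fst p) (snd p)) \<in> \<mu> \<Otimes>\<^sub>M \<mu> \<rightarrow>\<^sub>M \<mu>"
proof (rule measurable_configI)
  show "glue D (fst x) (snd x) \<in> configurations" if "x \<in> space (\<mu> \<Otimes>\<^sub>M \<mu>)" for x
    using that by (auto simp: space_pair_measure space_\<mu> intro: glue_configurations)
  fix G :: "'a set" assume G: "precompact_open G"
  have "{x \<in> space (\<mu> \<Otimes>\<^sub>M \<mu>). glue D (fst x) (snd x) \<inter> G = {}} = void (G \<inter> D) \<times> void (G - D)"
    by (auto simp: space_pair_measure space_\<mu> void_def glue_def)
  then show "{x \<in> space (\<mu> \<Otimes>\<^sub>M \<mu>). glue D (fst x) (snd x) \<inter> G = {}} \<in> sets (\<mu> \<Otimes>\<^sub>M \<mu>)"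
    using sets_void[OF precompact_open_Int[OF G assms]] sets_void_Diff[OF G assms] by (simp add: sets_\<mu>)
qed

lemma measurable_glue'[measurable (raw)]:
  assumes "open D" "f \<in> M \<rightarrow>\<^sub>M \<mu>" "g \<in> M \<rightarrow>\<^sub>M \<mu>"
  shows "(\<lambda>x. glue D (f x) (g x)) \<in> M \<rightarrow>\<^sub>M \<mu>"
  using measurable_compose[OF measurable_Pair[OF assms(2,3)] measurable_glue[OF assms(1)]] by simp

sublocale pair: pair_prob_space \<mu> \<mu> ..

text \<open>The independence of the restrictions of a Poisson process to \<open>D\<close> and to its complement: replacing the
  part outside \<open>D\<close> by that of an independent copy does not change the law. On void events this is the
  additivity of \<open>\<sigma>\<close> in the exponent.\<close>

lemma distr_glue:
  assumes D: "open D"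
  shows "distr (\<mu> \<Otimes>\<^sub>M \<mu>) \<mu> (\<lambda>p. glue D (fst p) (snd p)) = \<mu>"
proof (rule measure_eqI_void[OF sigma_compact])
  note [measurable] = measurable_glue[OF D]
  show "finite_measure (distr (\<mu> \<Otimes>\<^sub>M \<mu>) \<mu> (\<lambda>p. glue D (fst p) (snd p)))"
    by (intro prob_space.finite_measure pair.prob_space_distr) measurable
  fix G :: "'a set" assume G: "precompact_open G"
  have GD: "precompact_open (G \<inter> D)" using precompact_open_Int[OF G D] .
  have V: "void G \<in> sets \<mu>" "void (G \<inter> D) \<in> sets \<mu>" "void (G - D) \<in> sets \<mu>"
    using sets_void[OF G] sets_void[OF GD] sets_void_Diff[OF G D] by (simp_all add: sets_\<mu>)
  have "(\<lambda>p. glue D (fst p) (snd p)) -` void G \<inter> space (\<mu> \<Otimes>\<^sub>M \<mu>) = void (G \<inter> D) \<times> void (G - D)"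
    using glue_configurations
    by (fastforce simp: space_pair_measure space_\<mu> void_def glue_def)
  then have "emeasure (distr (\<mu> \<Otimes>\<^sub>M \<mu>) \<mu> (\<lambda>p. glue D (fst p) (snd p))) (void G)
      = emeasure (\<mu> \<Otimes>\<^sub>M \<mu>) (void (G \<inter> D) \<times> void (G - D))"
    using V(1) measurable_glue[OF D] by (simp add: emeasure_distr)
  also have "\<dots> = ennreal (exp (- measure \<sigma> (G \<inter> D))) * ennreal (exp (- measure \<sigma> (G - D)))"
    using V by (subst emeasure_pair_measure_Times) (simp_all add: emeasure_void[OF G D] emeasure_void_precompact[OF GD])
  also have "\<dots> = ennreal (exp (- (measure \<sigma> (G \<inter> D) + measure \<sigma> (G - D))))"
    by (simp add: ennreal_mult[symmetric] exp_add[symmetric])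
  also have "measure \<sigma> (G \<inter> D) + measure \<sigma> (G - D) = measure \<sigma> ((G \<inter> D) \<union> (G - D))"
    using G D emeasure_finite[OF G, of "G \<inter> D"] emeasure_finite[OF G, of "G - D"]
    by (intro measure_Union[symmetric]) (auto simp: sets_\<sigma> precompact_open_def)
  also have "(G \<inter> D) \<union> (G - D) = G" by blast
  finally show "emeasure (distr (\<mu> \<Otimes>\<^sub>M \<mu>) \<mu> (\<lambda>p. glue D (fst p) (snd p))) (void G) = emeasure \<mu> (void G)"
    by (simp add: emeasure_void_precompact[OF G])
qed (simp_all add: sets_\<mu>)

lemma nn_integral_glue:
  assumes D: "open D" and F[measurable]: "F \<in> borel_measurable \<mu>"
  shows "(\<integral>\<^sup>+ \<eta>. \<integral>\<^sup>+ \<zeta>. F (glue D \<eta> \<zeta>) \<partial>\<mu> \<partial>\<mu>) = (\<integral>\<^sup>+ \<omega>. F \<omega> \<partial>\<mu>)"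
proof -
  note [measurable] = measurable_glue[OF D]
  have "(\<integral>\<^sup>+ \<omega>. F \<omega> \<partial>\<mu>) = (\<integral>\<^sup>+ \<omega>. F \<omega> \<partial>distr (\<mu> \<Otimes>\<^sub>M \<mu>) \<mu> (\<lambda>p. glue D (fst p) (snd p)))"
    by (simp only: distr_glue[OF D])
  also have "\<dots> = (\<integral>\<^sup>+ p. F (glue D (fst p) (snd p)) \<partial>(\<mu> \<Otimes>\<^sub>M \<mu>))"
    by (intro nn_integral_distr) simp_all
  also have "\<dots> = (\<integral>\<^sup>+ \<eta>. \<integral>\<^sup>+ \<zeta>. F (glue D \<eta> \<zeta>) \<partial>\<mu> \<partial>\<mu>)"
    by (subst nn_integral_fst[symmetric]) (auto simp: split_beta)
  finally show ?thesis by simp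
qed

lemma measurable_insert:
  "(\<lambda>p. insert (snd p) (fst p)) \<in> \<mu> \<Otimes>\<^sub>M borel \<rightarrow>\<^sub>M \<mu>"
proof (rule measurable_configI)
  show "insert (snd x) (fst x) \<in> configurations" if "x \<in> space (\<mu> \<Otimes>\<^sub>M borel)" for x
    using that by (auto simp: space_pair_measure space_\<mu> intro: configurations_insert)
  fix G :: "'a set" assume G: "precompact_open G"
  have "{x \<in> space (\<mu> \<Otimes>\<^sub>M borel). insert (snd x) (fst x) \<inter> G = {}} = void G \<times> (- G)"
    by (auto simp: space_pair_measure space_\<mu> void_def)
  then show "{x \<in> space (\<mu> \<Otimes>\<^sub>M borel). insert (snd x) (fst x) \<inter> G = {}} \<in> sets (\<mu> \<Otimes>\<^sub>M borel)"
    using sets_void[OF G] precompact_openD(1)[OF G] by (simp add: sets_\<mu>)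
qed

lemma measurable_insert'[measurable (raw)]:
  assumes "f \<in> M \<rightarrow>\<^sub>M borel" "g \<in> M \<rightarrow>\<^sub>M \<mu>"
  shows "(\<lambda>x. insert (f x) (g x)) \<in> M \<rightarrow>\<^sub>M \<mu>"
  using measurable_compose[OF measurable_Pair[OF assms(2,1)] measurable_insert] by simp

text \<open>Both sides are integrals of \<open>H\<close> against finite measures on configurations, so it suffices to compare
  these on void events. On the void event of \<open>G'\<close> the points counted in \<open>G - D\<close> all lie outside \<open>G'\<close>,
  hence they are independent of the event and their mean number is \<open>\<sigma> (G - (D \<union> G'))\<close>. On the other
  side, an added point must avoid \<open>G'\<close>, which gives the same product.\<close>

lemma mecke:
  assumes G: "precompact_open G" and D: "open D" and H[measurable]: "H \<in> borel_measurable \<mu>"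
  shows "(\<integral>\<^sup>+ \<omega>. num_points (G - D) \<omega> * H \<omega> \<partial>\<mu>) = (\<integral>\<^sup>+ x. indicator (G - D) x * (\<integral>\<^sup>+ \<omega>. H (insert x \<omega>) \<partial>\<mu>) \<partial>\<sigma>)"
proof -
  note [measurable] = measurable_num_points[OF G D] sets_Diff[OF G D]
  define S where "S = density \<sigma> (indicator (G - D))"
  have sets_S[measurable_cong]: "sets S = sets borel" by (simp add: S_def sets_\<sigma>)
  have GD: "G - D \<in> sets \<sigma>" using sets_Diff[OF G D] by (simp add: sets_\<sigma>)
  have "emeasure S (space S) = emeasure \<sigma> (G - D)"
    unfolding S_def using GD by (subst emeasure_density) (simp_all add: space_\<sigma>)
  then interpret S: finite_measure S
    using emeasure_finite[OF G, of "G - D"] by (intro finite_measureI) (auto simp: less_top)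
  interpret Sp: pair_sigma_finite S \<mu> ..
  define M1 where "M1 = density \<mu> (num_points (G - D))"
  define M2 where "M2 = distr (S \<Otimes>\<^sub>M \<mu>) \<mu> (\<lambda>p. insert (fst p) (snd p))"
  have "M1 = M2"
  proof (rule measure_eqI_void[OF sigma_compact])
    show "sets M1 = sets config_space" "sets M2 = sets config_space"
      by (simp_all add: M1_def M2_def sets_\<mu>)
    have "emeasure M1 (space M1) = emeasure \<sigma> (G - D)"
      unfolding M1_def using nn_integral_num_points[OF G D]
      by (subst emeasure_density) (simp_all add: nn_integral_set_ennreal[symmetric] cong: nn_integral_cong)
    then show "finite_measure M1"
      using emeasure_finite[OF G, of "G - D"] by (intro finite_measureI) (auto simp: less_top)
    fix G' :: "'a set" assume G': "precompact_open G'"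
    have DG': "open (D \<union> G')" using D precompact_openD(1)[OF G'] by auto
    have V: "void G' \<in> sets \<mu>" using sets_void[OF G'] by (simp add: sets_\<mu>)
    note [measurable] = measurable_num_points[OF G DG'] V
    have "emeasure M1 (void G') = (\<integral>\<^sup>+ \<omega>. num_points (G - D) \<omega> * indicator (void G') \<omega> \<partial>\<mu>)"
      unfolding M1_def by (subst emeasure_density) simp_all
    also have "\<dots> = (\<integral>\<^sup>+ \<omega>. num_points (G - (D \<union> G')) \<omega> * indicator (void G') \<omega> \<partial>\<mu>)"
      by (intro nn_integral_cong) (auto simp: indicator_def void_def num_points_def intro!: arg_cong[where f=card])
    also have "\<dots> = (\<integral>\<^sup>+ \<eta>. \<integral>\<^sup>+ \<zeta>. num_points (G - (D \<union> G')) (glue G' \<eta> \<zeta>) * indicator (void G') (glue G' \<eta> \<zeta>) \<partial>\<mu> \<partial>\<mu>)"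
      by (rule nn_integral_glue[OF precompact_openD(1)[OF G'], symmetric]) simp
    also have "\<dots> = (\<integral>\<^sup>+ \<eta>. \<integral>\<^sup>+ \<zeta>. num_points (G - (D \<union> G')) \<zeta> * indicator (void G') \<eta> \<partial>\<mu> \<partial>\<mu>)"
    proof (intro nn_integral_cong arg_cong2[where f="(*)"])
      fix \<eta> \<zeta> assume "\<eta> \<in> space \<mu>" "\<zeta> \<in> space \<mu>"
      then show "indicator (void G') (glue G' \<eta> \<zeta>) = (indicator (void G') \<eta> :: ennreal)"
        using glue_configurations[of \<eta> \<zeta> G'] by (auto simp: space_\<mu> indicator_def void_def glue_def)
    qed (auto simp: num_points_def glue_def intro!: arg_cong[where f=card])
    also have "\<dots> = emeasure \<sigma> (G - (D \<union> G')) * emeasure \<mu> (void G')"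
      by (simp add: nn_integral_multc nn_integral_cmult nn_integral_num_points[OF G DG'])
    finally have 1: "emeasure M1 (void G') = emeasure \<sigma> (G - (D \<union> G')) * emeasure \<mu> (void G')" .
    have "(\<lambda>p. insert (fst p) (snd p)) -` void G' \<inter> space (S \<Otimes>\<^sub>M \<mu>) = (- G') \<times> void G'"
      using configurations_insert by (auto simp: space_pair_measure space_\<mu> void_def S_def space_\<sigma> elim: configurations_subset)
    then have "emeasure M2 (void G') = emeasure (S \<Otimes>\<^sub>M \<mu>) ((- G') \<times> void G')"
      unfolding M2_def by (subst emeasure_distr) simp_all
    also have "\<dots> = emeasure S (- G') * emeasure \<mu> (void G')"
      using precompact_openD(1)[OF G'] by (intro emeasure_pair_measure_Times) (simp_all add: sets_S V)
    also have "emeasure S (- G') = emeasure \<sigma> (G - (D \<union> G'))"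
    proof -
      have "- G' \<in> sets \<sigma>" using precompact_openD(1)[OF G'] by (simp add: sets_\<sigma>)
      then have "emeasure S (- G') = (\<integral>\<^sup>+ x. indicator (G - D) x * indicator (- G') x \<partial>\<sigma>)"
        unfolding S_def by (subst emeasure_density) simp_all
      also have "\<dots> = (\<integral>\<^sup>+ x. indicator (G - (D \<union> G')) x \<partial>\<sigma>)"
        by (intro nn_integral_cong) (auto simp: indicator_def)
      finally show ?thesis using G DG' by (simp add: sets_\<sigma> sets_Diff)
    qed
    finally show "emeasure M1 (void G') = emeasure M2 (void G')" using 1 by simp
  qed
  have "(\<integral>\<^sup>+ \<omega>. num_points (G - D) \<omega> * H \<omega> \<partial>\<mu>) = (\<integral>\<^sup>+ \<omega>. H \<omega> \<partial>M1)"
    unfolding M1_def by (subst nn_integral_density) simp_all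
  also have "\<dots> = (\<integral>\<^sup>+ p. H (insert (fst p) (snd p)) \<partial>(S \<Otimes>\<^sub>M \<mu>))"
    unfolding \<open>M1 = M2\<close> M2_def by (intro nn_integral_distr) simp_all
  also have "\<dots> = (\<integral>\<^sup>+ x. \<integral>\<^sup>+ \<omega>. H (insert x \<omega>) \<partial>\<mu> \<partial>S)"
    by (subst nn_integral_fst[symmetric]) (auto simp: split_beta)
  also have "\<dots> = (\<integral>\<^sup>+ x. indicator (G - D) x * (\<integral>\<^sup>+ \<omega>. H (insert x \<omega>) \<partial>\<mu>) \<partial>\<sigma>)"
    unfolding S_def by (subst nn_integral_density) (simp_all add: sets_\<sigma>)
  finally show ?thesis .
qed

end

section \<open>Maximal coupling of a probability measure with a density\<close>

text \<open>The distance of extended nonnegative numbers. The case distinction is needed since \<open>\<infinity> - \<infinity> = \<infinity>\<close> in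
  this type.\<close>

definition edist :: "ennreal \<Rightarrow> ennreal \<Rightarrow> ennreal" where
  "edist x y = (if x = y then 0 else (x - y) + (y - x))"

lemma edist_commute: "edist x y = edist y x"
  by (simp add: edist_def add.commute)

lemma measurable_edist[measurable (raw)]:
  assumes [measurable]: "f \<in> borel_measurable M" "g \<in> borel_measurable M"
  shows "(\<lambda>x. edist (f x) (g x)) \<in> borel_measurable M"
  unfolding edist_def by measurable

lemma ennreal_diff_eq_0: "(x::ennreal) < y \<Longrightarrow> x - y = 0"
  by (auto simp: diff_eq_0_iff_ennreal intro: order_less_le_trans)

lemma ennreal_le_diff_add: "(x::ennreal) \<le> y + (x - y)"
  by (metis ennreal_minus_le_iff order_refl)

lemma edist_leI:
  assumes "x \<le> y + c" "y \<le> x + c"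
  shows "edist x y \<le> c"
proof (cases x y rule: linorder_cases)
  case less
  then show ?thesis using assms by (auto simp: edist_def ennreal_diff_eq_0 ennreal_minus_le_iff)
next
  case greater
  then show ?thesis using assms by (auto simp: edist_def ennreal_diff_eq_0 ennreal_minus_le_iff)
qed (simp add: edist_def)

lemma le_add_edist: "x \<le> y + edist x y"
proof (cases "x = y")
  case False
  have "x \<le> y + (x - y) + (y - x)" using ennreal_le_diff_add by (rule add_increasing2[OF zero_le])
  then show ?thesis using False by (simp add: edist_def add.assoc)
qed (simp add: edist_def)

lemma edist_triangle: "edist x z \<le> edist x y + edist y z"
proof (rule edist_leI)
  have "x \<le> y + edist x y" by (rule le_add_edist)
  also have "\<dots> \<le> (z + edist y z) + edist x y" by (intro add_mono le_add_edist order_refl)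
  finally show "x \<le> z + (edist x y + edist y z)" by (simp add: ac_simps)
  have "z \<le> y + edist z y" by (rule le_add_edist)
  also have "\<dots> \<le> (x + edist y x) + edist z y" by (intro add_mono le_add_edist order_refl)
  finally show "z \<le> x + (edist x y + edist y z)" by (simp add: ac_simps edist_commute)
qed

lemma edist_le_add: "edist x y \<le> x + y"
  by (rule edist_leI) (auto intro: add_increasing add_increasing2)

lemma edist_nn_integral_le:
  assumes [measurable]: "f \<in> borel_measurable M" "g \<in> borel_measurable M"
  shows "edist (\<integral>\<^sup>+ x. f x \<partial>M) (\<integral>\<^sup>+ x. g x \<partial>M) \<le> (\<integral>\<^sup>+ x. edist (f x) (g x) \<partial>M)"
proof (rule edist_leI)
  have "(\<integral>\<^sup>+ x. f x \<partial>M) \<le> (\<integral>\<^sup>+ x. g x + edist (f x) (g x) \<partial>M)"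
    by (intro nn_integral_mono le_add_edist)
  then show "(\<integral>\<^sup>+ x. f x \<partial>M) \<le> (\<integral>\<^sup>+ x. g x \<partial>M) + (\<integral>\<^sup>+ x. edist (f x) (g x) \<partial>M)"
    by (subst nn_integral_add[symmetric]) simp_all
  have "(\<integral>\<^sup>+ x. g x \<partial>M) \<le> (\<integral>\<^sup>+ x. f x + edist (g x) (f x) \<partial>M)"
    by (intro nn_integral_mono le_add_edist)
  then show "(\<integral>\<^sup>+ x. g x \<partial>M) \<le> (\<integral>\<^sup>+ x. f x \<partial>M) + (\<integral>\<^sup>+ x. edist (f x) (g x) \<partial>M)"
    by (subst nn_integral_add[symmetric]) (simp_all add: edist_commute)
qed

lemma edist_ennreal_le: "edist (ennreal a) (ennreal b) \<le> ennreal \<bar>a - b\<bar>"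
proof (rule edist_leI)
  have *: "ennreal x \<le> ennreal y + ennreal \<bar>x - y\<bar>" for x y
  proof -
    have "ennreal x \<le> ennreal (max 0 y + \<bar>x - y\<bar>)" by (intro ennreal_leI) auto
    then show ?thesis by (subst (asm) ennreal_plus) auto
  qed
  show "ennreal a \<le> ennreal b + ennreal \<bar>a - b\<bar>" "ennreal b \<le> ennreal a + ennreal \<bar>a - b\<bar>"
    using *[of a b] *[of b a] by (auto simp: abs_minus_commute)
qed

lemma edist_finite: "a < \<infinity> \<Longrightarrow> edist p a = (p - a) + (a - p)"
  by (auto simp: edist_def diff_eq_0_iff_ennreal)

text \<open>The probability with which a maximal coupling keeps a point, where the density to be coupled has the
  value \<open>p\<close> and the reference density is the constant \<open>a\<close>. Densities are not normalized: both have
  total mass \<open>a\<close>.\<close>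

definition accept :: "ennreal \<Rightarrow> ennreal \<Rightarrow> ennreal" where
  "accept a p = (if p \<le> a then 1 else a / p)"

lemma accept_le_1: "accept a p \<le> 1"
proof (cases "p \<le> a")
  case False
  then show ?thesis by (auto simp: accept_def not_le intro!: divide_le_posI_ennreal intro: order_le_less_trans[OF zero_le])
qed (simp add: accept_def)

lemma measurable_accept[measurable (raw)]:
  assumes [measurable]: "f \<in> borel_measurable M" "g \<in> borel_measurable M"
  shows "(\<lambda>x. accept (f x) (g x)) \<in> borel_measurable M"
  unfolding accept_def by measurable

lemma mult_accept: "p < \<infinity> \<Longrightarrow> p * accept a p = min p a"
  using mult_divide_eq_ennreal[of p a]
  by (cases "p = 0") (auto simp: accept_def min_def ennreal_times_divide mult.commute)

lemma mult_reject:
  assumes "p < \<infinity>"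
  shows "p * (1 - accept a p) = p - a"
proof -
  have "p * (1 - accept a p) = p * 1 - p * accept a p"
    using assms by (intro ennreal_right_diff_distrib) auto
  also have "\<dots> = p - a" using mult_accept[OF assms, of a] assms
    by (auto simp: min_def diff_eq_0_ennreal top_unique)
  finally show ?thesis .
qed

lemma min_add_diff: "min p a + (a - p) = (a::ennreal)"
  by (cases "p \<le> a") (auto simp: min_def diff_add_cancel_ennreal add.commute ennreal_diff_eq_0 not_le)

context prob_space
begin

definition deficit :: "ennreal \<Rightarrow> ('a \<Rightarrow> ennreal) \<Rightarrow> ennreal" where
  "deficit a p = (\<integral>\<^sup>+ \<xi>. a - p \<xi> \<partial>M)"

text \<open>The density from which a rejected point is drawn again: the part of the constant density \<open>a\<close> that \<open>p\<close>
  leaves uncovered. The value \<open>1\<close> in the degenerate cases makes this a probability density for every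
  argument, so that it defines a Markov kernel everywhere and not only almost everywhere.\<close>

definition refill :: "ennreal \<Rightarrow> ('a \<Rightarrow> ennreal) \<Rightarrow> 'a \<Rightarrow> ennreal" where
  "refill a p \<xi> = (if deficit a p = 0 \<or> deficit a p = \<infinity> then 1 else (a - p \<xi>) / deficit a p)"

lemma measurable_refill[measurable]: "p \<in> borel_measurable M \<Longrightarrow> refill a p \<in> borel_measurable M"
  unfolding refill_def[abs_def] by (cases "deficit a p = 0 \<or> deficit a p = \<infinity>") auto

lemma nn_integral_refill:
  assumes [measurable]: "p \<in> borel_measurable M"
  shows "(\<integral>\<^sup>+ \<xi>. refill a p \<xi> \<partial>M) = 1"
proof (cases "deficit a p = 0 \<or> deficit a p = \<infinity>")
  case True
  then show ?thesis by (simp add: refill_def[abs_def] emeasure_space_1)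
next
  case False
  then have "(\<integral>\<^sup>+ \<xi>. refill a p \<xi> \<partial>M) = deficit a p / deficit a p"
    unfolding refill_def[abs_def] by (simp add: nn_integral_divide deficit_def)
  then show ?thesis using False by (simp add: less_top zero_less_iff_neq_zero)
qed

context
  fixes p :: "'a \<Rightarrow> ennreal" and a :: ennreal
  assumes p[measurable]: "p \<in> borel_measurable M" and a: "(\<integral>\<^sup>+ \<xi>. p \<xi> \<partial>M) = a" and a_fin: "a < \<infinity>"
begin

lemma AE_p_finite: "AE \<xi> in M. p \<xi> < \<infinity>"
  using nn_integral_noteq_infinite[OF p] a a_fin by (auto simp: less_top)

lemma deficit_finite: "deficit a p < \<infinity>"
proof -
  have "deficit a p \<le> (\<integral>\<^sup>+ \<xi>. a \<partial>M)"
    unfolding deficit_def by (intro nn_integral_mono) (simp add: diff_le_self_ennreal)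
  then show ?thesis using a_fin by (simp add: emeasure_space_1 order_le_less_trans)
qed

text \<open>The densities \<open>p\<close> and \<open>a\<close> have the same total mass, so what \<open>p\<close> has too much it lacks elsewhere.\<close>

lemma nn_integral_excess: "(\<integral>\<^sup>+ \<xi>. p \<xi> - a \<partial>M) = deficit a p"
proof -
  have "a + deficit a p = (\<integral>\<^sup>+ \<xi>. p \<xi> + (a - p \<xi>) \<partial>M)"
    unfolding deficit_def a[symmetric] by (rule nn_integral_add[symmetric]) simp_all
  also have "\<dots> = (\<integral>\<^sup>+ \<xi>. a + (p \<xi> - a) \<partial>M)"
  proof (intro nn_integral_cong)
    fix \<xi> show "p \<xi> + (a - p \<xi>) = a + (p \<xi> - a)"
      using a_fin
    proof (cases "p \<xi>" a rule: linorder_cases)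
      case less
      then show ?thesis by (simp add: ennreal_diff_eq_0 add_diff_inverse_ennreal)
    next
      case greater
      then show ?thesis by (simp add: ennreal_diff_eq_0 add_diff_inverse_ennreal)
    qed simp
  qed
  also have "\<dots> = a + (\<integral>\<^sup>+ \<xi>. p \<xi> - a \<partial>M)"
    by (subst nn_integral_add) (simp_all add: emeasure_space_1)
  finally show ?thesis using a_fin by (auto simp: ennreal_add_left_cancel)
qed

lemma deficit_mult_refill:
  assumes [measurable]: "f \<in> borel_measurable M"
  shows "deficit a p * (\<integral>\<^sup>+ \<xi>. refill a p \<xi> * f \<xi> \<partial>M) = (\<integral>\<^sup>+ \<xi>. (a - p \<xi>) * f \<xi> \<partial>M)"
proof (cases "deficit a p = 0")
  case True
  then have "AE \<xi> in M. a - p \<xi> = 0" unfolding deficit_def by (subst (asm) nn_integral_0_iff_AE) auto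
  then have "(\<integral>\<^sup>+ \<xi>. (a - p \<xi>) * f \<xi> \<partial>M) = (\<integral>\<^sup>+ \<xi>. 0 \<partial>M)"
    by (intro nn_integral_cong_AE) auto
  then show ?thesis using True by simp
next
  case False
  then have eq: "deficit a p * refill a p \<xi> = a - p \<xi>" for \<xi>
    using deficit_finite mult_divide_eq_ennreal[of "deficit a p" "a - p \<xi>"]
    by (auto simp: refill_def ennreal_times_divide mult.commute)
  have "deficit a p * (\<integral>\<^sup>+ \<xi>. refill a p \<xi> * f \<xi> \<partial>M) = (\<integral>\<^sup>+ \<xi>. deficit a p * refill a p \<xi> * f \<xi> \<partial>M)"
    by (subst nn_integral_cmult[symmetric]) (simp_all add: mult.assoc)
  then show ?thesis by (simp add: eq)
qed

text \<open>A point of density \<open>p\<close> that is kept with probability \<open>accept\<close> and otherwise drawn again has the density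
  \<open>min p a + (a - p) = a\<close>.\<close>

lemma maximal_coupling_marginal:
  assumes [measurable]: "f \<in> borel_measurable M"
  shows "(\<integral>\<^sup>+ \<zeta>. p \<zeta> * (accept a (p \<zeta>) * f \<zeta> + (1 - accept a (p \<zeta>)) * (\<integral>\<^sup>+ \<xi>. refill a p \<xi> * f \<xi> \<partial>M)) \<partial>M)
    = a * (\<integral>\<^sup>+ \<xi>. f \<xi> \<partial>M)"
    (is "(\<integral>\<^sup>+ \<zeta>. p \<zeta> * (_ + _ * ?R) \<partial>M) = _")
proof -
  have "(\<integral>\<^sup>+ \<zeta>. p \<zeta> * (accept a (p \<zeta>) * f \<zeta> + (1 - accept a (p \<zeta>)) * ?R) \<partial>M)
      = (\<integral>\<^sup>+ \<zeta>. min (p \<zeta>) a * f \<zeta> + (p \<zeta> - a) * ?R \<partial>M)"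
    using AE_p_finite
  proof (intro nn_integral_cong_AE, elim eventually_mono)
    fix \<zeta> assume "p \<zeta> < \<infinity>"
    then show "p \<zeta> * (accept a (p \<zeta>) * f \<zeta> + (1 - accept a (p \<zeta>)) * ?R) = min (p \<zeta>) a * f \<zeta> + (p \<zeta> - a) * ?R"
      by (simp add: distrib_left mult.assoc[symmetric] mult_accept mult_reject)
  qed
  also have "\<dots> = (\<integral>\<^sup>+ \<zeta>. min (p \<zeta>) a * f \<zeta> \<partial>M) + deficit a p * ?R"
    by (subst nn_integral_add) (simp_all add: nn_integral_multc nn_integral_excess)
  also have "\<dots> = (\<integral>\<^sup>+ \<zeta>. min (p \<zeta>) a * f \<zeta> + (a - p \<zeta>) * f \<zeta> \<partial>M)"
    by (subst nn_integral_add) (simp_all add: deficit_mult_refill)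
  also have "\<dots> = (\<integral>\<^sup>+ \<zeta>. a * f \<zeta> \<partial>M)"
    by (simp add: distrib_right[symmetric] min_add_diff)
  finally show ?thesis by (simp add: nn_integral_cmult)
qed

text \<open>Charging the weights of the old and of the new point on rejection costs the integral of \<open>N\<close> against
  \<open>p - a\<close> for the old point and against \<open>a - p\<close> for the new one.\<close>

lemma maximal_coupling_cost:
  assumes [measurable]: "N \<in> borel_measurable M"
  shows "(\<integral>\<^sup>+ \<zeta>. p \<zeta> * ((1 - accept a (p \<zeta>)) * (N \<zeta> + (\<integral>\<^sup>+ \<xi>. refill a p \<xi> * N \<xi> \<partial>M))) \<partial>M)
    = (\<integral>\<^sup>+ \<zeta>. edist (p \<zeta>) a * N \<zeta> \<partial>M)"
    (is "(\<integral>\<^sup>+ \<zeta>. p \<zeta> * (_ * (_ + ?R)) \<partial>M) = _")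
proof -
  have "(\<integral>\<^sup>+ \<zeta>. p \<zeta> * ((1 - accept a (p \<zeta>)) * (N \<zeta> + ?R)) \<partial>M)
      = (\<integral>\<^sup>+ \<zeta>. (p \<zeta> - a) * N \<zeta> + (p \<zeta> - a) * ?R \<partial>M)"
    using AE_p_finite
    by (intro nn_integral_cong_AE, elim eventually_mono) (simp add: distrib_left mult.assoc[symmetric] mult_reject)
  also have "\<dots> = (\<integral>\<^sup>+ \<zeta>. (p \<zeta> - a) * N \<zeta> \<partial>M) + deficit a p * ?R"
    by (subst nn_integral_add) (simp_all add: nn_integral_multc nn_integral_excess)
  also have "\<dots> = (\<integral>\<^sup>+ \<zeta>. (p \<zeta> - a) * N \<zeta> + (a - p \<zeta>) * N \<zeta> \<partial>M)"
    by (subst nn_integral_add) (simp_all add: deficit_mult_refill)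
  finally show ?thesis by (simp add: distrib_right[symmetric] edist_finite[OF a_fin])
qed

lemma nn_integral_edist: "(\<integral>\<^sup>+ \<zeta>. edist (p \<zeta>) a \<partial>M) = 2 * deficit a p"
  unfolding edist_finite[OF a_fin] by (subst nn_integral_add) (simp_all add: nn_integral_excess deficit_def[symmetric] mult_2)

text \<open>As \<open>p\<close> is constant on the set where \<open>N < 1\<close>, one of \<open>p - a\<close> and \<open>a - p\<close> vanishes on all of
  that set. Its integral is bounded by the weighted one, and both have integral \<open>deficit\<close>.\<close>

lemma deficit_le:
  assumes N[measurable]: "N \<in> borel_measurable M"
    and c: "\<And>\<zeta>. \<zeta> \<in> space M \<Longrightarrow> N \<zeta> \<ge> 1 \<or> p \<zeta> = c"
  shows "deficit a p \<le> (\<integral>\<^sup>+ \<zeta>. edist (p \<zeta>) a * N \<zeta> \<partial>M)"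
proof (cases "c \<le> a")
  case True
  show ?thesis
    unfolding nn_integral_excess[symmetric]
  proof (rule nn_integral_mono)
    fix \<zeta> assume "\<zeta> \<in> space M"
    then consider "N \<zeta> \<ge> 1" | "p \<zeta> - a = 0" using c[of \<zeta>] True a_fin by (auto simp: diff_eq_0_iff_ennreal)
    then show "p \<zeta> - a \<le> edist (p \<zeta>) a * N \<zeta>"
    proof cases
      case 1
      then have "(p \<zeta> - a) * 1 \<le> edist (p \<zeta>) a * N \<zeta>"
        by (intro mult_mono) (auto simp: edist_finite[OF a_fin])
      then show ?thesis by simp
    qed simp
  qed
next
  case False
  show ?thesis
    unfolding deficit_def
  proof (rule nn_integral_mono)
    fix \<zeta> assume "\<zeta> \<in> space M"
    then consider "N \<zeta> \<ge> 1" | "a - p \<zeta> = 0" using c[of \<zeta>] False a_fin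
      by (auto simp: diff_eq_0_iff_ennreal)
    then show "a - p \<zeta> \<le> edist (p \<zeta>) a * N \<zeta>"
    proof cases
      case 1
      then have "(a - p \<zeta>) * 1 \<le> edist (p \<zeta>) a * N \<zeta>"
        by (intro mult_mono) (auto simp: edist_finite[OF a_fin])
      then show ?thesis by simp
    qed simp
  qed
qed

end

end

section \<open>The cost of revealing one cell\<close>

locale poisson_density = poisson_process \<sigma> \<mu>
  for \<sigma> :: "'a::metric_space measure" and \<mu> +
  fixes L :: "'a set \<Rightarrow> ennreal"
  assumes L[measurable]: "L \<in> borel_measurable \<mu>"
    and L_1: "(\<integral>\<^sup>+ \<omega>. L \<omega> \<partial>\<mu>) = 1"
begin

text \<open>The conditional expectation of \<open>L\<close> given the configuration inside \<open>D\<close>, in an explicit version that is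
  defined for every configuration: by independence, the part outside \<open>D\<close> is integrated out.\<close>

definition cond_density :: "'a set \<Rightarrow> 'a set \<Rightarrow> ennreal" where
  "cond_density D \<eta> = (\<integral>\<^sup>+ \<zeta>. L (glue D \<eta> \<zeta>) \<partial>\<mu>)"

lemma measurable_cond_density[measurable]: "open D \<Longrightarrow> cond_density D \<in> borel_measurable \<mu>"
  unfolding cond_density_def[abs_def] by measurable

lemma cond_density_glue: "cond_density D (glue D \<eta> \<zeta>) = cond_density D \<eta>"
proof -
  have "glue D (glue D \<eta> \<zeta>) \<xi> = glue D \<eta> \<xi>" for \<xi>
    by (auto simp: glue_def)
  then show ?thesis by (simp add: cond_density_def)
qed

lemma cond_density_cong: "\<eta> \<inter> D = \<eta>' \<inter> D \<Longrightarrow> cond_density D \<eta> = cond_density D \<eta>'"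
  by (simp add: cond_density_def glue_def)

lemma cond_density_tower:
  assumes "open D" "open D'" "D \<subseteq> D'" "\<eta> \<in> space \<mu>"
  shows "(\<integral>\<^sup>+ \<zeta>. cond_density D' (glue D \<eta> \<zeta>) \<partial>\<mu>) = cond_density D \<eta>"
proof -
  have [measurable]: "open D" "open D'" "\<eta> \<in> space \<mu>" by fact+
  have "glue D' (glue D \<eta> \<zeta>) \<xi> = glue D \<eta> (glue D' \<zeta> \<xi>)" for \<zeta> \<xi>
    using assms(3) by (auto simp: glue_def)
  then have "(\<integral>\<^sup>+ \<zeta>. cond_density D' (glue D \<eta> \<zeta>) \<partial>\<mu>) = (\<integral>\<^sup>+ \<zeta>. \<integral>\<^sup>+ \<xi>. L (glue D \<eta> (glue D' \<zeta> \<xi>)) \<partial>\<mu> \<partial>\<mu>)"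
    by (simp add: cond_density_def)
  also have "\<dots> = (\<integral>\<^sup>+ \<zeta>. L (glue D \<eta> \<zeta>) \<partial>\<mu>)"
    by (rule nn_integral_glue) measurable
  finally show ?thesis by (simp add: cond_density_def)
qed

lemma nn_integral_cond_density_mult:
  assumes D[measurable]: "open D" and \<Phi>[measurable]: "\<Phi> \<in> borel_measurable \<mu>"
    and dep: "\<And>\<eta> \<zeta>. \<eta> \<in> space \<mu> \<Longrightarrow> \<zeta> \<in> space \<mu> \<Longrightarrow> \<Phi> (glue D \<eta> \<zeta>) = \<Phi> \<eta>"
  shows "(\<integral>\<^sup>+ \<omega>. L \<omega> * \<Phi> \<omega> \<partial>\<mu>) = (\<integral>\<^sup>+ \<omega>. cond_density D \<omega> * \<Phi> \<omega> \<partial>\<mu>)"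
proof -
  have "(\<integral>\<^sup>+ \<omega>. L \<omega> * \<Phi> \<omega> \<partial>\<mu>) = (\<integral>\<^sup>+ \<eta>. \<integral>\<^sup>+ \<zeta>. L (glue D \<eta> \<zeta>) * \<Phi> (glue D \<eta> \<zeta>) \<partial>\<mu> \<partial>\<mu>)"
    by (rule nn_integral_glue[symmetric]) measurable
  also have "\<dots> = (\<integral>\<^sup>+ \<eta>. \<integral>\<^sup>+ \<zeta>. L (glue D \<eta> \<zeta>) * \<Phi> \<eta> \<partial>\<mu> \<partial>\<mu>)"
    by (intro nn_integral_cong) (simp add: dep)
  also have "\<dots> = (\<integral>\<^sup>+ \<eta>. cond_density D \<eta> * \<Phi> \<eta> \<partial>\<mu>)"
    unfolding cond_density_def by (intro nn_integral_cong nn_integral_multc) measurable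
  finally show ?thesis .
qed

lemma nn_integral_cond_density: "open D \<Longrightarrow> (\<integral>\<^sup>+ \<omega>. cond_density D \<omega> \<partial>\<mu>) = 1"
  using nn_integral_cond_density_mult[of D "\<lambda>_. 1"] L_1 by simp

lemma AE_cond_density_finite: "open D \<Longrightarrow> AE \<omega> in \<mu>. cond_density D \<omega> < \<infinity>"
  using nn_integral_noteq_infinite[OF measurable_cond_density, of D] nn_integral_cond_density[of D] by (auto simp: less_top)

definition grad :: "'a \<Rightarrow> 'a set \<Rightarrow> ennreal" where
  "grad x \<omega> = edist (L (insert x \<omega>)) (L \<omega>)"

lemma measurable_grad[measurable (raw)]:
  assumes [measurable]: "f \<in> M \<rightarrow>\<^sub>M borel" "g \<in> M \<rightarrow>\<^sub>M \<mu>"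
  shows "(\<lambda>x. grad (f x) (g x)) \<in> borel_measurable M"
  unfolding grad_def by measurable

text \<open>
  The configuration in \<open>D\<close> is known, and the cell \<open>G - D\<close> is revealed.
\<close>

context
  fixes G D :: "'a set"
  assumes G: "precompact_open G" and D[measurable]: "open D"
begin

lemma open_D': "open (D \<union> G)"
  using D precompact_openD(1)[OF G] by auto

lemmas [measurable] = open_D' measurable_num_points[OF G D] sets_Diff[OF G D]

lemma num_points_glue: "num_points (G - D) (glue D \<eta> \<zeta>) = num_points (G - D) \<zeta>"
  by (auto simp: num_points_def glue_def intro!: arg_cong[where f=card])

definition cell_gap :: "'a set \<Rightarrow> ennreal" where
  "cell_gap \<omega> = edist (cond_density (D \<union> G) \<omega>) (cond_density D \<omega>)"

text \<open>The expected number of points that the old and the new configuration have in the cell when the maximal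
  coupling rejects, see \<open>maximal_coupling_cost\<close>.\<close>

definition cell_cost :: ennreal where
  "cell_cost = (\<integral>\<^sup>+ \<omega>. cell_gap \<omega> * num_points (G - D) \<omega> \<partial>\<mu>)"

definition cell_gradient :: ennreal where
  "cell_gradient = (\<integral>\<^sup>+ x. indicator (G - D) x * (\<integral>\<^sup>+ \<omega>. grad x \<omega> \<partial>\<mu>) \<partial>\<sigma>)"

lemma measurable_cell_gap[measurable]: "cell_gap \<in> borel_measurable \<mu>"
  unfolding cell_gap_def[abs_def] by measurable

lemma cell_cost_cond:
  "cell_cost = (\<integral>\<^sup>+ \<eta>. \<integral>\<^sup>+ \<zeta>. edist (cond_density (D \<union> G) (glue D \<eta> \<zeta>)) (cond_density D \<eta>) * num_points (G - D) \<zeta> \<partial>\<mu> \<partial>\<mu>)"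
  unfolding cell_cost_def
  by (subst nn_integral_glue[OF D, symmetric]) (simp_all add: cell_gap_def cond_density_glue num_points_glue)

text \<open>If the cell is empty, then what is known after revealing it is just \<open>\<eta> \<inter> D\<close>, so the conditional density
  takes a fixed value on all such configurations, as required by \<open>deficit_le\<close>.\<close>

lemma deficit_le_cost:
  assumes "\<eta> \<in> space \<mu>" "cond_density D \<eta> < \<infinity>"
  shows "deficit (cond_density D \<eta>) (\<lambda>\<zeta>. cond_density (D \<union> G) (glue D \<eta> \<zeta>))
    \<le> (\<integral>\<^sup>+ \<zeta>. edist (cond_density (D \<union> G) (glue D \<eta> \<zeta>)) (cond_density D \<eta>) * num_points (G - D) \<zeta> \<partial>\<mu>)"
proof (rule deficit_le)
  have [measurable]: "\<eta> \<in> space \<mu>" by fact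
  show "(\<lambda>\<zeta>. cond_density (D \<union> G) (glue D \<eta> \<zeta>)) \<in> borel_measurable \<mu>" by measurable
  show "(\<integral>\<^sup>+ \<zeta>. cond_density (D \<union> G) (glue D \<eta> \<zeta>) \<partial>\<mu>) = cond_density D \<eta>"
    using assms by (intro cond_density_tower open_D' D) auto
  fix \<zeta> assume \<zeta>: "\<zeta> \<in> space \<mu>"
  show "1 \<le> num_points (G - D) \<zeta> \<or> cond_density (D \<union> G) (glue D \<eta> \<zeta>) = cond_density (D \<union> G) (\<eta> \<inter> D)"
  proof (cases "\<zeta> \<inter> (G - D) = {}")
    case True
    then show ?thesis by (intro disjI2 cond_density_cong) (auto simp: glue_def)
  next
    case False
    moreover have "finite (\<zeta> \<inter> (G - D))"
      using \<zeta> by (intro configurations_finite_precompact[OF _ G]) (auto simp: space_\<mu>)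
    ultimately have "1 \<le> card (\<zeta> \<inter> (G - D))" by (simp add: Suc_le_eq card_gt_0_iff)
    then have "(of_nat 1 :: ennreal) \<le> of_nat (card (\<zeta> \<inter> (G - D)))" by (simp only: of_nat_le_iff)
    then show ?thesis by (simp add: num_points_def)
  qed
qed (use assms in simp_all)

lemma nn_integral_cell_gap: "(\<integral>\<^sup>+ \<omega>. cell_gap \<omega> \<partial>\<mu>) \<le> 2 * cell_cost"
proof -
  have "(\<integral>\<^sup>+ \<omega>. cell_gap \<omega> \<partial>\<mu>) = (\<integral>\<^sup>+ \<eta>. \<integral>\<^sup>+ \<zeta>. edist (cond_density (D \<union> G) (glue D \<eta> \<zeta>)) (cond_density D \<eta>) \<partial>\<mu> \<partial>\<mu>)"
    by (subst nn_integral_glue[OF D, symmetric]) (simp_all add: cell_gap_def cond_density_glue)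
  also have "\<dots> \<le> (\<integral>\<^sup>+ \<eta>. 2 * (\<integral>\<^sup>+ \<zeta>. edist (cond_density (D \<union> G) (glue D \<eta> \<zeta>)) (cond_density D \<eta>) * num_points (G - D) \<zeta> \<partial>\<mu>) \<partial>\<mu>)"
  proof (rule nn_integral_mono_AE)
    show "AE \<eta> in \<mu>. (\<integral>\<^sup>+ \<zeta>. edist (cond_density (D \<union> G) (glue D \<eta> \<zeta>)) (cond_density D \<eta>) \<partial>\<mu>)
        \<le> 2 * (\<integral>\<^sup>+ \<zeta>. edist (cond_density (D \<union> G) (glue D \<eta> \<zeta>)) (cond_density D \<eta>) * num_points (G - D) \<zeta> \<partial>\<mu>)"
      using AE_cond_density_finite[OF D] AE_space
    proof eventually_elim
      case (elim \<eta>)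
      then have [measurable]: "\<eta> \<in> space \<mu>" by simp
      have "(\<integral>\<^sup>+ \<zeta>. edist (cond_density (D \<union> G) (glue D \<eta> \<zeta>)) (cond_density D \<eta>) \<partial>\<mu>)
          = 2 * deficit (cond_density D \<eta>) (\<lambda>\<zeta>. cond_density (D \<union> G) (glue D \<eta> \<zeta>))"
        using elim by (intro nn_integral_edist cond_density_tower open_D' D) auto
      then show ?case using deficit_le_cost[of \<eta>] elim by (simp add: mult_left_mono)
    qed
  qed
  also have "\<dots> = 2 * cell_cost"
    unfolding cell_cost_cond by (intro nn_integral_cmult) measurable
  finally show ?thesis .
qed

text \<open>Finiteness is what allows \<open>cell_cost\<close> to be absorbed into the left-hand side in \<open>cell_cost_bound\<close>. It
  follows from the Mecke formula, as adding a point increases \<open>L\<close> by at most the gradient.\<close>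

lemma cell_cost_finite:
  assumes "cell_gradient < \<infinity>"
  shows "cell_cost < \<infinity>"
proof -
  have "cell_cost \<le> (\<integral>\<^sup>+ \<omega>. num_points (G - D) \<omega> * cond_density (D \<union> G) \<omega> + num_points (G - D) \<omega> * cond_density D \<omega> \<partial>\<mu>)"
    unfolding cell_cost_def cell_gap_def distrib_left[symmetric]
    by (subst mult.commute) (intro nn_integral_mono mult_left_mono edist_le_add zero_le)
  also have "\<dots> = (\<integral>\<^sup>+ \<omega>. num_points (G - D) \<omega> * cond_density (D \<union> G) \<omega> \<partial>\<mu>) + (\<integral>\<^sup>+ \<omega>. num_points (G - D) \<omega> * cond_density D \<omega> \<partial>\<mu>)"
    by (rule nn_integral_add) simp_all
  also have "(\<integral>\<^sup>+ \<omega>. num_points (G - D) \<omega> * cond_density D \<omega> \<partial>\<mu>) = (\<integral>\<^sup>+ x. indicator (G - D) x \<partial>\<sigma>)"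
  proof (subst mecke[OF G D], simp, intro nn_integral_cong)
    fix x
    have "cond_density D (insert x \<omega>) = cond_density D \<omega>" if "x \<in> G - D" for \<omega>
      using that by (intro cond_density_cong) auto
    then show "indicator (G - D) x * (\<integral>\<^sup>+ \<omega>. cond_density D (insert x \<omega>) \<partial>\<mu>) = indicator (G - D) x"
      using nn_integral_cond_density[OF D] by (auto simp: indicator_def)
  qed
  also have "(\<integral>\<^sup>+ \<omega>. num_points (G - D) \<omega> * cond_density (D \<union> G) \<omega> \<partial>\<mu>) = (\<integral>\<^sup>+ \<omega>. L \<omega> * num_points (G - D) \<omega> \<partial>\<mu>)"
    by (subst nn_integral_cond_density_mult[OF open_D'])
      (auto simp: mult.commute num_points_def glue_def intro!: arg_cong[where f=card])
  also have "\<dots> = (\<integral>\<^sup>+ x. indicator (G - D) x * (\<integral>\<^sup>+ \<omega>. L (insert x \<omega>) \<partial>\<mu>) \<partial>\<sigma>)"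
    by (subst mult.commute, subst mecke[OF G D]) simp_all
  also have "\<dots> \<le> (\<integral>\<^sup>+ x. indicator (G - D) x * (\<integral>\<^sup>+ \<omega>. L \<omega> + grad x \<omega> \<partial>\<mu>) \<partial>\<sigma>)"
    unfolding grad_def by (intro nn_integral_mono mult_left_mono le_add_edist zero_le)
  also have "\<dots> = (\<integral>\<^sup>+ x. indicator (G - D) x + indicator (G - D) x * (\<integral>\<^sup>+ \<omega>. grad x \<omega> \<partial>\<mu>) \<partial>\<sigma>)"
    by (subst nn_integral_add) (simp_all add: L_1 distrib_left)
  also have "\<dots> = (\<integral>\<^sup>+ x. indicator (G - D) x \<partial>\<sigma>) + cell_gradient"
    unfolding cell_gradient_def by (rule nn_integral_add) (simp_all add: sets_\<sigma>)
  finally have "cell_cost \<le> (\<integral>\<^sup>+ x. indicator (G - D) x \<partial>\<sigma>) + cell_gradient + (\<integral>\<^sup>+ x. indicator (G - D) x \<partial>\<sigma>)"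
    by (simp add: add_right_mono)
  also have "\<dots> < \<infinity>"
    using assms emeasure_finite[OF G, of "G - D"] sets_Diff[OF G D] by (simp add: sets_\<sigma>)
  finally show ?thesis .
qed

text \<open>By the Mecke formula, the cost is the mean of \<open>cell_gap\<close> after the addition of a point in the cell. The
  triangle inequality passes through the conditional density before the addition; the remaining
  difference is a conditional mean of the gradient, because adding a point of the cell commutes with
  resampling outside of it.\<close>

lemma cell_cost_le_gradient:
  "cell_cost \<le> cell_gradient + emeasure \<sigma> (G - D) * (\<integral>\<^sup>+ \<omega>. cell_gap \<omega> \<partial>\<mu>)"
proof -
  have "cell_cost = (\<integral>\<^sup>+ x. indicator (G - D) x * (\<integral>\<^sup>+ \<omega>. cell_gap (insert x \<omega>) \<partial>\<mu>) \<partial>\<sigma>)"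
    unfolding cell_cost_def by (subst mult.commute, rule mecke[OF G D]) simp
  also have "\<dots> \<le> (\<integral>\<^sup>+ x. indicator (G - D) x * (\<integral>\<^sup>+ \<omega>. grad x \<omega> \<partial>\<mu>) + indicator (G - D) x * (\<integral>\<^sup>+ \<omega>. cell_gap \<omega> \<partial>\<mu>) \<partial>\<sigma>)"
  proof (intro nn_integral_mono)
    fix x
    show "indicator (G - D) x * (\<integral>\<^sup>+ \<omega>. cell_gap (insert x \<omega>) \<partial>\<mu>)
        \<le> indicator (G - D) x * (\<integral>\<^sup>+ \<omega>. grad x \<omega> \<partial>\<mu>) + indicator (G - D) x * (\<integral>\<^sup>+ \<omega>. cell_gap \<omega> \<partial>\<mu>)"
    proof (cases "x \<in> G - D")
      case True
      have "(\<integral>\<^sup>+ \<omega>. cell_gap (insert x \<omega>) \<partial>\<mu>)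
          \<le> (\<integral>\<^sup>+ \<omega>. (\<integral>\<^sup>+ \<zeta>. grad x (glue (D \<union> G) \<omega> \<zeta>) \<partial>\<mu>) + cell_gap \<omega> \<partial>\<mu>)"
      proof (rule nn_integral_mono)
        fix \<omega> assume [measurable]: "\<omega> \<in> space \<mu>"
        have D_eq: "cond_density D (insert x \<omega>) = cond_density D \<omega>"
          using True by (intro cond_density_cong) auto
        have "glue (D \<union> G) (insert x \<omega>) \<zeta> = insert x (glue (D \<union> G) \<omega> \<zeta>)" for \<zeta>
          using True by (auto simp: glue_def)
        then have "edist (cond_density (D \<union> G) (insert x \<omega>)) (cond_density (D \<union> G) \<omega>) \<le> (\<integral>\<^sup>+ \<zeta>. grad x (glue (D \<union> G) \<omega> \<zeta>) \<partial>\<mu>)"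
          unfolding cond_density_def grad_def by (simp only:) (rule edist_nn_integral_le; measurable)
        then show "cell_gap (insert x \<omega>) \<le> (\<integral>\<^sup>+ \<zeta>. grad x (glue (D \<union> G) \<omega> \<zeta>) \<partial>\<mu>) + cell_gap \<omega>"
          unfolding cell_gap_def D_eq
          by (rule order_trans[OF edist_triangle[of _ _ "cond_density (D \<union> G) \<omega>"] add_right_mono])
      qed
      also have "\<dots> = (\<integral>\<^sup>+ \<omega>. grad x \<omega> \<partial>\<mu>) + (\<integral>\<^sup>+ \<omega>. cell_gap \<omega> \<partial>\<mu>)"
        by (subst nn_integral_add) (simp_all add: nn_integral_glue[OF open_D', of "grad x"])
      finally show ?thesis using True by simp
    qed simp
  qed
  also have "\<dots> = cell_gradient + emeasure \<sigma> (G - D) * (\<integral>\<^sup>+ \<omega>. cell_gap \<omega> \<partial>\<mu>)"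
    unfolding cell_gradient_def using sets_Diff[OF G D]
    by (subst nn_integral_add) (simp_all add: nn_integral_multc sets_\<sigma>)
  finally show ?thesis .
qed

text \<open>The estimates \<open>cell_cost_le_gradient\<close> and \<open>nn_integral_cell_gap\<close> combine to \<open>C \<le> g + 2 * \<epsilon> * C\<close>. This first gives \<open>C \<le> 2 * g\<close>, and a second
  application gives the factor \<open>1 + 4 * \<epsilon>\<close>.\<close>

lemma cell_cost_bound:
  assumes \<epsilon>: "emeasure \<sigma> (G - D) \<le> ennreal \<epsilon>" "0 \<le> \<epsilon>" "\<epsilon> \<le> 1 / 4"
  shows "cell_cost \<le> ennreal (1 + 4 * \<epsilon>) * cell_gradient"
proof (cases "cell_gradient < \<infinity>")
  case True
  obtain c where c: "cell_cost = ennreal c" "c \<ge> 0" using cell_cost_finite[OF True] by (cases cell_cost) auto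
  obtain g where g: "cell_gradient = ennreal g" "g \<ge> 0" using True by (cases cell_gradient) auto
  have "cell_cost \<le> cell_gradient + ennreal \<epsilon> * (2 * cell_cost)"
    using cell_cost_le_gradient nn_integral_cell_gap \<epsilon>(1)
    by (meson add_left_mono mult_mono order_trans zero_le)
  also have "\<dots> = ennreal (g + 2 * \<epsilon> * c)"
    using c g \<epsilon>(2) by (simp add: ennreal_mult ac_simps)
  finally have *: "c \<le> g + 2 * \<epsilon> * c"
    using c g \<epsilon>(2) by (simp del: ennreal_plus)
  have "2 * \<epsilon> * c \<le> 2 * (1 / 4) * c" using \<epsilon>(3) c(2) by (intro mult_right_mono) auto
  then have "c \<le> 2 * g" using * by simp
  then have "2 * \<epsilon> * c \<le> 2 * \<epsilon> * (2 * g)" using \<epsilon>(2) by (intro mult_left_mono) auto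
  then have "c \<le> (1 + 4 * \<epsilon>) * g" using * by (simp add: algebra_simps)
  then show ?thesis using c g \<epsilon>(2) by (simp add: ennreal_mult[symmetric] ennreal_leI del: ennreal_plus)
next
  case False
  then have "cell_gradient = \<infinity>" by (metis infinity_ennreal_def less_top)
  then show ?thesis using \<epsilon>(2) by (simp add: ennreal_mult_top ennreal_eq_0_iff)
qed

end

end

section \<open>Resampling all cells\<close>

locale poisson_cells = poisson_density \<sigma> \<mu> L
  for \<sigma> :: "'a::metric_space measure" and \<mu> L +
  fixes G :: "nat \<Rightarrow> 'a set"
  assumes precompact: "\<And>k. precompact_open (G k)"
    and cover: "\<And>V. precompact_open V \<Longrightarrow> V \<subseteq> (\<Union>k. G k)"
begin

text \<open>The union of the first \<open>k\<close> cells. It is open although the cells are not, and hence configurations can be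
  glued along it measurably.\<close>

definition D :: "nat \<Rightarrow> 'a set" where "D k = (\<Union>j<k. G j)"

definition A :: "nat \<Rightarrow> 'a set" where "A k = G k - D k"

lemma open_D[measurable]: "open (D k)"
  using precompact by (auto simp: D_def precompact_open_def)

lemma D_0: "D 0 = {}" and D_Suc: "D (Suc k) = D k \<union> G k"
  by (auto simp: D_def lessThan_Suc)

lemma D_mono: "j \<le> k \<Longrightarrow> D j \<subseteq> D k"
  unfolding D_def by (intro UN_mono) auto

lemma A_subset_D: "k < n \<Longrightarrow> A k \<subseteq> D n"
  by (auto simp: A_def D_def)

lemma A_disjoint_D: "A k \<inter> D k = {}"
  by (auto simp: A_def)

lemma A_disjoint: "x \<in> A j \<Longrightarrow> x \<in> A k \<Longrightarrow> j = k"
  using A_subset_D[of j k] A_subset_D[of k j] A_disjoint_D by (metis IntI empty_iff linorder_neqE_nat subsetD)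

lemma UN_A: "(\<Union>k<n. A k) = D n"
proof (induction n)
  case (Suc n)
  then show ?case by (auto simp: lessThan_Suc D_Suc A_def)
qed (simp add: D_0)

lemma D_covers: "x \<in> G j \<Longrightarrow> \<exists>k. x \<in> A k"
  using UN_A[of "Suc j"] by (auto simp: D_def)

lemma measurable_num_points_A[measurable]: "num_points (A k) \<in> borel_measurable \<mu>"
  using measurable_num_points[OF precompact open_D] by (simp add: A_def measurable_cong_sets[OF sets_\<mu> refl])

text \<open>The Boolean tells whether the cell is kept; if not, the configuration is its replacement. The counting
  measure on the first component serves as reference measure for densities.\<close>

abbreviation proposal :: "(bool \<times> 'a set) measure" where
  "proposal \<equiv> count_space UNIV \<Otimes>\<^sub>M \<mu>"

definition accept_prob :: "nat \<Rightarrow> 'a set \<Rightarrow> ennreal" where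
  "accept_prob k \<eta> = accept (cond_density (D k) \<eta>) (cond_density (D (Suc k)) \<eta>)"

definition fresh_density :: "nat \<Rightarrow> 'a set \<Rightarrow> 'a set \<Rightarrow> ennreal" where
  "fresh_density k \<eta> = refill (cond_density (D k) \<eta>) (\<lambda>\<zeta>. cond_density (D (Suc k)) (glue (D k) \<eta> \<zeta>))"

definition cell_kernel_density :: "nat \<Rightarrow> 'a set \<Rightarrow> bool \<times> 'a set \<Rightarrow> ennreal" where
  "cell_kernel_density k \<eta> s = (if fst s then accept_prob k \<eta> else (1 - accept_prob k \<eta>) * fresh_density k \<eta> (snd s))"

definition cell_kernel :: "nat \<Rightarrow> 'a set \<Rightarrow> (bool \<times> 'a set) measure" where
  "cell_kernel k \<eta> = density proposal (cell_kernel_density k \<eta>)"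

lemma measurable_accept_prob[measurable]: "accept_prob k \<in> borel_measurable \<mu>"
  unfolding accept_prob_def[abs_def] by measurable

lemma measurable_fresh_density[measurable (raw)]:
  assumes [measurable]: "f \<in> M \<rightarrow>\<^sub>M \<mu>" "g \<in> M \<rightarrow>\<^sub>M \<mu>"
  shows "(\<lambda>x. fresh_density k (f x) (g x)) \<in> borel_measurable M"
  unfolding fresh_density_def refill_def deficit_def by measurable

lemma measurable_cell_kernel_density[measurable (raw)]:
  assumes [measurable]: "f \<in> M \<rightarrow>\<^sub>M \<mu>" "g \<in> M \<rightarrow>\<^sub>M proposal"
  shows "(\<lambda>x. cell_kernel_density k (f x) (g x)) \<in> borel_measurable M"
  unfolding cell_kernel_density_def by measurable

lemma sets_cell_kernel[measurable_cong, simp]: "sets (cell_kernel k \<eta>) = sets proposal"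
  by (simp add: cell_kernel_def)

lemma space_cell_kernel: "space (cell_kernel k \<eta>) = UNIV \<times> configurations"
  by (simp add: cell_kernel_def space_pair_measure space_\<mu>)

lemma nn_integral_cell_kernel:
  assumes [measurable]: "f \<in> borel_measurable proposal" and [measurable]: "\<eta> \<in> space \<mu>"
  shows "(\<integral>\<^sup>+ s. f s \<partial>cell_kernel k \<eta>) =
    accept_prob k \<eta> * (\<integral>\<^sup>+ \<xi>. f (True, \<xi>) \<partial>\<mu>) + (1 - accept_prob k \<eta>) * (\<integral>\<^sup>+ \<xi>. fresh_density k \<eta> \<xi> * f (False, \<xi>) \<partial>\<mu>)"
proof -
  have "(\<integral>\<^sup>+ s. f s \<partial>cell_kernel k \<eta>) = (\<integral>\<^sup>+ s. cell_kernel_density k \<eta> s * f s \<partial>proposal)"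
    unfolding cell_kernel_def by (rule nn_integral_density) measurable
  also have "\<dots> = (\<integral>\<^sup>+ b. \<integral>\<^sup>+ \<xi>. cell_kernel_density k \<eta> (b, \<xi>) * f (b, \<xi>) \<partial>\<mu> \<partial>count_space UNIV)"
    by (rule nn_integral_fst[symmetric]) measurable
  also have "\<dots> = (\<integral>\<^sup>+ \<xi>. accept_prob k \<eta> * f (True, \<xi>) \<partial>\<mu>) + (\<integral>\<^sup>+ \<xi>. (1 - accept_prob k \<eta>) * (fresh_density k \<eta> \<xi> * f (False, \<xi>)) \<partial>\<mu>)"
    by (simp add: nn_integral_count_space_finite UNIV_bool cell_kernel_density_def add.commute mult.assoc)
  also have "\<dots> = accept_prob k \<eta> * (\<integral>\<^sup>+ \<xi>. f (True, \<xi>) \<partial>\<mu>) + (1 - accept_prob k \<eta>) * (\<integral>\<^sup>+ \<xi>. fresh_density k \<eta> \<xi> * f (False, \<xi>) \<partial>\<mu>)"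
    by (intro arg_cong2[where f="(+)"] nn_integral_cmult) measurable
  finally show ?thesis .
qed

lemma nn_integral_fresh_density:
  assumes [measurable]: "\<eta> \<in> space \<mu>"
  shows "(\<integral>\<^sup>+ \<xi>. fresh_density k \<eta> \<xi> \<partial>\<mu>) = 1"
  unfolding fresh_density_def by (rule nn_integral_refill) measurable

lemma accept_prob_le_1: "accept_prob k \<eta> \<le> 1"
  unfolding accept_prob_def by (rule accept_le_1)

lemma prob_space_cell_kernel:
  assumes [measurable]: "\<eta> \<in> space \<mu>"
  shows "prob_space (cell_kernel k \<eta>)"
proof
  have "emeasure (cell_kernel k \<eta>) (space (cell_kernel k \<eta>)) = (\<integral>\<^sup>+ s. 1 \<partial>cell_kernel k \<eta>)"
    by simp
  also have "\<dots> = accept_prob k \<eta> + (1 - accept_prob k \<eta>)"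
    using assms by (subst nn_integral_cell_kernel) (simp_all add: emeasure_space_1 nn_integral_fresh_density)
  also have "\<dots> = 1" using accept_prob_le_1 by (rule add_diff_inverse_ennreal)
  finally show "emeasure (cell_kernel k \<eta>) (space (cell_kernel k \<eta>)) = 1" .
qed

abbreviation choices :: "(nat \<Rightarrow> bool \<times> 'a set) measure" where
  "choices \<equiv> PiM UNIV (\<lambda>_. proposal)"

text \<open>Given \<open>\<eta>\<close>, the decisions in different cells are independent, although the kernel of each cell depends on
  the parts of \<open>\<eta>\<close> in earlier cells.\<close>

definition choice_law :: "'a set \<Rightarrow> (nat \<Rightarrow> bool \<times> 'a set) measure" where
  "choice_law \<eta> = PiM UNIV (\<lambda>k. cell_kernel k \<eta>)"

lemma sets_choice_law[measurable_cong, simp]: "sets (choice_law \<eta>) = sets choices"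
  unfolding choice_law_def by (intro sets_PiM_cong) simp_all

lemma space_choice_law: "space (choice_law \<eta>) = space choices"
  by (intro sets_eq_imp_space_eq) simp

lemma product_prob_space_cell_kernel: "\<eta> \<in> space \<mu> \<Longrightarrow> product_prob_space (\<lambda>k. cell_kernel k \<eta>)"
  using prob_space_cell_kernel
  by (auto simp: product_prob_space_def product_sigma_finite_def product_prob_space_axioms_def intro: prob_space_imp_sigma_finite)

lemma measurable_emeasure_cell_kernel:
  assumes [measurable]: "X \<in> sets proposal"
  shows "(\<lambda>\<eta>. emeasure (cell_kernel k \<eta>) X) \<in> borel_measurable \<mu>"
proof -
  have eq: "emeasure (cell_kernel k \<eta>) X = accept_prob k \<eta> * (\<integral>\<^sup>+ \<xi>. indicator X (True, \<xi>) \<partial>\<mu>) + (1 - accept_prob k \<eta>) * (\<integral>\<^sup>+ \<xi>. fresh_density k \<eta> \<xi> * indicator X (False, \<xi>) \<partial>\<mu>)"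
    if "\<eta> \<in> space \<mu>" for \<eta>
    using that by (subst nn_integral_cell_kernel[symmetric]) simp_all
  show ?thesis by (subst measurable_cong[OF eq]) (assumption, measurable)
qed

lemma measurable_choice_law[measurable]: "choice_law \<in> \<mu> \<rightarrow>\<^sub>M prob_algebra choices"
proof (rule measurable_prob_algebra_generated[OF sets_PiM Int_stable_prod_algebra prod_algebra_sets_into_space])
  show "prob_space (choice_law \<eta>)" if "\<eta> \<in> space \<mu>" for \<eta>
    unfolding choice_law_def using that by (intro prob_space_PiM prob_space_cell_kernel)
  fix E :: "(nat \<Rightarrow> bool \<times> 'a set) set" assume "E \<in> prod_algebra UNIV (\<lambda>_. proposal)"
  then obtain J X where E: "E = prod_emb UNIV (\<lambda>_. proposal) J (\<Pi>\<^sub>E j\<in>J. X j)" "finite J" "\<And>j. j \<in> J \<Longrightarrow> X j \<in> sets proposal"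
    by (elim prod_algebraE) blast
  have "emeasure (choice_law \<eta>) E = (\<Prod>j\<in>J. emeasure (cell_kernel j \<eta>) (X j))" if "\<eta> \<in> space \<mu>" for \<eta>
  proof -
    interpret product_prob_space "\<lambda>k. cell_kernel k \<eta>" UNIV
      by (rule product_prob_space_cell_kernel[OF that])
    have "prod_emb UNIV (\<lambda>_. proposal) J (\<Pi>\<^sub>E j\<in>J. X j) = prod_emb UNIV (\<lambda>k. cell_kernel k \<eta>) J (\<Pi>\<^sub>E j\<in>J. X j)"
      by (simp add: prod_emb_def space_cell_kernel space_pair_measure space_\<mu>)
    then show ?thesis
      unfolding choice_law_def E(1) using E(2,3) by (simp add: emeasure_PiM_emb)
  qed
  then show "(\<lambda>\<eta>. emeasure (choice_law \<eta>) E) \<in> borel_measurable \<mu>"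
    using E by (subst measurable_cong) (auto intro!: borel_measurable_prod_ennreal measurable_emeasure_cell_kernel)
qed simp_all

lemma nn_integral_choice_law_component:
  assumes [measurable]: "f \<in> borel_measurable proposal" and \<eta>: "\<eta> \<in> space \<mu>"
  shows "(\<integral>\<^sup>+ s. f (s k) \<partial>choice_law \<eta>) = (\<integral>\<^sup>+ x. f x \<partial>cell_kernel k \<eta>)"
proof -
  interpret product_prob_space "\<lambda>k. cell_kernel k \<eta>" UNIV
    by (rule product_prob_space_cell_kernel[OF \<eta>])
  have "(\<integral>\<^sup>+ x. f x \<partial>cell_kernel k \<eta>) = (\<integral>\<^sup>+ x. f x \<partial>distr (PiM UNIV (\<lambda>k. cell_kernel k \<eta>)) (cell_kernel k \<eta>) (\<lambda>s. s k))"
    by (subst PiM_component) simp_all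
  then show ?thesis
    unfolding choice_law_def by (subst (asm) nn_integral_distr) simp_all
qed

text \<open>The law of a configuration \<open>\<eta>\<close> with density \<open>L\<close> together with the decisions made in all cells.\<close>

definition joint :: "('a set \<times> (nat \<Rightarrow> bool \<times> 'a set)) measure" where
  "joint = density \<mu> L \<bind> (\<lambda>\<eta>. distr (choice_law \<eta>) (\<mu> \<Otimes>\<^sub>M choices) (\<lambda>s. (\<eta>, s)))"

lemma space_\<mu>_not_empty: "space \<mu> \<noteq> {}"
  by (rule not_empty)

lemma measurable_joint_kernel:
  "(\<lambda>\<eta>. distr (choice_law \<eta>) (\<mu> \<Otimes>\<^sub>M choices) (\<lambda>s. (\<eta>, s))) \<in> density \<mu> L \<rightarrow>\<^sub>M subprob_algebra (\<mu> \<Otimes>\<^sub>M choices)"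
proof -
  have [measurable]: "choice_law \<in> density \<mu> L \<rightarrow>\<^sub>M subprob_algebra choices"
    using measurable_prob_algebraD[OF measurable_choice_law] by simp
  show ?thesis by (rule measurable_distr2[where M=choices]) simp_all
qed

lemma sets_joint[measurable_cong, simp]: "sets joint = sets (\<mu> \<Otimes>\<^sub>M choices)"
  unfolding joint_def by (rule sets_bind) (simp_all add: space_\<mu>_not_empty)

lemma nn_integral_joint:
  assumes [measurable]: "f \<in> borel_measurable (\<mu> \<Otimes>\<^sub>M choices)"
  shows "(\<integral>\<^sup>+ x. f x \<partial>joint) = (\<integral>\<^sup>+ \<eta>. L \<eta> * (\<integral>\<^sup>+ s. f (\<eta>, s) \<partial>choice_law \<eta>) \<partial>\<mu>)"
proof -
  have [measurable]: "choice_law \<in> \<mu> \<rightarrow>\<^sub>M subprob_algebra choices"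
    using measurable_prob_algebraD[OF measurable_choice_law] .
  have m: "(\<lambda>\<eta>. \<integral>\<^sup>+ s. f (\<eta>, s) \<partial>choice_law \<eta>) \<in> borel_measurable \<mu>"
    by (rule nn_integral_measurable_subprob_algebra2[where N=choices]) simp_all
  have "(\<integral>\<^sup>+ x. f x \<partial>joint) = (\<integral>\<^sup>+ \<eta>. \<integral>\<^sup>+ x. f x \<partial>distr (choice_law \<eta>) (\<mu> \<Otimes>\<^sub>M choices) (\<lambda>s. (\<eta>, s)) \<partial>density \<mu> L)"
    unfolding joint_def by (rule nn_integral_bind[OF assms measurable_joint_kernel])
  also have "\<dots> = (\<integral>\<^sup>+ \<eta>. \<integral>\<^sup>+ s. f (\<eta>, s) \<partial>choice_law \<eta> \<partial>density \<mu> L)"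
    by (intro nn_integral_cong nn_integral_distr) simp_all
  also have "\<dots> = (\<integral>\<^sup>+ \<eta>. L \<eta> * (\<integral>\<^sup>+ s. f (\<eta>, s) \<partial>choice_law \<eta>) \<partial>\<mu>)"
    by (rule nn_integral_density[OF L m])
  finally show ?thesis .
qed

text \<open>Agrees with the transported configuration inside the cell \<open>A k\<close>, see \<open>transport_Int_A\<close> below.\<close>

definition pick :: "nat \<Rightarrow> 'a set \<times> (nat \<Rightarrow> bool \<times> 'a set) \<Rightarrow> 'a set" where
  "pick k x = (if fst (snd x k) then fst x else snd (snd x k))"

lemma measurable_pick[measurable]: "pick k \<in> \<mu> \<Otimes>\<^sub>M choices \<rightarrow>\<^sub>M \<mu>"
  unfolding pick_def[abs_def] by measurable

text \<open>The mean of \<open>f\<close> at \<open>pick k\<close>, given \<open>\<eta>\<close>.\<close>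

definition mixed :: "nat \<Rightarrow> ('a set \<Rightarrow> ennreal) \<Rightarrow> 'a set \<Rightarrow> ennreal" where
  "mixed k f \<eta> = accept_prob k \<eta> * f \<eta> + (1 - accept_prob k \<eta>) * (\<integral>\<^sup>+ \<xi>. fresh_density k \<eta> \<xi> * f \<xi> \<partial>\<mu>)"

lemma measurable_mixed[measurable (raw)]:
  assumes [measurable]: "f \<in> borel_measurable \<mu>" "g \<in> M \<rightarrow>\<^sub>M \<mu>"
  shows "(\<lambda>x. mixed k f (g x)) \<in> borel_measurable M"
  unfolding mixed_def by measurable

lemma fresh_density_glue: "j \<le> k \<Longrightarrow> fresh_density j (glue (D k) \<eta> \<zeta>) = fresh_density j \<eta>"
proof -
  assume "j \<le> k"
  then have "D j \<subseteq> D k" by (rule D_mono)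
  then have "glue (D k) \<eta> \<zeta> \<inter> D j = \<eta> \<inter> D j" "glue (D j) (glue (D k) \<eta> \<zeta>) \<xi> = glue (D j) \<eta> \<xi>" for \<xi>
    by (auto simp: glue_def)
  then have "cond_density (D j) (glue (D k) \<eta> \<zeta>) = cond_density (D j) \<eta>"
      "\<And>\<xi>. glue (D j) (glue (D k) \<eta> \<zeta>) \<xi> = glue (D j) \<eta> \<xi>"
    by (auto intro: cond_density_cong)
  then show ?thesis unfolding fresh_density_def by (simp only:)
qed

lemma accept_prob_glue: "j < k \<Longrightarrow> accept_prob j (glue (D k) \<eta> \<zeta>) = accept_prob j \<eta>"
proof -
  assume "j < k"
  then have "D j \<subseteq> D k" "D (Suc j) \<subseteq> D k" by (auto intro!: D_mono)
  then have "glue (D k) \<eta> \<zeta> \<inter> D j = \<eta> \<inter> D j" "glue (D k) \<eta> \<zeta> \<inter> D (Suc j) = \<eta> \<inter> D (Suc j)"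
    by (auto simp: glue_def)
  then have "cond_density (D j) (glue (D k) \<eta> \<zeta>) = cond_density (D j) \<eta>"
      "cond_density (D (Suc j)) (glue (D k) \<eta> \<zeta>) = cond_density (D (Suc j)) \<eta>"
    by (auto intro: cond_density_cong)
  then show ?thesis unfolding accept_prob_def by (simp only:)
qed

definition local_to :: "'a set \<Rightarrow> ('a set \<Rightarrow> ennreal) \<Rightarrow> bool" where
  "local_to B f \<longleftrightarrow> (\<forall>\<omega>\<in>configurations. \<forall>\<eta>\<in>configurations. \<omega> \<inter> B = \<eta> \<inter> B \<longrightarrow> f \<omega> = f \<eta>)"

lemma local_toD:
  "local_to B f \<Longrightarrow> \<omega> \<in> space \<mu> \<Longrightarrow> \<eta> \<in> space \<mu> \<Longrightarrow> \<omega> \<inter> B = \<eta> \<inter> B \<Longrightarrow> f \<omega> = f \<eta>"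
  unfolding local_to_def space_\<mu> by blast

lemma space_glue: "\<eta> \<in> space \<mu> \<Longrightarrow> \<zeta> \<in> space \<mu> \<Longrightarrow> glue D' \<eta> \<zeta> \<in> space \<mu>"
  by (simp add: space_\<mu> glue_configurations)

lemma local_to_glue_inside:
  "local_to B f \<Longrightarrow> B \<subseteq> D' \<Longrightarrow> \<eta> \<in> space \<mu> \<Longrightarrow> \<zeta> \<in> space \<mu> \<Longrightarrow> f (glue D' \<eta> \<zeta>) = f \<eta>"
  by (rule local_toD, assumption, rule space_glue) (auto simp: glue_def)

lemma local_to_glue_outside:
  "local_to B f \<Longrightarrow> B \<inter> D' = {} \<Longrightarrow> \<eta> \<in> space \<mu> \<Longrightarrow> \<zeta> \<in> space \<mu> \<Longrightarrow> f (glue D' \<eta> \<zeta>) = f \<zeta>"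
  by (rule local_toD, assumption, rule space_glue) (auto simp: glue_def)

lemma mixed_glue:
  assumes "local_to (A j) f" "j < k" "\<eta> \<in> space \<mu>" "\<zeta> \<in> space \<mu>"
  shows "mixed j f (glue (D k) \<eta> \<zeta>) = mixed j f \<eta>"
  unfolding mixed_def using assms local_to_glue_inside[OF assms(1) A_subset_D[OF assms(2)] assms(3,4)]
  by (simp add: accept_prob_glue fresh_density_glue)

text \<open>Given \<open>\<eta>\<close> inside \<open>D k\<close>, the picked configuration in the cell \<open>A k\<close> has the Poisson law, by the property
  of the maximal coupling.\<close>

lemma marginal_step:
  assumes f[measurable]: "f \<in> borel_measurable \<mu>" and loc: "local_to (A k) f" and \<eta>[measurable]: "\<eta> \<in> space \<mu>"
    and fin: "cond_density (D k) \<eta> < \<infinity>"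
  shows "(\<integral>\<^sup>+ \<zeta>. cond_density (D (Suc k)) (glue (D k) \<eta> \<zeta>) * mixed k f (glue (D k) \<eta> \<zeta>) \<partial>\<mu>)
    = cond_density (D k) \<eta> * (\<integral>\<^sup>+ \<omega>. f \<omega> \<partial>\<mu>)"
proof -
  let ?p = "\<lambda>\<zeta>. cond_density (D (Suc k)) (glue (D k) \<eta> \<zeta>)" and ?a = "cond_density (D k) \<eta>"
  have p: "?p \<in> borel_measurable \<mu>" by measurable
  have a: "(\<integral>\<^sup>+ \<zeta>. ?p \<zeta> \<partial>\<mu>) = ?a"
    using \<eta> by (intro cond_density_tower open_D) (auto simp: D_Suc)
  have "(\<integral>\<^sup>+ \<zeta>. ?p \<zeta> * mixed k f (glue (D k) \<eta> \<zeta>) \<partial>\<mu>)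
      = (\<integral>\<^sup>+ \<zeta>. ?p \<zeta> * (accept ?a (?p \<zeta>) * f \<zeta> + (1 - accept ?a (?p \<zeta>)) * (\<integral>\<^sup>+ \<xi>. refill ?a ?p \<xi> * f \<xi> \<partial>\<mu>)) \<partial>\<mu>)"
    using local_to_glue_outside[OF loc A_disjoint_D \<eta>] fresh_density_glue[of k k \<eta>]
    by (intro nn_integral_cong) (simp add: mixed_def accept_prob_def cond_density_glue fresh_density_def[symmetric])
  also have "\<dots> = ?a * (\<integral>\<^sup>+ \<omega>. f \<omega> \<partial>\<mu>)"
    by (rule maximal_coupling_marginal[OF p a fin f])
  finally show ?thesis .
qed

text \<open>The last cell is averaged first: all earlier factors depend only on \<open>\<eta>\<close> inside \<open>D n\<close>, so
  \<open>marginal_step\<close> splits off one factor.\<close>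

lemma nn_integral_mixed_prod:
  assumes f[measurable]: "\<And>k. f k \<in> borel_measurable \<mu>" and loc: "\<And>k. local_to (A k) (f k)"
  shows "(\<integral>\<^sup>+ \<eta>. cond_density (D n) \<eta> * (\<Prod>k<n. mixed k (f k) \<eta>) \<partial>\<mu>) = (\<Prod>k<n. \<integral>\<^sup>+ \<omega>. f k \<omega> \<partial>\<mu>)"
proof (induction n)
  case 0
  then show ?case using nn_integral_cond_density[OF open_D] by simp
next
  case (Suc n)
  let ?\<Psi> = "\<lambda>\<eta>. \<Prod>k<n. mixed k (f k) \<eta>"
  have "(\<integral>\<^sup>+ \<eta>. cond_density (D (Suc n)) \<eta> * (\<Prod>k<Suc n. mixed k (f k) \<eta>) \<partial>\<mu>)
      = (\<integral>\<^sup>+ \<eta>. \<integral>\<^sup>+ \<zeta>. cond_density (D (Suc n)) (glue (D n) \<eta> \<zeta>) * (\<Prod>k<Suc n. mixed k (f k) (glue (D n) \<eta> \<zeta>)) \<partial>\<mu> \<partial>\<mu>)"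
    by (rule nn_integral_glue[OF open_D, symmetric]) measurable
  also have "\<dots> = (\<integral>\<^sup>+ \<eta>. \<integral>\<^sup>+ \<zeta>. ?\<Psi> \<eta> * (cond_density (D (Suc n)) (glue (D n) \<eta> \<zeta>) * mixed n (f n) (glue (D n) \<eta> \<zeta>)) \<partial>\<mu> \<partial>\<mu>)"
    by (intro nn_integral_cong) (simp add: mixed_glue[OF loc] ac_simps)
  also have "\<dots> = (\<integral>\<^sup>+ \<eta>. ?\<Psi> \<eta> * (\<integral>\<^sup>+ \<zeta>. cond_density (D (Suc n)) (glue (D n) \<eta> \<zeta>) * mixed n (f n) (glue (D n) \<eta> \<zeta>) \<partial>\<mu>) \<partial>\<mu>)"
    by (intro nn_integral_cong nn_integral_cmult) measurable
  also have "\<dots> = (\<integral>\<^sup>+ \<eta>. (cond_density (D n) \<eta> * ?\<Psi> \<eta>) * (\<integral>\<^sup>+ \<omega>. f n \<omega> \<partial>\<mu>) \<partial>\<mu>)"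
    using AE_cond_density_finite[OF open_D[of n]] AE_space
    by (intro nn_integral_cong_AE, eventually_elim)
      (subst marginal_step[OF f loc], simp_all add: ac_simps)
  also have "\<dots> = (\<Prod>k<n. \<integral>\<^sup>+ \<omega>. f k \<omega> \<partial>\<mu>) * (\<integral>\<^sup>+ \<omega>. f n \<omega> \<partial>\<mu>)"
    by (subst nn_integral_multc) (simp_all add: Suc)
  finally show ?case by simp
qed

lemma emeasure_cell_kernel_pick:
  assumes [measurable]: "V \<in> sets \<mu>" and \<eta>[measurable]: "\<eta> \<in> space \<mu>"
  shows "emeasure (cell_kernel k \<eta>) {s \<in> space proposal. (if fst s then \<eta> else snd s) \<in> V} = mixed k (indicator V) \<eta>"
proof -
  let ?X = "{s \<in> space proposal. (if fst s then \<eta> else snd s) \<in> V}"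
  have X[measurable]: "?X \<in> sets proposal" by measurable
  have "emeasure (cell_kernel k \<eta>) ?X = (\<integral>\<^sup>+ s. indicator ?X s \<partial>cell_kernel k \<eta>)"
    by simp
  also have "\<dots> = accept_prob k \<eta> * (\<integral>\<^sup>+ \<xi>. indicator ?X (True, \<xi>) \<partial>\<mu>) + (1 - accept_prob k \<eta>) * (\<integral>\<^sup>+ \<xi>. fresh_density k \<eta> \<xi> * indicator ?X (False, \<xi>) \<partial>\<mu>)"
    by (rule nn_integral_cell_kernel) measurable
  also have "(\<integral>\<^sup>+ \<xi>. indicator ?X (True, \<xi>) \<partial>\<mu>) = (\<integral>\<^sup>+ \<xi>. indicator V \<eta> \<partial>\<mu>)"
    by (intro nn_integral_cong) (simp add: indicator_def space_pair_measure)
  also have "(\<integral>\<^sup>+ \<xi>. fresh_density k \<eta> \<xi> * indicator ?X (False, \<xi>) \<partial>\<mu>) = (\<integral>\<^sup>+ \<xi>. fresh_density k \<eta> \<xi> * indicator V \<xi> \<partial>\<mu>)"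
    by (intro nn_integral_cong) (simp add: indicator_def space_pair_measure)
  finally show ?thesis by (simp add: mixed_def emeasure_space_1)
qed

text \<open>The picked parts in the first \<open>n\<close> cells are independent and have the Poisson law.\<close>

lemma emeasure_joint_cylinder:
  assumes V[measurable]: "\<And>k. V k \<in> sets \<mu>" and loc: "\<And>k. local_to (A k) (indicator (V k))"
  shows "emeasure joint {x \<in> space (\<mu> \<Otimes>\<^sub>M choices). \<forall>k<n. pick k x \<in> V k} = (\<Prod>k<n. emeasure \<mu> (V k))"
proof -
  let ?E = "{x \<in> space (\<mu> \<Otimes>\<^sub>M choices). \<forall>k<n. pick k x \<in> V k}"
  have E[measurable]: "?E \<in> sets (\<mu> \<Otimes>\<^sub>M choices)" by measurable
  have inner: "(\<integral>\<^sup>+ s. indicator ?E (\<eta>, s) \<partial>choice_law \<eta>) = (\<Prod>k<n. mixed k (indicator (V k)) \<eta>)"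
    if \<eta>[measurable]: "\<eta> \<in> space \<mu>" for \<eta>
  proof -
    interpret product_prob_space "\<lambda>k. cell_kernel k \<eta>" UNIV
      by (rule product_prob_space_cell_kernel[OF \<eta>])
    let ?X = "\<lambda>k. {s \<in> space proposal. (if fst s then \<eta> else snd s) \<in> V k}"
    let ?C = "{s \<in> space (PiM UNIV (\<lambda>k. cell_kernel k \<eta>)). \<forall>k\<in>{..<n}. s k \<in> ?X k}"
    have X[measurable]: "?X k \<in> sets proposal" for k by measurable
    have "(\<integral>\<^sup>+ s. indicator ?E (\<eta>, s) \<partial>choice_law \<eta>) = (\<integral>\<^sup>+ s. indicator ?C s \<partial>choice_law \<eta>)"
      using \<eta> space_choice_law[of \<eta>]
      by (intro nn_integral_cong) (auto simp: indicator_def pick_def space_pair_measure choice_law_def space_PiM)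
    also have "\<dots> = emeasure (choice_law \<eta>) ?C"
      unfolding choice_law_def by (intro nn_integral_indicator) simp
    also have "\<dots> = (\<Prod>k<n. emeasure (cell_kernel k \<eta>) (?X k))"
      unfolding choice_law_def by (rule emeasure_PiM_Collect) simp_all
    finally show ?thesis unfolding emeasure_cell_kernel_pick[OF V \<eta>] .
  qed
  have "emeasure joint ?E = (\<integral>\<^sup>+ x. indicator ?E x \<partial>joint)" by simp
  also have "\<dots> = (\<integral>\<^sup>+ \<eta>. L \<eta> * (\<integral>\<^sup>+ s. indicator ?E (\<eta>, s) \<partial>choice_law \<eta>) \<partial>\<mu>)"
    by (rule nn_integral_joint) measurable
  also have "\<dots> = (\<integral>\<^sup>+ \<eta>. L \<eta> * (\<Prod>k<n. mixed k (indicator (V k)) \<eta>) \<partial>\<mu>)"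
    by (intro nn_integral_cong) (simp add: inner)
  also have "\<dots> = (\<integral>\<^sup>+ \<eta>. cond_density (D n) \<eta> * (\<Prod>k<n. mixed k (indicator (V k)) \<eta>) \<partial>\<mu>)"
    by (rule nn_integral_cond_density_mult[OF open_D]) (auto intro!: prod.cong simp: mixed_glue[OF loc])
  also have "\<dots> = (\<Prod>k<n. \<integral>\<^sup>+ \<omega>. indicator (V k) \<omega> \<partial>\<mu>)"
    by (rule nn_integral_mixed_prod) (use loc in simp_all)
  finally show ?thesis by simp
qed

end

section \<open>The transported configuration\<close>

text \<open>The integral is a supremum over simple functions below the integrand, and each of them for \<open>f\<close> on the
  image pulls back to a measurable function below \<open>f \<circ> T\<close>. So the estimate holds for every \<open>f\<close>, in particular for
  the cost function \<open>rho1\<close> on pairs of configurations.\<close>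

lemma nn_integral_distr_le:
  assumes [measurable]: "T \<in> M \<rightarrow>\<^sub>M N"
  shows "(\<integral>\<^sup>+ y. f y \<partial>distr M N T) \<le> (\<integral>\<^sup>+ x. f (T x) \<partial>M)"
  unfolding nn_integral_def[of "distr M N T"]
proof (rule SUP_least)
  fix g assume "g \<in> {g. simple_function (distr M N T) g \<and> g \<le> f}"
  then have g: "simple_function (distr M N T) g" "g \<le> f" by auto
  have "g \<in> borel_measurable N"
    using borel_measurable_simple_function[OF g(1)] by simp
  then have "integral\<^sup>S (distr M N T) g = (\<integral>\<^sup>+ x. g (T x) \<partial>M)"
    by (simp add: nn_integral_eq_simple_integral[OF g(1), symmetric] nn_integral_distr)
  also have "\<dots> \<le> (\<integral>\<^sup>+ x. f (T x) \<partial>M)"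
    using g(2) by (intro nn_integral_mono) (auto simp: le_fun_def)
  finally show "integral\<^sup>S (distr M N T) g \<le> (\<integral>\<^sup>+ x. f (T x) \<partial>M)" .
qed

lemma rho0_le_rho1: "rho0 \<omega> \<eta> \<le> rho1 \<omega> \<eta>"
proof (cases "\<omega> = \<eta>")
  case False
  then obtain x where "x \<in> sym_diff \<omega> \<eta>" by blast
  then have "emeasure (count_space UNIV) {x} \<le> emeasure (count_space UNIV) (sym_diff \<omega> \<eta>)"
    by (intro emeasure_mono) auto
  then show ?thesis using False by (simp add: rho0_def rho1_eq_card_sym_diff)
qed (simp add: rho0_def)

lemma rubinstein_mono:
  assumes "\<And>\<omega> \<eta>. \<rho> \<omega> \<eta> \<le> \<rho>' \<omega> \<eta>"
  shows "rubinstein \<rho> \<mu> \<nu> \<le> rubinstein \<rho>' \<mu> \<nu>"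
  unfolding rubinstein_def by (intro INF_mono) (auto intro!: bexI nn_integral_mono assms)

context poisson_cells
begin

abbreviation cost :: "nat \<Rightarrow> ennreal" where
  "cost k \<equiv> cell_cost (G k) (D k)"

definition rejected :: "'a set \<times> (nat \<Rightarrow> bool \<times> 'a set) \<Rightarrow> nat set" where
  "rejected x = {k. \<not> fst (snd x k)}"

definition defect :: "nat \<Rightarrow> 'a set \<times> (nat \<Rightarrow> bool \<times> 'a set) \<Rightarrow> ennreal" where
  "defect k x = (if fst (snd x k) then 0 else num_points (A k) (fst x) + num_points (A k) (snd (snd x k)))"

lemma measurable_defect[measurable]: "defect k \<in> borel_measurable (\<mu> \<Otimes>\<^sub>M choices)"
  unfolding defect_def[abs_def] by measurable

text \<open>The expected charge on rejection in the cell \<open>A k\<close>, for a weight \<open>g\<close> that depends only on this cell: the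
  cost of the maximal coupling, averaged over \<open>\<eta>\<close> inside \<open>D k\<close>.\<close>

lemma nn_integral_joint_reject:
  assumes g[measurable]: "g \<in> borel_measurable \<mu>"
    and loc: "local_to (A k) g"
  shows "(\<integral>\<^sup>+ x. (if fst (snd x k) then 0 else g (fst x) + g (snd (snd x k))) \<partial>joint) =
    (\<integral>\<^sup>+ \<eta>. \<integral>\<^sup>+ \<zeta>. edist (cond_density (D (Suc k)) (glue (D k) \<eta> \<zeta>)) (cond_density (D k) \<eta>) * g \<zeta> \<partial>\<mu> \<partial>\<mu>)"
proof -
  define \<Phi> where "\<Phi> \<eta> = (1 - accept_prob k \<eta>) * (g \<eta> + (\<integral>\<^sup>+ \<xi>. fresh_density k \<eta> \<xi> * g \<xi> \<partial>\<mu>))" for \<eta>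
  have \<Phi>[measurable]: "\<Phi> \<in> borel_measurable \<mu>"
    unfolding \<Phi>_def by measurable
  have "(\<integral>\<^sup>+ x. (if fst (snd x k) then 0 else g (fst x) + g (snd (snd x k))) \<partial>joint)
      = (\<integral>\<^sup>+ \<eta>. L \<eta> * (\<integral>\<^sup>+ s. (if fst (s k) then 0 else g \<eta> + g (snd (s k))) \<partial>choice_law \<eta>) \<partial>\<mu>)"
    by (subst nn_integral_joint) (simp_all cong: if_cong)
  also have "\<dots> = (\<integral>\<^sup>+ \<eta>. L \<eta> * \<Phi> \<eta> \<partial>\<mu>)"
  proof (intro nn_integral_cong arg_cong2[where f="(*)"] refl)
    fix \<eta> assume \<eta>[measurable]: "\<eta> \<in> space \<mu>"
    have "(\<integral>\<^sup>+ s. (if fst (s k) then 0 else g \<eta> + g (snd (s k))) \<partial>choice_law \<eta>)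
        = (\<integral>\<^sup>+ x. (if fst x then 0 else g \<eta> + g (snd x)) \<partial>cell_kernel k \<eta>)"
      by (rule nn_integral_choice_law_component[OF _ \<eta>]) measurable
    also have "\<dots> = (1 - accept_prob k \<eta>) * (\<integral>\<^sup>+ \<xi>. fresh_density k \<eta> \<xi> * g \<eta> + fresh_density k \<eta> \<xi> * g \<xi> \<partial>\<mu>)"
      by (subst nn_integral_cell_kernel) (simp_all add: distrib_left \<eta>)
    also have "(\<integral>\<^sup>+ \<xi>. fresh_density k \<eta> \<xi> * g \<eta> + fresh_density k \<eta> \<xi> * g \<xi> \<partial>\<mu>) = g \<eta> + (\<integral>\<^sup>+ \<xi>. fresh_density k \<eta> \<xi> * g \<xi> \<partial>\<mu>)"
      by (subst nn_integral_add) (simp_all add: nn_integral_multc nn_integral_fresh_density \<eta>)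
    finally show "(\<integral>\<^sup>+ s. (if fst (s k) then 0 else g \<eta> + g (snd (s k))) \<partial>choice_law \<eta>) = \<Phi> \<eta>"
      by (simp add: \<Phi>_def)
  qed
  also have "\<dots> = (\<integral>\<^sup>+ \<eta>. cond_density (D (Suc k)) \<eta> * \<Phi> \<eta> \<partial>\<mu>)"
    using local_to_glue_inside[OF loc A_subset_D[OF lessI]]
    by (intro nn_integral_cond_density_mult open_D) (simp_all add: \<Phi>_def accept_prob_glue fresh_density_glue)
  also have "\<dots> = (\<integral>\<^sup>+ \<eta>. \<integral>\<^sup>+ \<zeta>. cond_density (D (Suc k)) (glue (D k) \<eta> \<zeta>) * \<Phi> (glue (D k) \<eta> \<zeta>) \<partial>\<mu> \<partial>\<mu>)"
    by (rule nn_integral_glue[OF open_D, symmetric]) measurable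
  also have "\<dots> = (\<integral>\<^sup>+ \<eta>. \<integral>\<^sup>+ \<zeta>. edist (cond_density (D (Suc k)) (glue (D k) \<eta> \<zeta>)) (cond_density (D k) \<eta>) * g \<zeta> \<partial>\<mu> \<partial>\<mu>)"
  proof (rule nn_integral_cong_AE)
    show "AE \<eta> in \<mu>. (\<integral>\<^sup>+ \<zeta>. cond_density (D (Suc k)) (glue (D k) \<eta> \<zeta>) * \<Phi> (glue (D k) \<eta> \<zeta>) \<partial>\<mu>)
        = (\<integral>\<^sup>+ \<zeta>. edist (cond_density (D (Suc k)) (glue (D k) \<eta> \<zeta>)) (cond_density (D k) \<eta>) * g \<zeta> \<partial>\<mu>)"
      using AE_cond_density_finite[OF open_D[of k]] AE_space
    proof eventually_elim
      case (elim \<eta>)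
      then have \<eta>[measurable]: "\<eta> \<in> space \<mu>" by simp
      let ?p = "\<lambda>\<zeta>. cond_density (D (Suc k)) (glue (D k) \<eta> \<zeta>)" and ?a = "cond_density (D k) \<eta>"
      have p: "?p \<in> borel_measurable \<mu>" by measurable
      have a: "(\<integral>\<^sup>+ \<zeta>. ?p \<zeta> \<partial>\<mu>) = ?a"
        using \<eta> by (intro cond_density_tower open_D D_mono) auto
      have "(\<integral>\<^sup>+ \<zeta>. ?p \<zeta> * \<Phi> (glue (D k) \<eta> \<zeta>) \<partial>\<mu>)
          = (\<integral>\<^sup>+ \<zeta>. ?p \<zeta> * ((1 - accept ?a (?p \<zeta>)) * (g \<zeta> + (\<integral>\<^sup>+ \<xi>. refill ?a ?p \<xi> * g \<xi> \<partial>\<mu>))) \<partial>\<mu>)"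
        using local_to_glue_outside[OF loc A_disjoint_D \<eta>] fresh_density_glue[of k k \<eta>]
        by (intro nn_integral_cong) (simp add: \<Phi>_def accept_prob_def cond_density_glue fresh_density_def[symmetric])
      also have "\<dots> = (\<integral>\<^sup>+ \<zeta>. edist (?p \<zeta>) ?a * g \<zeta> \<partial>\<mu>)"
        by (rule maximal_coupling_cost[OF p a elim(1) g])
      finally show ?case .
    qed
  qed
  finally show ?thesis .
qed

lemma local_to_num_points: "local_to B (num_points B)"
  by (simp add: local_to_def num_points_def)

lemma nn_integral_defect: "(\<integral>\<^sup>+ x. defect k x \<partial>joint) = cost k"
  unfolding defect_def using nn_integral_joint_reject[OF measurable_num_points_A local_to_num_points]
  by (simp add: cell_cost_cond[OF precompact open_D] D_Suc A_def)

lemma nn_integral_rejected: "(\<integral>\<^sup>+ x. (if fst (snd x k) then 0 else 1) \<partial>joint) \<le> 2 * cost k"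
proof -
  have "(\<integral>\<^sup>+ x. (if fst (snd x k) then 0 else 1) \<partial>joint) \<le> (\<integral>\<^sup>+ x. (if fst (snd x k) then 0 else 1 + 1) \<partial>joint)"
    by (intro nn_integral_mono) auto
  also have "\<dots> = (\<integral>\<^sup>+ \<eta>. \<integral>\<^sup>+ \<zeta>. edist (cond_density (D (Suc k)) (glue (D k) \<eta> \<zeta>)) (cond_density (D k) \<eta>) \<partial>\<mu> \<partial>\<mu>)"
    using nn_integral_joint_reject[of "\<lambda>_. 1" k] by (simp add: local_to_def)
  also have "\<dots> = (\<integral>\<^sup>+ \<eta>. cell_gap (G k) (D k) \<eta> \<partial>\<mu>)"
    using nn_integral_glue[OF open_D[of k] measurable_cell_gap[OF precompact open_D, of k k]]
    by (simp add: cell_gap_def[OF precompact open_D] cond_density_glue D_Suc)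
  also have "\<dots> \<le> 2 * cost k"
    by (rule nn_integral_cell_gap[OF precompact open_D])
  finally show ?thesis .
qed

text \<open>Rejected cells are refilled. If infinitely many cells are rejected, which happens with probability \<open>0\<close>,
  the result might fail to be locally finite, and \<open>\<eta>\<close> is returned instead.\<close>

definition transport :: "'a set \<times> (nat \<Rightarrow> bool \<times> 'a set) \<Rightarrow> 'a set" where
  "transport x = (if finite (rejected x)
    then (fst x - (\<Union>k\<in>rejected x. A k)) \<union> (\<Union>k\<in>rejected x. snd (snd x k) \<inter> A k) else fst x)"

lemma space_joint: "space joint = space (\<mu> \<Otimes>\<^sub>M choices)"
  by (rule sets_eq_imp_space_eq) simp

lemma space_jointD:
  assumes "x \<in> space (\<mu> \<Otimes>\<^sub>M choices)"
  shows "fst x \<in> configurations" "snd (snd x k) \<in> configurations"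
  using assms by (auto simp: space_pair_measure space_PiM space_\<mu> PiE_iff mem_Times_iff)

lemma transport_configurations:
  assumes "x \<in> space (\<mu> \<Otimes>\<^sub>M choices)"
  shows "transport x \<in> configurations"
  unfolding transport_def using space_jointD[OF assms]
  by (auto intro!: configurations_Un configurations_finite_UN
      intro: configurations_subset[OF space_jointD(1)[OF assms]] configurations_subset[OF space_jointD(2)[OF assms]])

lemma transport_Int_A: "finite (rejected x) \<Longrightarrow> transport x \<inter> A k = pick k x \<inter> A k"
  by (auto simp: transport_def pick_def rejected_def dest: A_disjoint)

lemma transport_void_iff:
  assumes "precompact_open V" "finite (rejected x)"
  shows "transport x \<inter> V = {} \<longleftrightarrow> (\<forall>k. pick k x \<inter> (A k \<inter> V) = {})"
proof -
  have "V \<subseteq> (\<Union>k. A k)" using cover[OF assms(1)] D_covers by blast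
  then have "transport x \<inter> V = {} \<longleftrightarrow> (\<forall>k. (transport x \<inter> A k) \<inter> V = {})" by blast
  then show ?thesis using transport_Int_A[OF assms(2)] by (simp add: Int_assoc)
qed

lemma void_A_sets[measurable]:
  assumes "precompact_open V"
  shows "void (A k \<inter> V) \<in> sets \<mu>"
proof -
  have "A k \<inter> V = (V \<inter> G k) - D k" by (auto simp: A_def)
  then show ?thesis
    using sets_void_Diff[OF precompact_open_Int[OF assms precompact_openD(1)[OF precompact]] open_D]
    by (simp add: sets_\<mu>)
qed

lemma pick_void_iff:
  assumes "x \<in> space (\<mu> \<Otimes>\<^sub>M choices)"
  shows "pick k x \<inter> B = {} \<longleftrightarrow> pick k x \<in> void B"
  using space_jointD[OF assms] by (auto simp: void_def pick_def)

lemma measurable_finite_rejected[measurable]: "Measurable.pred (\<mu> \<Otimes>\<^sub>M choices) (\<lambda>x. finite (rejected x))"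
proof -
  have "finite (rejected x) \<longleftrightarrow> (\<exists>n. \<forall>k. n \<le> k \<longrightarrow> fst (snd x k))" for x
    by (auto simp: rejected_def finite_nat_set_iff_bounded) (metis not_le)+
  then show ?thesis by simp
qed

lemma measurable_transport[measurable]: "transport \<in> \<mu> \<Otimes>\<^sub>M choices \<rightarrow>\<^sub>M \<mu>"
proof (rule measurable_configI[OF transport_configurations])
  fix V :: "'a set" assume V: "precompact_open V"
  have [measurable]: "void V \<in> sets \<mu>" using sets_void[OF V] by (simp add: sets_\<mu>)
  note [measurable] = void_A_sets[OF V]
  have "{x \<in> space (\<mu> \<Otimes>\<^sub>M choices). transport x \<inter> V = {}} =
      {x \<in> space (\<mu> \<Otimes>\<^sub>M choices). if finite (rejected x) then \<forall>k. pick k x \<in> void (A k \<inter> V) else fst x \<in> void V}"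
  proof (intro Collect_cong conj_cong refl)
    fix x assume x: "x \<in> space (\<mu> \<Otimes>\<^sub>M choices)"
    show "transport x \<inter> V = {} \<longleftrightarrow> (if finite (rejected x) then \<forall>k. pick k x \<in> void (A k \<inter> V) else fst x \<in> void V)"
    proof (cases "finite (rejected x)")
      case True
      then show ?thesis by (simp add: transport_void_iff[OF V] pick_void_iff[OF x])
    next
      case False
      then show ?thesis using space_jointD(1)[OF x] by (simp add: transport_def void_def)
    qed
  qed
  also have "\<dots> \<in> sets (\<mu> \<Otimes>\<^sub>M choices)" by measurable
  finally show "{x \<in> space (\<mu> \<Otimes>\<^sub>M choices). transport x \<inter> V = {}} \<in> sets (\<mu> \<Otimes>\<^sub>M choices)" .
qed

lemma emeasure_joint_space: "emeasure joint (space joint) = 1"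
proof -
  have "(\<integral>\<^sup>+ \<eta>. L \<eta> * emeasure (choice_law \<eta>) (space (choice_law \<eta>)) \<partial>\<mu>) = (\<integral>\<^sup>+ \<eta>. L \<eta> * 1 \<partial>\<mu>)"
    by (intro nn_integral_cong arg_cong2[where f="(*)"] refl prob_space.emeasure_space_1)
      (simp add: choice_law_def prob_space_PiM prob_space_cell_kernel)
  then show ?thesis
    using nn_integral_joint[of "\<lambda>_. 1"] by (simp add: L_1)
qed

lemma prob_space_joint: "prob_space joint"
  by (rule prob_spaceI) (rule emeasure_joint_space)

text \<open>The Borel--Cantelli lemma: by \<open>nn_integral_rejected\<close>, summable costs make the probabilities of rejection
  summable.\<close>

lemma AE_finite_rejected:
  assumes "(\<Sum>k. cost k) < \<infinity>"
  shows "AE x in joint. finite (rejected x)"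
proof -
  have [measurable]: "(\<lambda>x. if fst (snd x k) then 0 else 1 :: ennreal) \<in> borel_measurable joint" for k
    by measurable
  have "(\<integral>\<^sup>+ x. (\<Sum>k. if fst (snd x k) then 0 else 1) \<partial>joint) = (\<Sum>k. \<integral>\<^sup>+ x. (if fst (snd x k) then 0 else 1) \<partial>joint)"
    by (rule nn_integral_suminf) measurable
  also have "\<dots> \<le> (\<Sum>k. 2 * cost k)"
    by (intro suminf_le nn_integral_rejected) auto
  also have "\<dots> < \<infinity>" using assms by (simp add: ennreal_suminf_cmult ennreal_mult_less_top)
  finally have "(\<integral>\<^sup>+ x. (\<Sum>k. if fst (snd x k) then 0 else 1) \<partial>joint) \<noteq> \<infinity>" by simp
  then have "AE x in joint. (\<Sum>k. if fst (snd x k) then 0 else 1 :: ennreal) \<noteq> \<infinity>"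
    by (intro nn_integral_noteq_infinite) measurable
  then show ?thesis
  proof eventually_elim
    case (elim x)
    have "(\<Sum>k. if fst (snd x k) then 0 else 1 :: ennreal) = (\<integral>\<^sup>+ k. indicator (rejected x) k \<partial>count_space UNIV)"
      by (subst nn_integral_count_space_nat) (auto intro!: suminf_cong simp: rejected_def indicator_def)
    also have "\<dots> = emeasure (count_space UNIV) (rejected x)" by simp
    finally show ?case using elim by (metis emeasure_count_space_infinite subset_UNIV infinity_ennreal_def)
  qed
qed

lemma prod_emeasure_void_cells:
  assumes V: "precompact_open V"
  shows "(\<Prod>k<n. emeasure \<mu> (void (A k \<inter> V))) = emeasure \<mu> (void (V \<inter> D n))"
proof (induction n)
  case 0
  then show ?case using emeasure_space_1 by (simp add: D_0 void_def space_\<mu>)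
next
  case (Suc n)
  let ?B = "(V \<inter> G n) - D n"
  have VG: "precompact_open (V \<inter> G n)" using precompact_open_Int[OF V] precompact precompact_openD(1) by blast
  have VD: "precompact_open (V \<inter> D n)" for n using precompact_open_Int[OF V open_D] .
  have "measure \<sigma> (V \<inter> D (Suc n)) = measure \<sigma> ((V \<inter> D n) \<union> ?B)"
    by (rule arg_cong[where f="measure \<sigma>"]) (auto simp: D_Suc)
  also have "\<dots> = measure \<sigma> (V \<inter> D n) + measure \<sigma> ?B"
    using emeasure_finite[OF V Int_lower1, of "D n"] emeasure_finite[OF V, of ?B, OF subset_trans[OF Diff_subset Int_lower1]] precompact_openD(1)[OF VD] sets_Diff[OF VG open_D]
    by (intro measure_Union) (auto simp: sets_\<sigma>)
  finally have m: "measure \<sigma> (V \<inter> D (Suc n)) = measure \<sigma> (V \<inter> D n) + measure \<sigma> ?B" .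
  have "A n \<inter> V = ?B" by (auto simp: A_def)
  then show ?case
    by (simp add: Suc emeasure_void_precompact[OF VD] emeasure_void[OF VG open_D] m ennreal_mult[symmetric] exp_add[symmetric])
qed

text \<open>It suffices to consider void events. A void event is the decreasing intersection over \<open>n\<close> of the events
  that concern the first \<open>n\<close> cells, and on those \<open>emeasure_joint_cylinder\<close> and the Poisson process give
  the same products.\<close>

proposition distr_transport:
  assumes "(\<Sum>k. cost k) < \<infinity>"
  shows "distr joint \<mu> transport = \<mu>"
proof (rule measure_eqI_void[OF sigma_compact])
  interpret joint: prob_space joint by (rule prob_space_joint)
  show "finite_measure (distr joint \<mu> transport)"
    by (intro prob_space.finite_measure joint.prob_space_distr) measurable
  show "sets (distr joint \<mu> transport) = sets config_space" "sets \<mu> = sets config_space"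
    by (simp_all add: sets_\<mu>)
  fix V :: "'a set" assume V: "precompact_open V"
  have VD: "precompact_open (V \<inter> D n)" for n using precompact_open_Int[OF V open_D] .
  have void_V[measurable]: "void V \<in> sets \<mu>" using sets_void[OF V] by (simp add: sets_\<mu>)
  note [measurable] = void_A_sets[OF V]
  define E where "E n = {x \<in> space (\<mu> \<Otimes>\<^sub>M choices). \<forall>k<n. pick k x \<in> void (A k \<inter> V)}" for n
  have E[measurable]: "E n \<in> sets joint" for n unfolding E_def by measurable
  have "local_to (A k) (indicator (void (A k \<inter> V)))" for k
    unfolding local_to_def void_def by (auto simp: indicator_def)
  then have En: "emeasure joint (E n) = emeasure \<mu> (void (V \<inter> D n))" for n
    unfolding E_def prod_emeasure_void_cells[OF V, symmetric] by (intro emeasure_joint_cylinder) measurable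
  have "emeasure (distr joint \<mu> transport) (void V) = emeasure joint (transport -` void V \<inter> space joint)"
    by (rule emeasure_distr) measurable
  also have "\<dots> = emeasure joint (\<Inter>n. E n)"
  proof (rule emeasure_eq_AE)
    show "AE x in joint. x \<in> transport -` void V \<inter> space joint \<longleftrightarrow> x \<in> (\<Inter>n. E n)"
      using AE_finite_rejected[OF assms] AE_space
    proof eventually_elim
      case (elim x)
      then have x: "x \<in> space (\<mu> \<Otimes>\<^sub>M choices)" by (simp add: space_joint)
      have "x \<in> transport -` void V \<inter> space joint \<longleftrightarrow> transport x \<inter> V = {}"
        using x transport_configurations[OF x] by (auto simp: void_def space_joint)
      also have "\<dots> \<longleftrightarrow> (\<forall>k. pick k x \<in> void (A k \<inter> V))"
        unfolding transport_void_iff[OF V elim(1)] pick_void_iff[OF x] ..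
      also have "\<dots> \<longleftrightarrow> x \<in> (\<Inter>n. E n)" using x by (auto simp: E_def)
      finally show ?case .
    qed
  qed measurable
  finally have 1: "emeasure (distr joint \<mu> transport) (void V) = emeasure joint (\<Inter>n. E n)" .
  have "(\<lambda>n. emeasure joint (E n)) \<longlonglongrightarrow> emeasure joint (\<Inter>n. E n)"
    by (rule Lim_emeasure_decseq) (auto simp: decseq_def E_def)
  moreover have "(\<lambda>n. emeasure \<mu> (void (V \<inter> D n))) \<longlonglongrightarrow> emeasure \<mu> (\<Inter>n. void (V \<inter> D n))"
  proof (rule Lim_emeasure_decseq)
    show "range (\<lambda>n. void (V \<inter> D n)) \<subseteq> sets \<mu>" using sets_void[OF VD] by (auto simp: sets_\<mu>)
    show "decseq (\<lambda>n. void (V \<inter> D n))" using D_mono by (fastforce simp: decseq_def void_def)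
  qed simp
  moreover have "(\<Inter>n. void (V \<inter> D n)) = void V"
  proof -
    have "\<exists>n. x \<in> D n" if x: "x \<in> V" for x
    proof -
      obtain k where "x \<in> G k" using cover[OF V] x by auto
      then have "x \<in> D (Suc k)" by (simp add: D_Suc)
      then show ?thesis ..
    qed
    then have "(\<forall>n. \<omega> \<inter> (V \<inter> D n) = {}) \<longleftrightarrow> \<omega> \<inter> V = {}" for \<omega> by blast
    then show ?thesis by (auto simp: void_def)
  qed
  ultimately show "emeasure (distr joint \<mu> transport) (void V) = emeasure \<mu> (void V)"
    unfolding 1 En by (metis LIMSEQ_unique)
qed

lemma distr_fst: "distr joint (density \<mu> L) fst = density \<mu> L"
proof (rule measure_eqI)
  fix X assume "X \<in> sets (distr joint (density \<mu> L) fst)"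
  then have X[measurable]: "X \<in> sets \<mu>" by simp
  have "emeasure (distr joint (density \<mu> L) fst) X = (\<integral>\<^sup>+ x. indicator X (fst x) \<partial>joint)"
    by (subst nn_integral_distr[symmetric, where M'="density \<mu> L"]) simp_all
  also have "\<dots> = (\<integral>\<^sup>+ \<eta>. L \<eta> * (indicator X \<eta> * emeasure (choice_law \<eta>) (space (choice_law \<eta>))) \<partial>\<mu>)"
    by (subst nn_integral_joint) simp_all
  also have "\<dots> = (\<integral>\<^sup>+ \<eta>. L \<eta> * indicator X \<eta> \<partial>\<mu>)"
  proof (intro nn_integral_cong)
    fix \<eta> assume "\<eta> \<in> space \<mu>"
    then have "prob_space (choice_law \<eta>)" by (simp add: choice_law_def prob_space_PiM prob_space_cell_kernel)
    then show "L \<eta> * (indicator X \<eta> * emeasure (choice_law \<eta>) (space (choice_law \<eta>))) = L \<eta> * indicator X \<eta>"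
      by (simp add: prob_space.emeasure_space_1)
  qed
  also have "\<dots> = emeasure (density \<mu> L) X" by (subst emeasure_density) simp_all
  finally show "emeasure (distr joint (density \<mu> L) fst) X = emeasure (density \<mu> L) X" .
qed simp

lemma rho1_transport_le:
  assumes x: "x \<in> space (\<mu> \<Otimes>\<^sub>M choices)"
  shows "rho1 (transport x) (fst x) \<le> (\<Sum>k. defect k x)"
proof (cases "finite (rejected x)")
  case True
  define B where "B k = (if k \<in> rejected x then (fst x \<inter> A k) \<union> (snd (snd x k) \<inter> A k) else {})" for k
  have "sym_diff (transport x) (fst x) \<subseteq> (\<Union>k. B k)"
    using True by (auto simp: transport_def B_def split: if_splits)
  then have "rho1 (transport x) (fst x) \<le> emeasure (count_space UNIV) (\<Union>k. B k)"
    unfolding rho1_eq_card_sym_diff by (intro emeasure_mono) auto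
  also have "\<dots> \<le> (\<Sum>k. emeasure (count_space UNIV) (B k))"
    by (rule emeasure_subadditive_countably) auto
  also have "\<dots> \<le> (\<Sum>k. defect k x)"
  proof (rule suminf_le)
    fix k
    have fin: "finite (\<omega> \<inter> A k)" if "\<omega> \<in> configurations" for \<omega>
      using configurations_finite_precompact[OF that precompact[of k]] by (auto simp: A_def)
    show "emeasure (count_space UNIV) (B k) \<le> defect k x"
    proof (cases "k \<in> rejected x")
      case True
      have "emeasure (count_space UNIV) (B k) \<le> emeasure (count_space UNIV) (fst x \<inter> A k) + emeasure (count_space UNIV) (snd (snd x k) \<inter> A k)"
        using True by (simp add: B_def emeasure_subadditive)
      then show ?thesis
        using True fin[OF space_jointD(1)[OF x]] fin[OF space_jointD(2)[OF x, of k]]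
        by (simp add: emeasure_count_space_finite defect_def num_points_def rejected_def)
    qed (simp add: B_def)
  qed auto
  finally show ?thesis .
qed (simp add: transport_def rho1_def)

section \<open>Bounding the Rubinstein distance\<close>

proposition rubinstein_rho1_le_cost:
  assumes "(\<Sum>k. cost k) < \<infinity>"
  shows "rubinstein rho1 \<mu> (density \<mu> L) \<le> (\<Sum>k. cost k)"
proof -
  let ?\<nu> = "density \<mu> L"
  interpret joint: prob_space joint by (rule prob_space_joint)
  define \<gamma> where "\<gamma> = distr joint (\<mu> \<Otimes>\<^sub>M ?\<nu>) (\<lambda>x. (transport x, fst x))"
  have T[measurable]: "(\<lambda>x. (transport x, fst x)) \<in> joint \<rightarrow>\<^sub>M \<mu> \<Otimes>\<^sub>M ?\<nu>" by measurable
  have "\<gamma> \<in> couplings \<mu> ?\<nu>"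
    unfolding couplings_def
  proof (intro CollectI conjI)
    show "prob_space \<gamma>" unfolding \<gamma>_def by (rule joint.prob_space_distr) measurable
    show "sets \<gamma> = sets (\<mu> \<Otimes>\<^sub>M ?\<nu>)" by (simp add: \<gamma>_def)
    show "distr \<gamma> \<mu> fst = \<mu>"
      unfolding \<gamma>_def using distr_transport[OF assms] by (subst distr_distr) (simp_all add: comp_def)
    show "distr \<gamma> ?\<nu> snd = ?\<nu>"
      unfolding \<gamma>_def using distr_fst by (subst distr_distr) (simp_all add: comp_def)
  qed
  then have "rubinstein rho1 \<mu> ?\<nu> \<le> (\<integral>\<^sup>+ (\<omega>, \<eta>). rho1 \<omega> \<eta> \<partial>\<gamma>)"
    unfolding rubinstein_def by (rule INF_lower)
  also have "\<dots> \<le> (\<integral>\<^sup>+ x. rho1 (transport x) (fst x) \<partial>joint)"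
    unfolding \<gamma>_def using nn_integral_distr_le[OF T, of "\<lambda>(\<omega>, \<eta>). rho1 \<omega> \<eta>"] by simp
  also have "\<dots> \<le> (\<integral>\<^sup>+ x. (\<Sum>k. defect k x) \<partial>joint)"
    by (intro nn_integral_mono rho1_transport_le) (simp add: space_joint)
  also have "\<dots> = (\<Sum>k. cost k)"
    by (subst nn_integral_suminf) (simp_all add: nn_integral_defect)
  finally show ?thesis .
qed

text \<open>The cells are disjoint.\<close>

lemma sum_cell_gradient_le:
  "(\<Sum>k. cell_gradient (G k) (D k)) \<le> (\<integral>\<^sup>+ \<omega>. \<integral>\<^sup>+ x. grad x \<omega> \<partial>\<sigma> \<partial>\<mu>)"
proof -
  interpret p: pair_sigma_finite \<mu> \<sigma> ..
  have A[measurable]: "A k \<in> sets borel" for k unfolding A_def using sets_Diff[OF precompact open_D] .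
  have m: "(\<lambda>x. \<integral>\<^sup>+ \<omega>. grad x \<omega> \<partial>\<mu>) \<in> borel_measurable \<sigma>" by measurable
  have "(\<Sum>k. cell_gradient (G k) (D k)) = (\<integral>\<^sup>+ x. (\<Sum>k. indicator (A k) x * (\<integral>\<^sup>+ \<omega>. grad x \<omega> \<partial>\<mu>)) \<partial>\<sigma>)"
    unfolding cell_gradient_def[OF precompact open_D] A_def[symmetric]
    by (rule nn_integral_suminf[symmetric]) measurable
  also have "\<dots> \<le> (\<integral>\<^sup>+ x. \<integral>\<^sup>+ \<omega>. grad x \<omega> \<partial>\<mu> \<partial>\<sigma>)"
  proof (rule nn_integral_mono)
    fix x
    have "disjoint_family A" using A_disjoint by (auto simp: disjoint_family_on_def)
    then have "(\<Sum>k. indicator (A k) x :: ennreal) = indicator (\<Union>k. A k) x"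
      by (rule suminf_indicator)
    then show "(\<Sum>k. indicator (A k) x * (\<integral>\<^sup>+ \<omega>. grad x \<omega> \<partial>\<mu>)) \<le> (\<integral>\<^sup>+ \<omega>. grad x \<omega> \<partial>\<mu>)"
      by (simp add: ennreal_suminf_multc indicator_def)
  qed
  also have "\<dots> = (\<integral>\<^sup>+ \<omega>. \<integral>\<^sup>+ x. grad x \<omega> \<partial>\<sigma> \<partial>\<mu>)"
    by (rule p.Fubini') (simp add: split_beta)
  finally show ?thesis .
qed

proposition rubinstein_rho1_le_gradient:
  assumes small: "\<And>k. emeasure \<sigma> (G k) \<le> ennreal \<epsilon>" and \<epsilon>: "0 \<le> \<epsilon>" "\<epsilon> \<le> 1 / 4"
    and fin: "(\<integral>\<^sup>+ \<omega>. \<integral>\<^sup>+ x. grad x \<omega> \<partial>\<sigma> \<partial>\<mu>) < \<infinity>"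
  shows "rubinstein rho1 \<mu> (density \<mu> L) \<le> ennreal (1 + 4 * \<epsilon>) * (\<integral>\<^sup>+ \<omega>. \<integral>\<^sup>+ x. grad x \<omega> \<partial>\<sigma> \<partial>\<mu>)"
proof -
  have "emeasure \<sigma> (G k - D k) \<le> ennreal \<epsilon>" for k
  proof -
    have "emeasure \<sigma> (G k - D k) \<le> emeasure \<sigma> (G k)"
      using precompact_openD(1)[OF precompact[of k]] by (intro emeasure_mono) (auto simp: sets_\<sigma>)
    then show ?thesis using small[of k] by simp
  qed
  then have "(\<Sum>k. cost k) \<le> (\<Sum>k. ennreal (1 + 4 * \<epsilon>) * cell_gradient (G k) (D k))"
    using \<epsilon> by (intro suminf_le cell_cost_bound precompact open_D) auto
  also have "\<dots> = ennreal (1 + 4 * \<epsilon>) * (\<Sum>k. cell_gradient (G k) (D k))"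
    by (rule ennreal_suminf_cmult)
  also have "\<dots> \<le> ennreal (1 + 4 * \<epsilon>) * (\<integral>\<^sup>+ \<omega>. \<integral>\<^sup>+ x. grad x \<omega> \<partial>\<sigma> \<partial>\<mu>)"
    by (intro mult_left_mono sum_cell_gradient_le) simp
  finally have le: "(\<Sum>k. cost k) \<le> ennreal (1 + 4 * \<epsilon>) * (\<integral>\<^sup>+ \<omega>. \<integral>\<^sup>+ x. grad x \<omega> \<partial>\<sigma> \<partial>\<mu>)" .
  also have "\<dots> < \<infinity>" using fin by (simp add: ennreal_mult_less_top)
  finally show ?thesis using rubinstein_rho1_le_cost le by (meson order_trans)
qed

end

text \<open>Since \<open>\<sigma>\<close> is diffuse and finite on precompact sets, small balls around a point have small measure.
  Members of a countable base inside such balls cover all precompact open sets. The empty set is added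
  to make the family nonempty, which matters if no point has a compact neighbourhood.\<close>

lemma (in poisson_process) small_cover:
  assumes "\<epsilon> > 0"
  obtains G :: "nat \<Rightarrow> 'a set" where "\<And>k. precompact_open (G k)" "\<And>k. emeasure \<sigma> (G k) \<le> ennreal \<epsilon>"
    "\<And>V. precompact_open V \<Longrightarrow> V \<subseteq> (\<Union>k. G k)"
proof -
  obtain \<B> :: "'a set set" where cB: "countable \<B>" and bB: "topological_basis \<B>"
    using sigma_compact_countable_basis[OF sigma_compact] by blast
  define S where "S = insert {} {B \<in> \<B>. precompact_open B \<and> emeasure \<sigma> B \<le> ennreal \<epsilon>}"
  have S: "countable S" "S \<noteq> {}" using cB by (auto simp: S_def)
  define G where "G = from_nat_into S"
  have G: "G k \<in> S" for k unfolding G_def using S(2) by (rule from_nat_into)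
  have rangeG: "range G = S" unfolding G_def using S by (intro range_from_nat_into)
  show thesis
  proof (rule that[of G])
    show "precompact_open (G k)" "emeasure \<sigma> (G k) \<le> ennreal \<epsilon>" for k
      using G[of k] by (auto simp: S_def precompact_open_empty)
    fix V :: "'a set" assume V: "precompact_open V"
    show "V \<subseteq> (\<Union>k. G k)"
    proof
      fix x assume x: "x \<in> V"
      define W where "W n = ball x (1 / Suc n) \<inter> V" for n
      have oW: "open (W n)" for n using precompact_openD(1)[OF V] by (auto simp: W_def)
      have "(\<lambda>n. emeasure \<sigma> (W n)) \<longlonglongrightarrow> emeasure \<sigma> (\<Inter>n. W n)"
      proof (rule Lim_emeasure_decseq)
        show "range W \<subseteq> sets \<sigma>" using oW by (auto simp: sets_\<sigma>)
        show "decseq W"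
        proof (rule decseq_SucI)
          fix n
          have "1 / real (Suc (Suc n)) \<le> 1 / real (Suc n)" by (intro divide_left_mono) auto
          then show "W (Suc n) \<subseteq> W n" unfolding W_def by (intro Int_mono subset_ball) auto
        qed
        show "emeasure \<sigma> (W n) \<noteq> \<infinity>" for n
          using emeasure_finite[OF V, of "W n"] by (auto simp: W_def)
      qed
      moreover have "(\<Inter>n. W n) = {x}"
      proof (intro equalityI subsetI)
        fix y assume y: "y \<in> (\<Inter>n. W n)"
        have "dist x y < 1 / Suc n" for n using y by (auto simp: W_def)
        then have "\<not> dist x y > 0" using nat_approx_posE by (metis less_asym)
        then show "y \<in> {x}" by simp
      qed (use x in \<open>auto simp: W_def\<close>)
      moreover have "emeasure \<sigma> {x} = 0" using diffuse by (simp add: diffuse_measure_def)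
      ultimately have "(\<lambda>n. emeasure \<sigma> (W n)) \<longlonglongrightarrow> 0" by simp
      then have "\<forall>\<^sub>F n in sequentially. emeasure \<sigma> (W n) < ennreal \<epsilon>"
        using assms by (intro order_tendstoD(2)) auto
      then obtain n where n: "emeasure \<sigma> (W n) < ennreal \<epsilon>" by (auto simp: eventually_sequentially)
      have "x \<in> W n" using x by (simp add: W_def)
      then obtain B where B: "B \<in> \<B>" "x \<in> B" "B \<subseteq> W n"
        using topological_basisE[OF bB oW[of n]] by metis
      have "open B" using topological_basis_open[OF bB B(1)] .
      then have "precompact_open B" using precompact_open_subset[OF V] B(3) by (auto simp: W_def)
      moreover have "emeasure \<sigma> B \<le> emeasure \<sigma> (W n)"
        using B(3) oW by (intro emeasure_mono) (auto simp: sets_\<sigma>)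
      ultimately have "B \<in> S" using B(1) n by (auto simp: S_def)
      then show "x \<in> (\<Union>k. G k)" using B(2) rangeG by (metis UN_iff rangeE UNIV_I)
    qed
  qed
qed

theorem theorem3p2:
  fixes \<sigma> :: "'a::metric_space measure"
    and \<mu> \<nu> :: "'a set measure"
    and L :: "'a set \<Rightarrow> real"
  assumes "sigma_compact_space TYPE('a)"
    and "radon_measure \<sigma>"
    and "diffuse_measure \<sigma>"
    and "poisson_measure \<sigma> \<mu>"
    and "prob_space \<nu>"
    and "L \<in> borel_measurable \<mu>"
    and "AE \<omega> in \<mu>. 0 \<le> L \<omega>"
    and "\<nu> = density \<mu> (\<lambda>\<omega>. ennreal (L \<omega>))"
    and "L \<in> dom_gradient \<sigma> \<mu>"
    and "integrable (\<mu> \<Otimes>\<^sub>M \<sigma>) (\<lambda>(\<omega>, x). discrete_gradient L x \<omega>)"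
  shows "rubinstein rho1 \<mu> \<nu> \<le> (\<integral>\<^sup>+ \<omega>. \<integral>\<^sup>+ x. ennreal \<bar>discrete_gradient L x \<omega>\<bar> \<partial>\<sigma> \<partial>\<mu>) \<and>
         rubinstein rho0 \<mu> \<nu> \<le> (\<integral>\<^sup>+ \<omega>. \<integral>\<^sup>+ x. ennreal \<bar>discrete_gradient L x \<omega>\<bar> \<partial>\<sigma> \<partial>\<mu>)"
proof -
  interpret poisson_process \<sigma> \<mu> using assms by unfold_locales
  interpret \<nu>: prob_space \<nu> by fact
  let ?R = "\<integral>\<^sup>+ \<omega>. \<integral>\<^sup>+ x. ennreal \<bar>discrete_gradient L x \<omega>\<bar> \<partial>\<sigma> \<partial>\<mu>"
  have [measurable]: "(\<lambda>\<omega>. ennreal (L \<omega>)) \<in> borel_measurable \<mu>" using assms(6) by measurable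
  have "(\<integral>\<^sup>+ \<omega>. ennreal (L \<omega>) \<partial>\<mu>) = emeasure \<nu> (space \<nu>)"
    unfolding assms(8) by (subst emeasure_density) (auto intro!: nn_integral_cong)
  then interpret poisson_density \<sigma> \<mu> "\<lambda>\<omega>. ennreal (L \<omega>)"
    by unfold_locales (simp_all add: \<nu>.emeasure_space_1)
  have grad_le: "(\<integral>\<^sup>+ \<omega>. \<integral>\<^sup>+ x. grad x \<omega> \<partial>\<sigma> \<partial>\<mu>) \<le> ?R"
    unfolding grad_def discrete_gradient_def by (intro nn_integral_mono edist_ennreal_le)
  have "rubinstein rho1 \<mu> \<nu> \<le> ?R"
  proof (rule ennreal_le_epsilon)
    fix e :: real assume R: "?R < top" and e: "0 < e"
    obtain r where r: "?R = ennreal r" "0 \<le> r" using R by (cases ?R) auto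
    (* The excess 4 * \<epsilon> * r has to stay below e, and \<epsilon> below the threshold of the cell estimate. *)
    define \<epsilon> where "\<epsilon> = min (1 / 4) (e / (4 * (r + 1)))"
    have \<epsilon>: "0 < \<epsilon>" "\<epsilon> \<le> 1 / 4"
      unfolding \<epsilon>_def using e r(2) by (simp, intro min.cobounded1)
    have "\<epsilon> \<le> e / (4 * (r + 1))" unfolding \<epsilon>_def by (rule min.cobounded2)
    then have "\<epsilon> * (4 * (r + 1)) \<le> e"
      using r(2) by (subst (asm) pos_le_divide_eq) simp_all
    then have \<epsilon>r: "(1 + 4 * \<epsilon>) * r \<le> r + e" using \<epsilon>(1) by (simp add: algebra_simps)
    obtain G :: "nat \<Rightarrow> 'a set" where G: "\<And>k. precompact_open (G k)" "\<And>k. emeasure \<sigma> (G k) \<le> ennreal \<epsilon>"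
        "\<And>V. precompact_open V \<Longrightarrow> V \<subseteq> (\<Union>k. G k)"
      using small_cover[OF \<epsilon>(1)] by blast
    interpret poisson_cells \<sigma> \<mu> "\<lambda>\<omega>. ennreal (L \<omega>)" G
      using G by unfold_locales auto
    have "rubinstein rho1 \<mu> \<nu> \<le> ennreal (1 + 4 * \<epsilon>) * (\<integral>\<^sup>+ \<omega>. \<integral>\<^sup>+ x. grad x \<omega> \<partial>\<sigma> \<partial>\<mu>)"
      unfolding assms(8) using G(2) \<epsilon> grad_le R by (intro rubinstein_rho1_le_gradient) auto
    also have "\<dots> \<le> ennreal (1 + 4 * \<epsilon>) * ennreal r"
      using grad_le r by (intro mult_left_mono) auto
    also have "\<dots> = ennreal ((1 + 4 * \<epsilon>) * r)" using \<epsilon> by (intro ennreal_mult[symmetric] r) auto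
    also have "\<dots> \<le> ennreal (r + e)" using \<epsilon>r by (rule ennreal_leI)
    also have "\<dots> = ?R + ennreal e" using r e by simp
    finally show "rubinstein rho1 \<mu> \<nu> \<le> ?R + ennreal e" .
  qed
  moreover have "rubinstein rho0 \<mu> \<nu> \<le> rubinstein rho1 \<mu> \<nu>"
    by (rule rubinstein_mono[OF rho0_le_rho1])
  ultimately show ?thesis by auto
qed

end
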